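(* For all positive integers $a,b,s,x$ with $x\leq a$ and all integers $k_1,k_2,\dotsc,k_s$ with $0< k_1<k_2<\dots<k_s\le a/2$, we have $$ \operatorname{M}_{\odot}(H_{a,2b}(k_1,k_2,\dotsc,k_s)) = \operatorname{M}_{\odot,|}(H_{a,2b}(k_1,k_2,\dotsc,k_s))^2, $$ and $$ \operatorname{M}_{\odot}(H_{2a-1,2b}(k_1,k_2,\dotsc,k_s;2x-1)) = \operatorname{M}_{\odot,|}(H_{2a-1,2b}(k_1,k_2,\dotsc,k_s;2x-1))^2, $$ where $\odot$ denotes symmetry with respect to the center of the region (equivalently, invariance under rotation by $180^\circ$ around its center).
   Context: Work on the triangular lattice drawn so that one family of lattice lines is vertical. For a lattice region $R$, $\operatorname{M}(R)$ denotes the number of lozenge tilings of $R$, and $\operatorname{M}_{s_1,\dotsc,s_k}(R)$ denotes the number of lozenge tilings of $R$ invariant under the symmetries $s_1,\dotsc,s_k$; here $|$ denotes reflection across the vertical symmetry axis and $\odot$ denotes rotation by $180^\circ$ about the center. For positive integers $a,b,s$ and $0<k_1<\dots<k_s\le a/2$, $H_{a,2b}(k_1,\dotsc,k_s)$ is the region obtained from the hexagon with side lengths $a,a,2b,a,a,2b$ (clockwise, starting from the northwestern side) by removing $2s$ triangles of side-length two along its horizontal symmetry axis: $s$ left-pointing such triangles whose vertical sides are at distances $2k_1,\dotsc,2k_s$ from the left side of the hexagon (in units of $\sqrt{3}$ times the lattice spacing), together with their reflections across the vertical symmetry axis of the hexagon. When the first parameter is odd, $2a-1$, this region has a horizontal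 lattice rhombus of odd side-length at its center; for a positive integer $x\le a$, $H_{2a-1,2b}(k_1,\dotsc,k_s;2x-1)$ denotes the region obtained from $H_{2a-1,2b}(k_1,\dotsc,k_s)$ by removing from its center the horizontal lattice rhombus of side $2x-1$.
   Formalization: The distances 2k_1,…,2k_s of the vertical sides from the left side of the hexagon are measured in units of √3/2 (not √3) times the lattice spacing, so that k_s ≤ a/2 places the left-pointing triangles in the left half; with unit √3 the claim fails, e.g. for a=2, b=2, s=1, k_1=1 (6 versus 4²). *)

theory Defs
  imports Main
begin

text \<open>
Coordinates on the triangular lattice with one family of lattice lines vertical.
A point is (x, Y) :: int \<times> int, where x indexes the vertical lattice lines
(consecutive vertical lines are at distance sqrt 3 / 2 times the lattice spacing)
and Y is twice the vertical coordinate (in lattice-spacing units).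
Lattice points are exactly those with x + Y even. A unit triangle is represented
by the set of its three vertices; it is left-pointing ({(x,Y),(x+1,Y-1),(x+1,Y+1)})
or right-pointing ({(x,Y-1),(x,Y+1),(x+1,Y)}).
\<close>

type_synonym pt = "int \<times> int"

definition unit_tris :: "pt set set" where
  "unit_tris =
     {t. \<exists>x y. even (x + y) \<and> t = {(x, y), (x + 1, y - 1), (x + 1, y + 1)}}
   \<union> {t. \<exists>x y. odd (x + y) \<and> t = {(x, y - 1), (x, y + 1), (x + 1, y)}}"

text \<open>The unit triangles contained in a (lattice, convex) region given by a point predicate.\<close>
definition tris_in :: "(pt \<Rightarrow> bool) \<Rightarrow> pt set set" where
  "tris_in P = {t \<in> unit_tris. \<forall>v\<in>t. P v}"

definition lozenge_tilings :: "pt set set \<Rightarrow> pt set set set set" where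
  "lozenge_tilings R =
     {F. (\<forall>l\<in>F. \<exists>t1 t2. l = {t1, t2} \<and> t1 \<noteq> t2 \<and> card (t1 \<inter> t2) = 2)
       \<and> (\<forall>l1\<in>F. \<forall>l2\<in>F. l1 \<noteq> l2 \<longrightarrow> l1 \<inter> l2 = {})
       \<and> \<Union>F = R}"

definition map_tiling :: "(pt \<Rightarrow> pt) \<Rightarrow> pt set set set \<Rightarrow> pt set set set" where
  "map_tiling f F = (\<lambda>l. (\<lambda>t. f ` t) ` l) ` F"

definition M :: "pt set set \<Rightarrow> nat" where
  "M R = card (lozenge_tilings R)"

definition M_sym :: "(pt \<Rightarrow> pt) set \<Rightarrow> pt set set \<Rightarrow> nat" where
  "M_sym S R = card {F \<in> lozenge_tilings R. \<forall>f\<in>S. map_tiling f F = F}"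

text \<open>Hexagon with side lengths A, A, B, A, A, B (clockwise from the northwestern side):
  western side on line x = 0 from Y = 0 to Y = 2B, eastern side on x = 2A.
  Its center is (A, B).\<close>
definition hexagon :: "nat \<Rightarrow> nat \<Rightarrow> pt set set" where
  "hexagon A B = tris_in (\<lambda>(x, y). 0 \<le> x \<and> x \<le> 2 * int A
      \<and> - min x (2 * int A - x) \<le> y \<and> y \<le> 2 * int B + min x (2 * int A - x))"

definition refl_v :: "nat \<Rightarrow> pt \<Rightarrow> pt" where
  "refl_v A = (\<lambda>(x, y). (2 * int A - x, y))"

definition rot180 :: "nat \<Rightarrow> nat \<Rightarrow> pt \<Rightarrow> pt" where
  "rot180 A B = (\<lambda>(x, y). (2 * int A - x, 2 * int B - y))"

text \<open>Left-pointing triangle of side 2 on the horizontal axis Y = B whose vertical side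
  is on the line x = 2k (apex at (2k-2, B)), and its mirror image across x = A.\<close>
definition left_tri2 :: "nat \<Rightarrow> nat \<Rightarrow> pt set set" where
  "left_tri2 B k = tris_in (\<lambda>(x, y). 2 * int k - 2 \<le> x \<and> x \<le> 2 * int k
      \<and> \<bar>y - int B\<bar> \<le> x - (2 * int k - 2))"

definition right_tri2 :: "nat \<Rightarrow> nat \<Rightarrow> nat \<Rightarrow> pt set set" where
  "right_tri2 A B k = tris_in (\<lambda>(x, y). 2 * int A - 2 * int k \<le> x
      \<and> x \<le> 2 * int A - 2 * int k + 2
      \<and> \<bar>y - int B\<bar> \<le> (2 * int A - 2 * int k + 2) - x)"

definition H :: "nat \<Rightarrow> nat \<Rightarrow> nat set \<Rightarrow> pt set set" where
  "H A B K = hexagon A B - (\<Union>k\<in>K. left_tri2 B k \<union> right_tri2 A B k)"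

definition center_rhombus :: "nat \<Rightarrow> nat \<Rightarrow> nat \<Rightarrow> pt set set" where
  "center_rhombus A B n = tris_in (\<lambda>(x, y). \<bar>x - int A\<bar> + \<bar>y - int B\<bar> \<le> int n)"

definition H_rh :: "nat \<Rightarrow> nat \<Rightarrow> nat set \<Rightarrow> nat \<Rightarrow> pt set set" where
  "H_rh A B K n = H A B K - center_rhombus A B n"

end

theory Submission
  imports Defs "Jordan_Normal_Form.Determinant"
begin

text \<open>
The lozenges with two vertical sides form paths that run from left to right. A centrally symmetric
tiling is determined by its left half, that is by a family of nonintersecting paths whose set of end
points on the vertical axis is of the form \<open>T \<union> -T\<close>; it is also invariant under reflection iff the
whole family is symmetric, that is iff it is the double of a family of paths in the upper half plane
that ends in \<open>T\<close>. If \<open>P\<close> counts free paths from the starting points \<open>u\<close>, the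
Lindstroem--Gessel--Viennot determinants are \<open>det X\<^sub>T\<close> in the latter and \<open>det X\<^sub>T det Z\<^sub>T\<close> in the former
case, with rows \<open>X(v) = P(u,v) - P(u,-v)\<close> and \<open>Z(v) = P(u,v) + P(u,-v)\<close>. Up to a unitriangular change
of rows, \<open>Z(v) = X(v) + 2 \<Sum>\<^bsub>p > v\<^esub> X(p)\<close>. Hence, by Cauchy--Binet, \<open>\<Sum>\<^sub>T det X\<^sub>T det Z\<^sub>T\<close> is the determinant
of the Gram matrix of the rows of \<open>X\<close> under \<open>\<langle>x, y\<rangle> = \<Sum>\<^bsub>v < p\<^esub> (x\<^sub>v y\<^sub>p - x\<^sub>p y\<^sub>v) + (\<Sum> x) (\<Sum> y)\<close>, which is the
square of a Pfaffian, and this Pfaffian is \<open>\<Sum>\<^sub>T det X\<^sub>T\<close>.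
\<close>

section \<open>Minors of families of functions\<close>

text \<open>The paths may be counted as free paths although the region has holes, because
  nonintersection does the work: a path that ran into a removed triangle would have to leave it
  through an entrance that is already occupied, and a path that ran into the rhombus could no longer
  reach an admissible end point. Parity does the rest: all positions on a vertical line have the
  same parity, so paths cannot cross without meeting, and on the even lines that carry the sides of
  the triangles nothing fits between the entrances 1 and -1. The sum of the minors is a Pfaffian
  because the sign matrix of the order has Pfaffian 1 on every even set of columns. Its square is
  reached by contraction in the exterior algebra, which splits off a hyperbolic plane from the sum
  of minors exactly as elimination does from the Gram determinant. The form on the rows is
  alternating only up to a symmetric part of rank one, and a bordered determinant separates the two.
  For an even number of rows the border contributes zero; for an odd number the alternating part
  does, and the border then acts as one more column, below all others.\<close>

definition ldet :: "nat \<Rightarrow> (nat \<Rightarrow> 'b \<Rightarrow> 'a::comm_ring_1) \<Rightarrow> (nat \<Rightarrow> 'b) \<Rightarrow> 'a" where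
  "ldet m \<phi> v = det (mat m m (\<lambda>(i,j). \<phi> i (v j)))"

text \<open>Only meaningful if \<open>card S = m\<close>: otherwise \<open>nth\<close> runs off the sorted list.\<close>

definition sdet :: "nat \<Rightarrow> (nat \<Rightarrow> 'b::linorder \<Rightarrow> 'a::comm_ring_1) \<Rightarrow> 'b set \<Rightarrow> 'a" where
  "sdet m \<phi> S = ldet m \<phi> (nth (sorted_list_of_set S))"

lemma ldet_cong:
  assumes "\<And>i j. i < m \<Longrightarrow> j < m \<Longrightarrow> \<phi> i (v j) = \<psi> i (w j)"
  shows "ldet m \<phi> v = ldet m \<psi> w"
  unfolding ldet_def by (rule arg_cong[where f = det], rule eq_matI) (auto simp: assms)

lemma sorted_list_of_set_nth_mem:
  assumes "finite S" "card S = m" "j < m"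
  shows "sorted_list_of_set S ! j \<in> S"
  using assms by (metis length_sorted_list_of_set nth_mem set_sorted_list_of_set)

lemma sdet_cong:
  assumes "finite S" "card S = m" "\<And>i v. i < m \<Longrightarrow> v \<in> S \<Longrightarrow> \<phi> i v = \<psi> i v"
  shows "sdet m \<phi> S = sdet m \<psi> S"
  unfolding sdet_def by (rule ldet_cong) (use assms sorted_list_of_set_nth_mem in blast)

lemma permutes_less_bound: "p permutes {0..<m} \<Longrightarrow> i < m \<Longrightarrow> p i < (m::nat)"
  using permutes_in_image[of p "{0..<m}" i] by simp

lemma ldet_leibniz:
  "ldet m \<phi> v = (\<Sum>p | p permutes {0..<m}. signof p * (\<Prod>j=0..<m. \<phi> (p j) (v j)))"
proof -
  have "ldet m \<phi> v = (\<Sum>p | p permutes {0..<m}. signof p *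
      (\<Prod>j=0..<m. mat m m (\<lambda>(i,j). \<phi> i (v j)) $$ (p j, j)))"
    unfolding ldet_def by (subst det_col[of _ m]) (simp_all add: atLeast0LessThan)
  also have "\<dots> = (\<Sum>p | p permutes {0..<m}. signof p * (\<Prod>j=0..<m. \<phi> (p j) (v j)))"
    by (intro sum.cong prod.cong arg_cong2[where f = "(*)"] refl)
      (auto simp: dest: permutes_less_bound)
  finally show ?thesis .
qed

lemma ldet_leibniz_row:
  "ldet m \<phi> v = (\<Sum>p | p permutes {0..<m}. signof p * (\<Prod>i=0..<m. \<phi> i (v (p i))))"
  unfolding ldet_def
  by (subst det_def'[of _ m], simp, intro sum.cong prod.cong arg_cong2[where f = "(*)"] refl)
      (auto dest: permutes_less_bound)

lemma ldet_not_inj: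
  fixes \<phi> :: "nat \<Rightarrow> 'b \<Rightarrow> 'a::comm_ring_1"
  assumes "i < m" "j < m" "i \<noteq> j" "v i = v j"
  shows "ldet m \<phi> v = 0"
  unfolding ldet_def
  by (rule det_identical_columns[of _ m i j]) (use assms in \<open>auto intro!: eq_vecI\<close>)

lemma ldet_permute_cols:
  fixes \<phi> :: "nat \<Rightarrow> 'b \<Rightarrow> 'a::comm_ring_1"
  assumes p: "p permutes {0..<m}"
  shows "ldet m \<phi> (\<lambda>j. v (p j)) = signof p * ldet m \<phi> v"
proof -
  let ?A = "mat m m (\<lambda>(j,i). \<phi> i (v j))"
  have T: "ldet m \<phi> w = det (mat m m (\<lambda>(j,i). \<phi> i (w j)))" for w
    unfolding ldet_def
    by (subst det_transpose[symmetric, of _ m], simp, rule arg_cong[where f = det], rule eq_matI) auto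
  have "det (mat m m (\<lambda>(i,j). ?A $$ (p i, j))) = signof p * det ?A"
    by (rule det_permute_rows[OF _ p]) simp
  also have "mat m m (\<lambda>(i,j). ?A $$ (p i, j)) = mat m m (\<lambda>(j,i). \<phi> i (v (p j)))"
    by (rule eq_matI) (use p in \<open>auto dest: permutes_less_bound\<close>)
  finally show ?thesis by (simp add: T)
qed

text \<open>The position of a column in the sorted list is the number of smaller elements. With the
  sign written in this way, all later sign computations concern sets and their order only.\<close>

lemma sdet_laplace:
  assumes S: "finite S" "card S = m" and i: "i < m"
  shows "sdet m \<phi> S = (\<Sum>v\<in>S. (- 1) ^ (i + card {u\<in>S. u < v}) * \<phi> i v *
           sdet (m - 1) (\<lambda>k. \<phi> (if k < i then k else Suc k)) (S - {v}))"
proof -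
  let ?l = "sorted_list_of_set S"
  let ?A = "mat m m (\<lambda>(i,j). \<phi> i (?l ! j))"
  have len: "length ?l = m" using S by simp
  have bij: "bij_betw (nth ?l) {..<m} S"
    using bij_betw_nth[of ?l "{..<m}" S] S by simp
  have below: "card {u\<in>S. u < ?l ! j} = j" if "j < m" for j
  proof -
    have "{u\<in>S. u < ?l ! j} = nth ?l ` {..<j}"
    proof (intro equalityI subsetI)
      fix u assume "u \<in> {u\<in>S. u < ?l ! j}"
      then have "u \<in> nth ?l ` {..<m}" "u < ?l ! j" using bij by (auto simp: bij_betw_def)
      then obtain k where k: "k < m" "u = ?l ! k" "?l ! k < ?l ! j" by blast
      have "k < j" by (metis k(1,3) len linorder_not_le sorted_list_of_set.sorted_sorted_key_list_of_set sorted_nth_mono that leD)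
      then show "u \<in> nth ?l ` {..<j}" using k by auto
    next
      fix u assume "u \<in> nth ?l ` {..<j}"
      then obtain k where "k < j" "u = ?l ! k" by auto
      then show "u \<in> {u\<in>S. u < ?l ! j}" using that len S bij
        by (auto simp: bij_betw_def sorted_wrt_nth_less[OF strict_sorted_list_of_set])
    qed
    moreover have "inj_on (nth ?l) {..<j}" using bij that
      by (auto simp: bij_betw_def intro: inj_on_subset)
    ultimately show ?thesis by (simp add: card_image)
  qed
  have del: "sorted_list_of_set (S - {?l ! j}) = take j ?l @ drop (Suc j) ?l" if "j < m" for j
  proof -
    have "sorted_list_of_set (S - {?l ! j}) = remove1 (?l ! j) ?l"
      using S by (simp add: sorted_list_of_set.sorted_key_list_of_set_remove)
    also have "?l = take j ?l @ ?l ! j # drop (Suc j) ?l"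
      using that len by (simp add: id_take_nth_drop)
    then have "remove1 (?l ! j) ?l = remove1 (?l ! j) (take j ?l @ ?l ! j # drop (Suc j) ?l)" by simp
    also have "?l ! j \<notin> set (take j ?l)"
    proof
      assume "?l ! j \<in> set (take j ?l)"
      then obtain k where "k < j" "?l ! k = ?l ! j" using that len by (auto simp: in_set_conv_nth)
      then show False using bij that by (auto simp: bij_betw_def inj_on_def)
    qed
    then have "remove1 (?l ! j) (take j ?l @ ?l ! j # drop (Suc j) ?l) = take j ?l @ drop (Suc j) ?l"
      by (simp add: remove1_append)
    finally show ?thesis .
  qed
  have minor: "det (mat_delete ?A i j) = sdet (m - 1) (\<lambda>k. \<phi> (if k < i then k else Suc k)) (S - {?l ! j})"
    if j: "j < m" for j
    unfolding sdet_def ldet_def del[OF j]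
    by (rule arg_cong[where f = det], rule eq_matI)
       (use j i len in \<open>auto simp: mat_delete_def nth_append min_def\<close>)
  have "sdet m \<phi> S = (\<Sum>j<m. ?A $$ (i,j) * cofactor ?A i j)"
    unfolding sdet_def ldet_def by (rule laplace_expansion_row) (use i in auto)
  also have "\<dots> = (\<Sum>j<m. (- 1) ^ (i + card {u\<in>S. u < ?l ! j}) * \<phi> i (?l ! j) *
           sdet (m - 1) (\<lambda>k. \<phi> (if k < i then k else Suc k)) (S - {?l ! j}))"
    by (rule sum.cong) (use i in \<open>auto simp: cofactor_def minor below\<close>)
  also have "\<dots> = (\<Sum>v\<in>S. (- 1) ^ (i + card {u\<in>S. u < v}) * \<phi> i v *
           sdet (m - 1) (\<lambda>k. \<phi> (if k < i then k else Suc k)) (S - {v}))"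
    by (rule sum.reindex_bij_betw[OF bij])
  finally show ?thesis .
qed

lemma sorted_list_of_set_image:
  fixes w :: "nat \<Rightarrow> 'b::linorder"
  assumes "\<And>i j. i < j \<Longrightarrow> j < m \<Longrightarrow> w i < w j"
  shows "sorted_list_of_set (w ` {0..<m}) = map w [0..<m]"
proof -
  have s: "sorted_wrt (<) (map w [0..<m])"
    using assms by (auto simp: sorted_wrt_iff_nth_less)
  then have "sorted_list_of_set (set (map w [0..<m])) = map w [0..<m]"
    using strict_sorted_iff[of "map w [0..<m]"]
    by (intro sorted_list_of_set.idem_if_sorted_distinct) auto
  then show ?thesis by simp
qed

text \<open>Multiplying out the sums gives one term for each map from the rows to \<open>V\<close>.
  A map that repeats a value yields a determinant with two equal columns. The injective maps with
  image \<open>T\<close> are the enumeration of \<open>T\<close> composed with permutations, whose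
  signs complete the first minor.\<close>

lemma cauchy_binet:
  fixes \<phi> \<chi> :: "nat \<Rightarrow> 'b::linorder \<Rightarrow> 'a::comm_ring_1"
  assumes V: "finite V"
  shows "det (mat m m (\<lambda>(i,j). \<Sum>v\<in>V. \<phi> i v * \<chi> j v)) =
         (\<Sum>T | T \<subseteq> V \<and> card T = m. sdet m \<phi> T * sdet m \<chi> T)"
proof -
  let ?I = "{0..<m}"
  let ?P = "{p. p permutes ?I}"
  let ?E = "?I \<rightarrow>\<^sub>E V"
  let ?J = "{f\<in>?E. inj_on f ?I}"
  have finE: "finite ?E" using V by (simp add: finite_PiE)
  have inner: "(\<Sum>f | f \<in> ?J \<and> f ` ?I = T. (\<Prod>i\<in>?I. \<phi> i (f i)) * ldet m \<chi> f) = sdet m \<phi> T * sdet m \<chi> T"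
    if T: "T \<subseteq> V" "card T = m" for T
  proof -
    define e where "e = nth (sorted_list_of_set T)"
    have finT: "finite T" using T V finite_subset by blast
    have e: "bij_betw e ?I T"
      using bij_betw_nth[of "sorted_list_of_set T" ?I T] T finT by (auto simp: e_def atLeast0LessThan)
    have bij: "bij_betw (\<lambda>p. restrict (\<lambda>i. e (p i)) ?I) ?P {f. f \<in> ?J \<and> f ` ?I = T}"
    proof (rule bij_betwI')
      fix p q assume pq: "p \<in> ?P" "q \<in> ?P"
      show "(restrict (\<lambda>i. e (p i)) ?I = restrict (\<lambda>i. e (q i)) ?I) = (p = q)"
      proof
        assume eq: "restrict (\<lambda>i. e (p i)) ?I = restrict (\<lambda>i. e (q i)) ?I"
        have "p i = q i" for i
        proof (cases "i < m")
          case True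
          then have "e (p i) = e (q i)" using fun_cong[OF eq, of i] by simp
          then show ?thesis using e True pq permutes_less_bound
            by (auto simp: bij_betw_def inj_on_def)
        next
          case False
          then show ?thesis using pq by (auto simp: permutes_def)
        qed
        then show "p = q" by blast
      qed auto
    next
      fix p assume p: "p \<in> ?P"
      then have pb: "bij_betw p ?I ?I" by (simp add: permutes_imp_bij)
      have "bij_betw (e \<circ> p) ?I T" using bij_betw_trans[OF pb e] .
      then have g: "inj_on (\<lambda>i. e (p i)) ?I" "(\<lambda>i. e (p i)) ` ?I = T"
        by (simp_all add: bij_betw_def comp_def)
      have "restrict (\<lambda>i. e (p i)) ?I \<in> ?E"
        by (rule restrict_PiE_iff[THEN iffD2]) (use g(2) T in blast)
      then show "restrict (\<lambda>i. e (p i)) ?I \<in> {f. f \<in> ?J \<and> f ` ?I = T}"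
        using g by (simp add: inj_on_restrict_eq image_restrict_eq)
    next
      fix f assume f: "f \<in> {f. f \<in> ?J \<and> f ` ?I = T}"
      then have fb: "bij_betw f ?I T" by (auto simp: bij_betw_def)
      define p where "p = (\<lambda>i. if i < m then inv_into ?I e (f i) else i)"
      have "bij_betw (inv_into ?I e \<circ> f) ?I ?I"
        using bij_betw_trans[OF fb bij_betw_inv_into[OF e]] .
      then have "bij_betw p ?I ?I"
        by (rule bij_betw_cong[THEN iffD1, rotated]) (auto simp: p_def)
      then have "p permutes ?I" by (intro bij_imp_permutes) (auto simp: p_def)
      moreover have "f = restrict (\<lambda>i. e (p i)) ?I"
      proof
        fix i show "f i = restrict (\<lambda>i. e (p i)) ?I i"
        proof (cases "i < m")
          case True
          then have "f i \<in> T" using fb by (auto simp: bij_betw_def)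
          then show ?thesis using True by (simp add: p_def bij_betw_inv_into_right[OF e])
        next
          case False
          have "f \<in> ?E" using f unfolding mem_Collect_eq by (elim conjE)
          then have "f i = undefined" using False by (intro PiE_arb) auto
          then show ?thesis using False by simp
        qed
      qed
      ultimately show "\<exists>p\<in>?P. f = restrict (\<lambda>i. e (p i)) ?I" by (intro bexI[of _ p] CollectI)
    qed
    have "(\<Sum>f | f \<in> ?J \<and> f ` ?I = T. (\<Prod>i\<in>?I. \<phi> i (f i)) * ldet m \<chi> f) =
      (\<Sum>p\<in>?P. (\<Prod>i\<in>?I. \<phi> i (restrict (\<lambda>i. e (p i)) ?I i)) * ldet m \<chi> (restrict (\<lambda>i. e (p i)) ?I))"
      by (rule sum.reindex_bij_betw[OF bij, symmetric])
    also have "\<dots> = (\<Sum>p\<in>?P. (\<Prod>i\<in>?I. \<phi> i (e (p i))) * (signof p * ldet m \<chi> e))"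
    proof (rule sum.cong[OF refl])
      fix p assume p: "p \<in> ?P"
      have "ldet m \<chi> (restrict (\<lambda>i. e (p i)) ?I) = ldet m \<chi> (\<lambda>i. e (p i))"
        by (rule ldet_cong) auto
      also have "\<dots> = signof p * ldet m \<chi> e" using p by (intro ldet_permute_cols) simp
      finally show "(\<Prod>i\<in>?I. \<phi> i (restrict (\<lambda>i. e (p i)) ?I i)) * ldet m \<chi> (restrict (\<lambda>i. e (p i)) ?I) =
        (\<Prod>i\<in>?I. \<phi> i (e (p i))) * (signof p * ldet m \<chi> e)" by simp
    qed
    also have "\<dots> = ldet m \<phi> e * ldet m \<chi> e"
      unfolding ldet_leibniz_row[of m \<phi> e] sum_distrib_right
      by (rule sum.cong) (auto simp: mult_ac)
    finally show ?thesis by (simp add: sdet_def e_def)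
  qed
  have "det (mat m m (\<lambda>(i,j). \<Sum>v\<in>V. \<phi> i v * \<chi> j v)) =
    (\<Sum>p\<in>?P. signof p * (\<Prod>i\<in>?I. \<Sum>v\<in>V. \<phi> i v * \<chi> (p i) v))"
    by (subst det_def'[of _ m], simp, intro sum.cong prod.cong arg_cong2[where f = "(*)"] refl)
      (auto dest: permutes_less_bound)
  also have "\<dots> = (\<Sum>p\<in>?P. signof p * (\<Sum>f\<in>?E. \<Prod>i\<in>?I. \<phi> i (f i) * \<chi> (p i) (f i)))"
    using V by (simp add: prod_sum_PiE)
  also have "\<dots> = (\<Sum>f\<in>?E. \<Sum>p\<in>?P. signof p * (\<Prod>i\<in>?I. \<phi> i (f i) * \<chi> (p i) (f i)))"
    unfolding sum_distrib_left by (rule sum.swap)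
  also have "\<dots> = (\<Sum>f\<in>?E. (\<Prod>i\<in>?I. \<phi> i (f i)) * ldet m \<chi> f)"
    unfolding ldet_leibniz sum_distrib_left
    by (intro sum.cong refl) (simp add: prod.distrib mult_ac)
  also have "\<dots> = (\<Sum>f\<in>?J. (\<Prod>i\<in>?I. \<phi> i (f i)) * ldet m \<chi> f)"
  proof (rule sum.mono_neutral_right[OF finE])
    show "\<forall>f\<in>?E - ?J. (\<Prod>i\<in>?I. \<phi> i (f i)) * ldet m \<chi> f = 0"
    proof
      fix f assume "f \<in> ?E - ?J"
      then obtain i j where "i < m" "j < m" "i \<noteq> j" "f i = f j" by (auto simp: inj_on_def)
      then have "ldet m \<chi> f = 0" by (rule ldet_not_inj)
      then show "(\<Prod>i\<in>?I. \<phi> i (f i)) * ldet m \<chi> f = 0" by simp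
    qed
  qed auto
  also have "\<dots> = (\<Sum>T | T \<subseteq> V \<and> card T = m. \<Sum>f | f \<in> ?J \<and> f ` ?I = T. (\<Prod>i\<in>?I. \<phi> i (f i)) * ldet m \<chi> f)"
    by (rule sum.group[symmetric]) (use V finE in \<open>auto simp: card_image\<close>)
  also have "\<dots> = (\<Sum>T | T \<subseteq> V \<and> card T = m. sdet m \<phi> T * sdet m \<chi> T)"
    by (rule sum.cong) (use inner in auto)
  finally show ?thesis .
qed

text \<open>Only the existence of the bijection is recorded. For finite sets it is unique
  (\<open>moves_unique\<close>), so a sequence of sets determines the paths that run through
  it.\<close>

definition step :: "int set \<Rightarrow> int set \<Rightarrow> bool" where
  "step S S' \<longleftrightarrow> (\<exists>f. bij_betw f S S' \<and> (\<forall>v\<in>S. f v = v + 1 \<or> f v = v - 1))"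

text \<open>Multilinearity splits each column into its lower and its upper neighbour. Columns of
  equal parity are at distance at least two, so the shifted columns stay weakly ordered: either two
  of them coincide and the minor vanishes, or the order is preserved and no sign appears. This takes
  the place of the involution that switches the tails of intersecting paths.\<close>

lemma sdet_step:
  fixes \<phi> :: "nat \<Rightarrow> int \<Rightarrow> 'a::comm_ring_1"
  assumes S': "finite S'" "card S' = m" and par: "\<And>u v. u \<in> S' \<Longrightarrow> v \<in> S' \<Longrightarrow> even (u - v)"
  shows "sdet m (\<lambda>i w. \<phi> i (w - 1) + \<phi> i (w + 1)) S' = (\<Sum>S | step S S'. sdet m \<phi> S)"
proof -
  let ?I = "{0..<m}"
  let ?P = "{p. p permutes ?I}"
  define e where "e = nth (sorted_list_of_set S')"
  \<comment> \<open>\<open>X\<close> is the set of the columns that are shifted downwards.\<close>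
  define w where "w = (\<lambda>X j. if j \<in> X then e j - 1 else e j + 1)"
  have e: "bij_betw e ?I S'"
    using bij_betw_nth[of "sorted_list_of_set S'" ?I S'] S' by (auto simp: e_def atLeast0LessThan)
  have e_less: "e i + 2 \<le> e j" if "i < j" "j < m" for i j
  proof -
    have "e i < e j" using that S' unfolding e_def
      by (intro sorted_wrt_nth_less[OF strict_sorted_list_of_set]) auto
    moreover have "even (e j - e i)" using that e by (intro par) (auto simp: bij_betw_def)
    ultimately show ?thesis by presburger
  qed
  have w_le: "w X i \<le> w X j" if "i < j" "j < m" for X i j
    using e_less[OF that] by (auto simp: w_def)
  let ?G = "{X\<in>Pow ?I. inj_on (w X) ?I}"
  have w_less: "w X i < w X j" if "X \<in> ?G" "i < j" "j < m" for X i j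
  proof -
    have "w X i \<noteq> w X j" using inj_onD[of "w X" ?I i j] that by auto
    then show ?thesis using w_le[OF that(2,3), of X] by simp
  qed
  have srt: "sorted_list_of_set (w X ` ?I) = map (w X) [0..<m]" if "X \<in> ?G" for X
    by (rule sorted_list_of_set_image) (use w_less[OF that] in auto)
  have "sdet m (\<lambda>i w. \<phi> i (w - 1) + \<phi> i (w + 1)) S' =
     (\<Sum>p\<in>?P. signof p * (\<Prod>j\<in>?I. \<phi> (p j) (e j - 1) + \<phi> (p j) (e j + 1)))"
    by (simp add: sdet_def e_def ldet_leibniz)
  also have "\<dots> = (\<Sum>p\<in>?P. signof p * (\<Sum>X\<in>Pow ?I. \<Prod>j\<in>?I. \<phi> (p j) (w X j)))"
  proof (intro sum.cong arg_cong2[where f = "(*)"] refl)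
    fix p
    have "(\<Prod>j\<in>?I. \<phi> (p j) (e j - 1) + \<phi> (p j) (e j + 1)) =
      (\<Sum>X\<in>Pow ?I. (\<Prod>j\<in>X. \<phi> (p j) (e j - 1)) * (\<Prod>j\<in>?I - X. \<phi> (p j) (e j + 1)))"
      by (rule prod_add) simp
    also have "\<dots> = (\<Sum>X\<in>Pow ?I. \<Prod>j\<in>?I. \<phi> (p j) (w X j))"
    proof (rule sum.cong[OF refl])
      fix X assume X: "X \<in> Pow ?I"
      have "(\<Prod>j\<in>?I. \<phi> (p j) (w X j)) = (\<Prod>j\<in>?I - X. \<phi> (p j) (w X j)) * (\<Prod>j\<in>X. \<phi> (p j) (w X j))"
        using X by (intro prod.subset_diff) auto
      then show "(\<Prod>j\<in>X. \<phi> (p j) (e j - 1)) * (\<Prod>j\<in>?I - X. \<phi> (p j) (e j + 1)) =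
          (\<Prod>j\<in>?I. \<phi> (p j) (w X j))"
        by (simp add: w_def mult.commute)
    qed
    finally show "(\<Prod>j\<in>?I. \<phi> (p j) (e j - 1) + \<phi> (p j) (e j + 1)) =
      (\<Sum>X\<in>Pow ?I. \<Prod>j\<in>?I. \<phi> (p j) (w X j))" .
  qed
  also have "\<dots> = (\<Sum>X\<in>Pow ?I. ldet m \<phi> (w X))"
    unfolding ldet_leibniz sum_distrib_left by (rule sum.swap)
  also have "\<dots> = (\<Sum>X\<in>?G. ldet m \<phi> (w X))"
  proof (rule sum.mono_neutral_right)
    show "\<forall>X\<in>Pow ?I - ?G. ldet m \<phi> (w X) = 0"
      by (auto simp: inj_on_def intro: ldet_not_inj)
  qed auto
  also have "\<dots> = (\<Sum>X\<in>?G. sdet m \<phi> (w X ` ?I))"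
    by (rule sum.cong[OF refl], unfold sdet_def, rule ldet_cong) (use srt in auto)
  also have "\<dots> = (\<Sum>S | step S S'. sdet m \<phi> S)"
  proof (rule sum.reindex_bij_betw, rule bij_betwI')
    fix X Y assume XY: "X \<in> ?G" "Y \<in> ?G"
    show "(w X ` ?I = w Y ` ?I) = (X = Y)"
    proof
      assume "w X ` ?I = w Y ` ?I"
      then have "map (w X) [0..<m] = map (w Y) [0..<m]" using srt XY by metis
      then have "w X j = w Y j" if "j < m" for j using that by (simp add: list_eq_iff_nth_eq)
      then have "j \<in> X \<longleftrightarrow> j \<in> Y" if "j < m" for j using that by (force simp: w_def split: if_splits)
      then show "X = Y" using XY by (auto simp: subset_iff)
    qed simp
  next
    fix X assume X: "X \<in> ?G"
    let ?f = "\<lambda>v. e (inv_into ?I (w X) v)"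
    have b: "bij_betw (w X) ?I (w X ` ?I)" using X by (auto simp: bij_betw_def)
    have "bij_betw (e \<circ> inv_into ?I (w X)) (w X ` ?I) S'"
      by (rule bij_betw_trans[OF bij_betw_inv_into[OF b] e])
    moreover have "(e \<circ> inv_into ?I (w X)) v = v + 1 \<or> (e \<circ> inv_into ?I (w X)) v = v - 1" if v: "v \<in> w X ` ?I" for v
    proof -
      from v obtain j where "j \<in> ?I" "v = w X j" by blast
      then show ?thesis using bij_betw_inv_into_left[OF b, of j] by (auto simp: w_def)
    qed
    ultimately show "w X ` ?I \<in> {S. step S S'}" unfolding step_def by blast
  next
    fix S assume "S \<in> {S. step S S'}"
    then obtain f where f: "bij_betw f S S'" "\<And>v. v \<in> S \<Longrightarrow> f v = v + 1 \<or> f v = v - 1"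
      by (auto simp: step_def)
    define g where "g = inv_into S f \<circ> e"
    have g: "bij_betw g ?I S" unfolding g_def
      by (rule bij_betw_trans[OF e bij_betw_inv_into[OF f(1)]])
    have ge: "e j = f (g j)" "g j \<in> S" if "j < m" for j
      using that g e by (auto simp: g_def bij_betw_inv_into_right[OF f(1)] bij_betw_def)
    define X where "X = {j\<in>?I. g j = e j - 1}"
    have wg: "w X j = g j" if "j < m" for j
      using f(2)[OF ge(2)[OF that]] ge(1)[OF that] that by (auto simp: w_def X_def)
    have "inj_on (w X) ?I" using g wg by (auto simp: bij_betw_def inj_on_def)
    moreover have "w X ` ?I = S" using g wg by (auto simp: bij_betw_def)
    ultimately show "\<exists>X\<in>?G. S = w X ` ?I" by (intro bexI[of _ X]) (auto simp: X_def)
  qed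
  finally show ?thesis .
qed

section \<open>Sums of maximal minors\<close>

definition lower :: "'b::linorder set \<Rightarrow> 'b \<Rightarrow> nat" where
  "lower S v = card {u\<in>S. u < v}"

lemma sdet_expand:
  assumes "finite S" "card S = Suc m"
  shows "sdet (Suc m) \<phi> S = (\<Sum>v\<in>S. (- 1) ^ lower S v * \<phi> 0 v * sdet m (\<lambda>k. \<phi> (Suc k)) (S - {v}))"
  using sdet_laplace[OF assms, of 0 \<phi>] by (simp add: lower_def)

lemma lower_insert:
  assumes "finite S" "u \<notin> S"
  shows "lower (insert u S) v = lower S v + (if u < v then 1 else 0)"
proof -
  have "{x \<in> insert u S. x < v} = (if u < v then insert u {x\<in>S. x < v} else {x\<in>S. x < v})" by auto
  then show ?thesis using assms by (simp add: lower_def)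
qed

lemma lower_remove:
  assumes "finite S" "u \<in> S"
  shows "lower S v = lower (S - {u}) v + (if u < v then 1 else 0)"
  using lower_insert[of "S - {u}" u v] assms by (simp add: insert_absorb)

text \<open>Contraction of the form \<open>g\<close> (a function on column sets) with the covector \<open>\<omega>\<close>, an antiderivation.\<close>

definition interior :: "'b::linorder set \<Rightarrow> ('b \<Rightarrow> 'a::comm_ring_1) \<Rightarrow> ('b set \<Rightarrow> 'a) \<Rightarrow> 'b set \<Rightarrow> 'a" where
  "interior V \<omega> g W = (\<Sum>u\<in>V - W. (- 1) ^ lower W u * \<omega> u * g (insert u W))"

text \<open>By \<open>sdet_expand\<close> the form \<open>sdet (Suc m) \<phi>\<close> is the wedge
  product of row 0 with the form of the later rows, so this is the graded Leibniz rule for the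
  contraction with \<omega>.\<close>

lemma interior_sdet:
  fixes \<phi> :: "nat \<Rightarrow> 'b::linorder \<Rightarrow> 'a::comm_ring_1"
  assumes V: "finite V" and W: "W \<subseteq> V" "card W = m"
  shows "interior V \<omega> (sdet (Suc m) \<phi>) W =
    (\<Sum>u\<in>V. \<omega> u * \<phi> 0 u) * sdet m (\<lambda>k. \<phi> (Suc k)) W -
    (\<Sum>v\<in>W. (- 1) ^ lower W v * \<phi> 0 v * interior V \<omega> (sdet m (\<lambda>k. \<phi> (Suc k))) (W - {v}))"
proof -
  let ?G = "sdet m (\<lambda>k. \<phi> (Suc k))"
  have finW: "finite W" using V W finite_subset by blast
  \<comment> \<open>The term in which \<open>u\<close> replaces \<open>v\<close> in
    \<open>W\<close>. It occurs in both expansions, with opposite signs because exactly one of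
    \<open>u < v\<close> and \<open>v < u\<close> holds.\<close>
  define c where "c = (\<lambda>u v. (- 1) ^ (lower W u + lower W v + (if u < v then 1 else 0)) * \<omega> u * \<phi> 0 v *
      ?G (insert u (W - {v})))"
  have "interior V \<omega> (sdet (Suc m) \<phi>) W = (\<Sum>u\<in>V - W. \<omega> u * \<phi> 0 u * ?G W + (\<Sum>v\<in>W. c u v))"
    unfolding interior_def
  proof (rule sum.cong[OF refl])
    fix u assume u: "u \<in> V - W"
    have "sdet (Suc m) \<phi> (insert u W) = (\<Sum>v\<in>insert u W. (- 1) ^ lower (insert u W) v * \<phi> 0 v * ?G (insert u W - {v}))"
      by (rule sdet_expand) (use u finW W in auto)
    also have "\<dots> = (- 1) ^ lower W u * \<phi> 0 u * ?G W +
      (\<Sum>v\<in>W. (- 1) ^ (lower W v + (if u < v then 1 else 0)) * \<phi> 0 v * ?G (insert u (W - {v})))"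
    proof -
      have "(\<Sum>v\<in>W. (- 1) ^ lower (insert u W) v * \<phi> 0 v * ?G (insert u W - {v})) =
        (\<Sum>v\<in>W. (- 1) ^ (lower W v + (if u < v then 1 else 0)) * \<phi> 0 v * ?G (insert u (W - {v})))"
        by (rule sum.cong[OF refl], subst lower_insert) (use u finW in \<open>auto simp: insert_Diff_if\<close>)
      then show ?thesis using u finW by (simp add: lower_insert)
    qed
    finally have e: "sdet (Suc m) \<phi> (insert u W) = \<dots>" .
    have s: "(- 1) ^ lower W u * ((- 1) ^ lower W u * x) = (x::'a)" for x
      by (simp flip: mult.assoc power_add)
    show "(- 1) ^ lower W u * \<omega> u * sdet (Suc m) \<phi> (insert u W) = \<omega> u * \<phi> 0 u * ?G W + (\<Sum>v\<in>W. c u v)"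
      unfolding e c_def distrib_left sum_distrib_left
      by (intro arg_cong2[where f = "(+)"] sum.cong refl) (simp_all add: mult_ac s power_add)
  qed
  also have "\<dots> = (\<Sum>u\<in>V - W. \<omega> u * \<phi> 0 u) * ?G W + (\<Sum>v\<in>W. \<Sum>u\<in>V - W. c u v)"
    by (simp add: sum.distrib sum_distrib_right sum.swap[of _ W])
  finally have L: "interior V \<omega> (sdet (Suc m) \<phi>) W = \<dots>" .
  have "(\<Sum>v\<in>W. (- 1) ^ lower W v * \<phi> 0 v * interior V \<omega> ?G (W - {v})) =
    (\<Sum>v\<in>W. \<omega> v * \<phi> 0 v * ?G W - (\<Sum>u\<in>V - W. c u v))"
  proof (rule sum.cong[OF refl])
    fix v assume v: "v \<in> W"
    have dec: "V - (W - {v}) = insert v (V - W)" using v W by auto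
    have s: "(- 1) ^ lower W v * ((- 1) ^ lower W v * x) = (x::'a)" for x
      by (simp flip: mult.assoc power_add)
    have lv: "lower (W - {v}) v = lower W v" using lower_remove[OF finW v, of v] by simp
    have "interior V \<omega> ?G (W - {v}) = (- 1) ^ lower W v * \<omega> v * ?G W +
      (\<Sum>u\<in>V - W. (- 1) ^ lower (W - {v}) u * \<omega> u * ?G (insert u (W - {v})))"
      unfolding interior_def dec using v V by (simp add: lv insert_absorb)
    moreover have "(- 1) ^ lower W v * \<phi> 0 v * ((- 1) ^ lower (W - {v}) u * \<omega> u * ?G (insert u (W - {v}))) = - c u v"
      if "u \<in> V - W" for u
    proof -
      have "u \<noteq> v" using that v by auto
      then have "u < v \<and> lower (W - {v}) u = lower W u \<or> \<not> u < v \<and> lower W u = Suc (lower (W - {v}) u)"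
        using lower_remove[OF finW v, of u] by auto
      then show ?thesis by (auto simp: c_def power_add mult_ac)
    qed
    ultimately show "(- 1) ^ lower W v * \<phi> 0 v * interior V \<omega> ?G (W - {v}) =
       \<omega> v * \<phi> 0 v * ?G W - (\<Sum>u\<in>V - W. c u v)"
      by (simp add: distrib_left sum_distrib_left mult_ac s flip: sum_negf)
  qed
  moreover have "(\<Sum>u\<in>V. \<omega> u * \<phi> 0 u) = (\<Sum>u\<in>V - W. \<omega> u * \<phi> 0 u) + (\<Sum>u\<in>W. \<omega> u * \<phi> 0 u)"
    by (rule sum.subset_diff[OF W(1) V])
  ultimately show ?thesis unfolding L by (simp add: sum_subtractf sum_distrib_right distrib_right)
qed

text \<open>By induction the contraction kills the minors of the later rows, so in the Leibniz rule
  only the pairing of \<omega> with row 0 remains.\<close>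

lemma interior_sdet_first:
  fixes \<phi> :: "nat \<Rightarrow> 'b::linorder \<Rightarrow> 'a::comm_ring_1"
  assumes V: "finite V" and "W \<subseteq> V" "card W = m"
    and "\<And>i. 0 < i \<Longrightarrow> i \<le> m \<Longrightarrow> (\<Sum>u\<in>V. \<omega> u * \<phi> i u) = 0"
  shows "interior V \<omega> (sdet (Suc m) \<phi>) W = (\<Sum>u\<in>V. \<omega> u * \<phi> 0 u) * sdet m (\<lambda>k. \<phi> (Suc k)) W"
  using assms(2-)
proof (induction m arbitrary: \<phi> W)
  case 0
  then have "W = {}" using finite_subset[OF _ V, of W] by simp
  then show ?case using interior_sdet[OF V, of W 0 \<omega> \<phi>] 0 by simp
next
  case (Suc m)
  have "interior V \<omega> (sdet (Suc m) (\<lambda>k. \<phi> (Suc k))) (W - {v}) = 0" if v: "v \<in> W" for v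
  proof -
    have "card (W - {v}) = m" "W - {v} \<subseteq> V" using Suc.prems v by (auto simp: card_Diff_singleton)
    then show ?thesis using Suc.prems(3) by (subst Suc.IH) auto
  qed
  then show ?case using interior_sdet[OF V Suc.prems(1,2), of \<omega> \<phi>] by simp
qed

section \<open>The sum of the maximal minors as a sum of contractions\<close>

definition minors_sum :: "'b::linorder set \<Rightarrow> nat \<Rightarrow> (nat \<Rightarrow> 'b \<Rightarrow> 'a::comm_ring_1) \<Rightarrow> 'a" where
  "minors_sum V m \<phi> = (\<Sum>T | T \<subseteq> V \<and> card T = m. sdet m \<phi> T)"

lemma sum_subset_point:
  assumes V: "finite V"
  shows "(\<Sum>T | T \<subseteq> V \<and> card T = Suc m. \<Sum>v\<in>T. f v (T - {v})) =
         (\<Sum>U | U \<subseteq> V \<and> card U = m. \<Sum>v\<in>V - U. f v U)"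
proof -
  have fin: "finite U" if "U \<subseteq> V" for U using that V finite_subset by blast
  have "(\<Sum>T | T \<subseteq> V \<and> card T = Suc m. \<Sum>v\<in>T. f v (T - {v})) =
    (\<Sum>(T,v)\<in>(SIGMA T:{T. T \<subseteq> V \<and> card T = Suc m}. T). f v (T - {v}))"
    by (rule sum.Sigma) (use V fin in auto)
  also have "\<dots> = (\<Sum>(U,v)\<in>(SIGMA U:{U. U \<subseteq> V \<and> card U = m}. V - U). f v U)"
    by (rule sum.reindex_bij_witness[of _ "\<lambda>(U,v). (insert v U, v)" "\<lambda>(T,v). (T - {v}, v)"])
       (auto simp: fin card_Diff_singleton card_insert_if insert_absorb)
  also have "\<dots> = (\<Sum>U | U \<subseteq> V \<and> card U = m. \<Sum>v\<in>V - U. f v U)"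
    by (rule sum.Sigma[symmetric]) (use V fin in auto)
  finally show ?thesis .
qed

lemma alternating_sum_lower:
  fixes U :: "'b::linorder set"
  assumes "finite U"
  shows "(\<Sum>u\<in>U. (- 1) ^ lower U u) = (if even (card U) then 0 else (1::'a::comm_ring_1))"
  using assms
proof (induction U rule: finite_linorder_max_induct)
  case (insert b A)
  have b: "b \<notin> A" using insert by auto
  have "(\<Sum>u\<in>A. (- 1) ^ lower (insert b A) u) = (\<Sum>u\<in>A. (- 1) ^ lower A u :: 'a)"
    by (rule sum.cong[OF refl], subst lower_insert) (use insert b in auto)
  moreover have "{u \<in> A. u < b} = A" using insert by auto
  then have "lower (insert b A) b = card A" using insert b by (subst lower_insert) (auto simp: lower_def)
  ultimately show ?case using insert b by simp
qed (simp add: lower_def)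

text \<open>The sign matrix of the order. Its Pfaffian on every finite set of even size is 1, which
  is why minors summed with equal weights form a Pfaffian.\<close>

definition cmp :: "'b::linorder \<Rightarrow> 'b \<Rightarrow> 'a::comm_ring_1" where
  "cmp v u = (if v < u then 1 else if u < v then - 1 else 0)"

text \<open>The sum is the part above \<open>v\<close> minus the part below. All signs together give
  1 since \<open>card U\<close> is odd, and the part below is 0 or 1 according to the parity of
  \<open>lower U v\<close>. This trades a sum over columns outside \<open>U\<close> for a sum over
  columns inside.\<close>

lemma alternating_sum_cmp:
  fixes U :: "'b::linorder set"
  assumes U: "finite U" "odd (card U)"
  shows "(\<Sum>u\<in>U. (- 1) ^ lower U u * cmp v u) = (if v \<in> U then 0 else (- 1) ^ lower U v :: 'a::comm_ring_1)"
proof -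
  let ?s = "\<lambda>u. (- 1) ^ lower U u :: 'a"
  let ?L = "{u\<in>U. u < v}" and ?R = "{u\<in>U. v < u}" and ?E = "{u\<in>U. u = v}"
  have "U = ?L \<union> ?R \<union> ?E" by auto
  then have split: "sum g U = sum g ?L + sum g ?R + sum g ?E" for g :: "'b \<Rightarrow> 'a"
    using sum.union_disjoint[of "?L \<union> ?R" ?E g] sum.union_disjoint[of ?L ?R g] U(1) by fastforce
  have "lower ?L u = lower U u" if "u \<in> ?L" for u
    unfolding lower_def by (rule arg_cong[where f = card]) (use that in auto)
  then have "sum ?s ?L = (\<Sum>u\<in>?L. (- 1) ^ lower ?L u)" by (intro sum.cong) auto
  also have "\<dots> = (if even (lower U v) then 0 else 1)"
    using alternating_sum_lower[of ?L] U(1) by (simp add: lower_def)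
  finally have L: "sum ?s ?L = (if even (lower U v) then 0 else 1)" .
  have E: "sum ?s ?E = (if v \<in> U then ?s v else 0)"
  proof (cases "v \<in> U")
    case True
    then have "?E = {v}" by auto
    then show ?thesis using True by simp
  next
    case False
    then have "?E = {}" by auto
    then show ?thesis unfolding \<open>?E = {}\<close> using False by simp
  qed
  have t: "sum ?s ?L + sum ?s ?R + sum ?s ?E = 1"
    unfolding split[symmetric] using alternating_sum_lower[OF U(1)] U(2) by simp
  have "(\<Sum>u\<in>U. ?s u * cmp v u) = - sum ?s ?L + sum ?s ?R + 0"
    unfolding split[of "\<lambda>u. ?s u * cmp v u"]
    by (intro arg_cong2[where f = "(+)"]; (subst sum_negf[symmetric])?)
       (auto intro!: sum.cong sum.neutral simp: cmp_def)
  also have "\<dots> = 1 - sum ?s ?E - 2 * sum ?s ?L" using t by (simp add: algebra_simps)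
  also have "\<dots> = (if v \<in> U then 0 else ?s v)" unfolding L E by auto
  finally show ?thesis .
qed

text \<open>Expanding along row 0 adds a column \<open>v\<close> to a set \<open>U\<close> of odd
  size. By \<open>alternating_sum_cmp\<close> these contributions from outside \<open>U\<close>
  equal contributions from inside, weighted with the covector that row 0 induces through
  \<open>cmp\<close>. Sorting them by \<open>U\<close> without the column concerned gives the
  contractions.\<close>

lemma minors_sum_interior:
  fixes \<phi> :: "nat \<Rightarrow> 'b::linorder \<Rightarrow> 'a::comm_ring_1"
  assumes V: "finite V" and m: "even m"
  shows "minors_sum V (Suc (Suc m)) \<phi> =
    (\<Sum>W | W \<subseteq> V \<and> card W = m. interior V (\<lambda>u. \<Sum>v\<in>V. \<phi> 0 v * cmp v u) (sdet (Suc m) (\<lambda>k. \<phi> (Suc k))) W)"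
proof -
  let ?G = "sdet (Suc m) (\<lambda>k. \<phi> (Suc k))"
  let ?\<omega> = "\<lambda>u. \<Sum>v\<in>V. \<phi> 0 v * cmp v u"
  have fin: "finite U" if "U \<subseteq> V" for U using that V finite_subset by blast
  have lo: "lower T v = lower (T - {v}) v" if "finite T" "v \<in> T" for T and v :: 'b
    using lower_remove[OF that, of v] by simp
  have key: "(\<Sum>v\<in>V - U. (- 1) ^ lower U v * \<phi> 0 v) = (\<Sum>u\<in>U. (- 1) ^ lower U u * ?\<omega> u)"
    if U: "U \<subseteq> V" "card U = Suc m" for U
  proof -
    have "(\<Sum>u\<in>U. (- 1) ^ lower U u * ?\<omega> u) = (\<Sum>v\<in>V. \<phi> 0 v * (\<Sum>u\<in>U. (- 1) ^ lower U u * cmp v u))"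
      unfolding sum_distrib_left by (subst sum.swap) (simp add: mult_ac)
    also have "\<dots> = (\<Sum>v\<in>V. if v \<in> U then 0 else (- 1) ^ lower U v * \<phi> 0 v)"
      by (rule sum.cong[OF refl], subst alternating_sum_cmp) (use U m fin in auto)
    also have "\<dots> = (\<Sum>v\<in>V - U. (- 1) ^ lower U v * \<phi> 0 v)"
      by (rule sum.mono_neutral_cong_right) (use V in auto)
    finally show ?thesis by simp
  qed
  have "minors_sum V (Suc (Suc m)) \<phi> =
    (\<Sum>T | T \<subseteq> V \<and> card T = Suc (Suc m). \<Sum>v\<in>T. (- 1) ^ lower (T - {v}) v * \<phi> 0 v * ?G (T - {v}))"
    unfolding minors_sum_def
    by (rule sum.cong[OF refl], subst sdet_expand) (use fin lo in \<open>auto intro!: sum.cong\<close>)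
  also have "\<dots> = (\<Sum>U | U \<subseteq> V \<and> card U = Suc m. \<Sum>v\<in>V - U. (- 1) ^ lower U v * \<phi> 0 v * ?G U)"
    by (rule sum_subset_point[OF V])
  also have "\<dots> = (\<Sum>U | U \<subseteq> V \<and> card U = Suc m. \<Sum>u\<in>U. (- 1) ^ lower (U - {u}) u * ?\<omega> u * ?G (insert u (U - {u})))"
  proof (rule sum.cong[OF refl])
    fix U assume "U \<in> {U. U \<subseteq> V \<and> card U = Suc m}"
    then have U: "U \<subseteq> V" "card U = Suc m" by auto
    have "(\<Sum>v\<in>V - U. (- 1) ^ lower U v * \<phi> 0 v * ?G U) = (\<Sum>u\<in>U. (- 1) ^ lower U u * ?\<omega> u) * ?G U"
      by (simp only: key[OF U, symmetric] sum_distrib_right)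
    also have "\<dots> = (\<Sum>u\<in>U. (- 1) ^ lower (U - {u}) u * ?\<omega> u * ?G (insert u (U - {u})))"
      unfolding sum_distrib_right
      by (rule sum.cong[OF refl], subst lo) (use fin[OF U(1)] in \<open>auto simp: insert_absorb\<close>)
    finally show "(\<Sum>v\<in>V - U. (- 1) ^ lower U v * \<phi> 0 v * ?G U) = \<dots>" .
  qed
  also have "\<dots> = (\<Sum>W | W \<subseteq> V \<and> card W = m. interior V ?\<omega> ?G W)"
    unfolding interior_def by (rule sum_subset_point[OF V])
  finally show ?thesis .
qed

definition alt :: "'b::linorder set \<Rightarrow> ('b \<Rightarrow> 'a) \<Rightarrow> ('b \<Rightarrow> 'a) \<Rightarrow> 'a::comm_ring_1" where
  "alt V x y = (\<Sum>v\<in>V. \<Sum>u\<in>V. x v * y u * cmp v u)"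

lemma cmp_swap: "cmp u v = - cmp v u"
  by (auto simp: cmp_def)

lemma alt_swap: "alt V y x = - alt V x y"
proof -
  have "alt V y x = (\<Sum>u\<in>V. \<Sum>v\<in>V. y v * x u * cmp v u)"
    unfolding alt_def by (rule sum.swap)
  also have "\<dots> = (\<Sum>u\<in>V. \<Sum>v\<in>V. - (x u * y v * cmp u v))"
    by (intro sum.cong refl, subst cmp_swap) (simp add: mult_ac)
  finally show ?thesis by (simp add: alt_def sum_negf)
qed

lemma alt_self:
  fixes x :: "'b::linorder \<Rightarrow> 'a::field_char_0"
  shows "alt V x x = 0"
  using alt_swap[of V x x] by simp

lemma alt_functional: "alt V x y = (\<Sum>u\<in>V. (\<Sum>v\<in>V. x v * cmp v u) * y u)"
  unfolding alt_def sum_distrib_right by (subst sum.swap) (simp add: mult_ac)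

text \<open>Pfaffian expansion along row 0 when row 1 is its only possible partner: the covector
  induced by row 0 kills all rows after row 1, so \<open>interior_sdet_first\<close>
  applies.\<close>

lemma minors_sum_split:
  fixes \<phi> :: "nat \<Rightarrow> 'b::linorder \<Rightarrow> 'a::comm_ring_1"
  assumes V: "finite V" and m: "even m"
    and z: "\<And>i. 2 \<le> i \<Longrightarrow> i < m + 2 \<Longrightarrow> alt V (\<phi> 0) (\<phi> i) = 0"
  shows "minors_sum V (Suc (Suc m)) \<phi> = alt V (\<phi> 0) (\<phi> 1) * minors_sum V m (\<lambda>k. \<phi> (Suc (Suc k)))"
proof -
  have "interior V (\<lambda>u. \<Sum>v\<in>V. \<phi> 0 v * cmp v u) (sdet (Suc m) (\<lambda>k. \<phi> (Suc k))) W =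
      alt V (\<phi> 0) (\<phi> 1) * sdet m (\<lambda>k. \<phi> (Suc (Suc k))) W" if "W \<subseteq> V" "card W = m" for W
    using interior_sdet_first[OF V that, of "\<lambda>u. \<Sum>v\<in>V. \<phi> 0 v * cmp v u" "\<lambda>k. \<phi> (Suc k)"] z
    by (simp add: alt_functional)
  then show ?thesis
    unfolding minors_sum_interior[OF V m] unfolding minors_sum_def sum_distrib_left by (intro sum.cong) auto
qed

section \<open>Row operations, and the Pfaffian identity by elimination\<close>

definition rowop :: "(nat \<Rightarrow> nat \<Rightarrow> 'a) \<Rightarrow> nat \<Rightarrow> (nat \<Rightarrow> 'b \<Rightarrow> 'a) \<Rightarrow> nat \<Rightarrow> 'b \<Rightarrow> 'a::comm_ring_1" where
  "rowop P m \<phi> i v = (\<Sum>k=0..<m. P i k * \<phi> k v)"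

lemma sdet_rowop:
  "sdet m (rowop P m \<phi>) S = det (mat m m (\<lambda>(i,k). P i k)) * sdet m \<phi> S"
proof -
  let ?P = "mat m m (\<lambda>(i,k). P i k)" and ?X = "mat m m (\<lambda>(i,j). \<phi> i (sorted_list_of_set S ! j))"
  have "mat m m (\<lambda>(i,j). rowop P m \<phi> i (sorted_list_of_set S ! j)) = ?P * ?X"
    by (rule eq_matI) (auto simp: rowop_def scalar_prod_def)
  then show ?thesis unfolding sdet_def ldet_def by (simp add: det_mult[of _ m])
qed

lemma minors_sum_rowop:
  "minors_sum V m (rowop P m \<phi>) = det (mat m m (\<lambda>(i,k). P i k)) * minors_sum V m \<phi>"
  unfolding minors_sum_def sdet_rowop sum_distrib_left ..

lemma alt_rowop:
  "alt V (rowop P m \<phi> i) (rowop Q m \<phi> j) = (\<Sum>k=0..<m. \<Sum>l=0..<m. P i k * Q j l * alt V (\<phi> k) (\<phi> l))"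
proof -
  have "alt V (rowop P m \<phi> i) (rowop Q m \<phi> j) =
    (\<Sum>v\<in>V. \<Sum>u\<in>V. \<Sum>k=0..<m. \<Sum>l=0..<m. P i k * \<phi> k v * (Q j l * \<phi> l u) * cmp v u)"
    unfolding alt_def rowop_def sum_product by (simp only: sum_distrib_right)
  also have "\<dots> = (\<Sum>v\<in>V. \<Sum>k=0..<m. \<Sum>u\<in>V. \<Sum>l=0..<m. P i k * \<phi> k v * (Q j l * \<phi> l u) * cmp v u)"
    by (intro sum.cong refl sum.swap)
  also have "\<dots> = (\<Sum>k=0..<m. \<Sum>v\<in>V. \<Sum>u\<in>V. \<Sum>l=0..<m. P i k * \<phi> k v * (Q j l * \<phi> l u) * cmp v u)"
    by (rule sum.swap)
  also have "\<dots> = (\<Sum>k=0..<m. \<Sum>v\<in>V. \<Sum>l=0..<m. \<Sum>u\<in>V. P i k * \<phi> k v * (Q j l * \<phi> l u) * cmp v u)"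
    by (intro sum.cong refl sum.swap)
  also have "\<dots> = (\<Sum>k=0..<m. \<Sum>l=0..<m. \<Sum>v\<in>V. \<Sum>u\<in>V. P i k * \<phi> k v * (Q j l * \<phi> l u) * cmp v u)"
    by (intro sum.cong refl sum.swap)
  finally show ?thesis by (simp add: alt_def sum_distrib_left mult_ac)
qed

lemma det_alt_rowop:
  "det (mat m m (\<lambda>(i,j). alt V (rowop P m \<phi> i) (rowop P m \<phi> j))) =
   (det (mat m m (\<lambda>(i,k). P i k)))\<^sup>2 * det (mat m m (\<lambda>(i,j). alt V (\<phi> i) (\<phi> j)))"
proof -
  let ?P = "mat m m (\<lambda>(i,k). P i k)" and ?X = "mat m m (\<lambda>(i,j). alt V (\<phi> i) (\<phi> j))"
  have "mat m m (\<lambda>(i,j). alt V (rowop P m \<phi> i) (rowop P m \<phi> j)) = ?P * (?X * transpose_mat ?P)"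
    by (rule eq_matI) (auto simp: alt_rowop scalar_prod_def sum_distrib_left mult_ac)
  also have "det \<dots> = det ?P * (det ?X * det ?P)"
  proof -
    have "?X * transpose_mat ?P \<in> carrier_mat m m" by (intro mult_carrier_mat[of _ m m]) auto
    then have "det (?P * (?X * transpose_mat ?P)) = det ?P * det (?X * transpose_mat ?P)"
      by (intro det_mult[of _ m]) simp_all
    also have "det (?X * transpose_mat ?P) = det ?X * det (transpose_mat ?P)"
      by (intro det_mult[of _ m]) simp_all
    also have "det (transpose_mat ?P) = det ?P" by (intro det_transpose[of _ m]) simp
    finally show ?thesis .
  qed
  finally show ?thesis by (simp add: power2_eq_square mult_ac)
qed

lemma det_lower_unitriangular:
  fixes P :: "nat \<Rightarrow> nat \<Rightarrow> 'a::comm_ring_1"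
  assumes "\<And>i j. i < j \<Longrightarrow> j < m \<Longrightarrow> P i j = 0" "\<And>i. i < m \<Longrightarrow> P i i = 1"
  shows "det (mat m m (\<lambda>(i,j). P i j)) = 1"
proof -
  have "det (mat m m (\<lambda>(i,j). P i j)) = prod_list (diag_mat (mat m m (\<lambda>(i,j). P i j)))"
    by (rule det_lower_triangular[of m]) (use assms(1) in auto)
  also have "diag_mat (mat m m (\<lambda>(i,j). P i j)) = map (\<lambda>i. 1) [0..<m]"
    unfolding diag_mat_def by (rule map_cong) (use assms(2) in auto)
  finally show ?thesis by (simp add: map_replicate_const)
qed

lemma det_two_by_two:
  assumes A: "A \<in> carrier_mat 2 2"
  shows "det A = A $$ (0,0) * A $$ (1,1) - A $$ (0,1) * A $$ (1,0)"
proof -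
  have "det A = (\<Sum>j<2. A $$ (0,j) * cofactor A 0 j)"
    using A by (intro laplace_expansion_row) auto
  moreover have "det (mat_delete A 0 0) = A $$ (1,1)" "det (mat_delete A 0 1) = A $$ (1,0)"
    using A by (simp_all add: det_single mat_delete_def)
  ultimately show ?thesis by (simp add: numeral_2_eq_2 cofactor_def)
qed

lemma rowop_elim:
  assumes "i < m" "2 \<le> m"
  shows "rowop (\<lambda>i k. (if k = i then 1 else 0) + (if k = 0 then \<alpha> i else 0) + (if k = 1 then \<beta> i else 0)) m \<phi> i
     = (\<lambda>v. \<phi> i v + \<alpha> i * \<phi> 0 v + \<beta> i * \<phi> 1 v)"
proof
  fix v
  have "(\<Sum>k=0..<m. (if k = 0 then \<alpha> i else 0) * \<phi> k v) = \<alpha> i * \<phi> 0 v"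
    "(\<Sum>k=0..<m. (if k = 1 then \<beta> i else 0) * \<phi> k v) = \<beta> i * \<phi> 1 v"
    "(\<Sum>k=0..<m. (if k = i then 1 else 0) * \<phi> k v) = \<phi> i v"
    using assms by (simp_all add: if_distrib[of "\<lambda>x. x * _"] sum.delta cong: if_cong)
  then show "rowop (\<lambda>i k. (if k = i then 1 else 0) + (if k = 0 then \<alpha> i else 0) + (if k = 1 then \<beta> i else 0)) m \<phi> i v
     = \<phi> i v + \<alpha> i * \<phi> 0 v + \<beta> i * \<phi> 1 v"
    unfolding rowop_def distrib_right sum.distrib by simp
qed

lemma alt_linear_right: "alt V x (\<lambda>v. y v + a * z v + b * w v) = alt V x y + a * alt V x z + b * alt V x w"
  by (simp add: alt_def sum.distrib sum_distrib_left algebra_simps)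

lemma alt_add_right: "alt V x (\<lambda>v. y v + z v) = alt V x y + alt V x z"
  by (simp add: alt_def sum.distrib algebra_simps)

text \<open>The sum of the maximal minors is the Pfaffian of the Gram matrix. The proof splits off hyperbolic
  planes of the alternating form.\<close>

lemma pfaffian_square:
  fixes \<phi> :: "nat \<Rightarrow> 'b::linorder \<Rightarrow> 'a::field_char_0"
  assumes V: "finite V"
  shows "det (mat (2 * n) (2 * n) (\<lambda>(i,j). alt V (\<phi> i) (\<phi> j))) = (minors_sum V (2 * n) \<phi>)\<^sup>2"
proof (induction n arbitrary: \<phi>)
  case 0
  have "{T. T \<subseteq> V \<and> card T = 0} = {{}}" using finite_subset[OF _ V] by auto
  then show ?case by (simp add: minors_sum_def sdet_def ldet_def)
next
  case (Suc n)
  define m where "m = 2 * Suc n"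
  have m: "m = Suc (Suc (2 * n))" "m \<ge> 2" by (auto simp: m_def)
  let ?Q = "\<lambda>\<phi>. det (mat m m (\<lambda>(i,j). alt V (\<phi> i) (\<phi> j))) = (minors_sum V m \<phi>)\<^sup>2"
  \<comment> \<open>A row operation multiplies the Gram determinant by the square of its determinant
    and the sum of minors by the determinant itself, so operations of determinant 1 preserve the
    claim.\<close>
  have transfer: "?Q \<phi>" if "?Q (rowop P m \<phi>)" "det (mat m m (\<lambda>(i,k). P i k)) = 1" for P and \<phi> :: "nat \<Rightarrow> 'b \<Rightarrow> 'a"
    using that unfolding det_alt_rowop minors_sum_rowop by simp
  have main: "?Q \<phi>" if o: "alt V (\<phi> 0) (\<phi> 1) \<noteq> 0" for \<phi> :: "nat \<Rightarrow> 'b \<Rightarrow> 'a"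
  proof -
    let ?o = "alt V (\<phi> 0) (\<phi> 1)"
    \<comment> \<open>The coefficients make each later row orthogonal to rows 0 and 1, so that the
      Gram matrix becomes a 2 by 2 block and a block of size \<open>2 * n\<close>.\<close>
    define \<alpha> where "\<alpha> = (\<lambda>i. if i < 2 then 0 else alt V (\<phi> 1) (\<phi> i) / ?o)"
    define \<beta> where "\<beta> = (\<lambda>i. if i < 2 then 0 else - alt V (\<phi> 0) (\<phi> i) / ?o)"
    define P where "P = (\<lambda>i k. (if k = i then 1 else 0) + (if k = 0 then \<alpha> i else 0) + (if k = 1 then \<beta> i else 0))"
    define \<psi> where "\<psi> = rowop P m \<phi>"
    have \<psi>: "\<psi> i = (\<lambda>v. \<phi> i v + \<alpha> i * \<phi> 0 v + \<beta> i * \<phi> 1 v)" if "i < m" for i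
      unfolding \<psi>_def P_def by (rule rowop_elim[OF that m(2)])
    have \<psi>01: "\<psi> 0 = \<phi> 0" "\<psi> 1 = \<phi> 1" using m \<psi>[of 0] \<psi>[of 1] by (auto simp: \<alpha>_def \<beta>_def)
    have z0: "alt V (\<phi> 0) (\<psi> i) = 0" if "2 \<le> i" "i < m" for i
      using that o unfolding \<psi>[OF that(2)] alt_linear_right by (simp add: \<beta>_def alt_self)
    have z1: "alt V (\<phi> 1) (\<psi> i) = 0" if "2 \<le> i" "i < m" for i
      using that o unfolding \<psi>[OF that(2)] alt_linear_right alt_swap[of V "\<phi> 1" "\<phi> 0"]
      by (simp add: \<alpha>_def alt_self)
    have detP: "det (mat m m (\<lambda>(i,k). P i k)) = 1"
      by (rule det_lower_unitriangular) (auto simp: P_def \<alpha>_def \<beta>_def)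
    let ?A = "mat 2 2 (\<lambda>(i,j). alt V (\<psi> i) (\<psi> j))"
    let ?D = "mat (2*n) (2*n) (\<lambda>(i,j). alt V (\<psi> (Suc (Suc i))) (\<psi> (Suc (Suc j))))"
    have "mat m m (\<lambda>(i,j). alt V (\<psi> i) (\<psi> j)) = four_block_mat ?A (0\<^sub>m 2 (2*n)) (0\<^sub>m (2*n) 2) ?D"
    proof (rule eq_matI)
      fix i j assume "i < dim_row (four_block_mat ?A (0\<^sub>m 2 (2*n)) (0\<^sub>m (2*n) 2) ?D)"
        "j < dim_col (four_block_mat ?A (0\<^sub>m 2 (2*n)) (0\<^sub>m (2*n) 2) ?D)"
      then have ij: "i < m" "j < m" by (auto simp: m)
      have small: "k = 0 \<or> k = 1" if "k < 2" for k :: nat using that by auto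
      have r: "alt V (\<psi> i) (\<psi> j) = 0" if "i < 2" "\<not> j < 2"
        using small[OF that(1)] z0[of j] z1[of j] that ij \<psi>01 by auto
      have l: "alt V (\<psi> i) (\<psi> j) = 0" if "\<not> i < 2" "j < 2"
        using small[OF that(2)] z0[of i] z1[of i] that ij \<psi>01 alt_swap[of V "\<psi> i" "\<psi> j"] by auto
      have s: "Suc (Suc (k - 2)) = k" if "\<not> k < 2" for k :: nat using that by simp
      show "mat m m (\<lambda>(i,j). alt V (\<psi> i) (\<psi> j)) $$ (i,j) = four_block_mat ?A (0\<^sub>m 2 (2*n)) (0\<^sub>m (2*n) 2) ?D $$ (i,j)"
        using ij by (auto simp: m r l s index_mat_four_block)
    qed (auto simp: m)
    then have "det (mat m m (\<lambda>(i,j). alt V (\<psi> i) (\<psi> j))) = det ?A * det ?D"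
      by (simp add: det_four_block_mat_upper_right_zero[of _ 2 _ "2*n"])
    also have "det ?A = ?o\<^sup>2"
      by (subst det_two_by_two) (auto simp: \<psi>01[unfolded One_nat_def] alt_self power2_eq_square
          alt_swap[of V "\<phi> 1" "\<phi> 0", unfolded One_nat_def])
    also have "det ?D = (minors_sum V (2*n) (\<lambda>k. \<psi> (Suc (Suc k))))\<^sup>2"
      by (rule Suc.IH)
    also have "?o\<^sup>2 * \<dots> = (minors_sum V m \<psi>)\<^sup>2"
      using minors_sum_split[OF V, of "2*n" \<psi>] z0 \<psi>01 unfolding m(1) by (simp add: power_mult_distrib)
    finally have "?Q \<psi>" .
    then show ?thesis using transfer detP unfolding \<psi>_def by blast
  qed
  show ?case unfolding m_def[symmetric]
  proof (cases "\<forall>j<m. alt V (\<phi> 0) (\<phi> j) = 0")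
    \<comment> \<open>Row 0 is orthogonal to all rows: the Gram matrix has a zero row, and the split
      with vanishing pairing shows that the sum of minors is zero as well.\<close>
    case True
    have "det (mat m m (\<lambda>(i,j). alt V (\<phi> i) (\<phi> j))) =
      (\<Sum>j<m. mat m m (\<lambda>(i,j). alt V (\<phi> i) (\<phi> j)) $$ (0,j) * cofactor (mat m m (\<lambda>(i,j). alt V (\<phi> i) (\<phi> j))) 0 j)"
      by (rule laplace_expansion_row) (auto simp: m)
    also have "\<dots> = 0" by (rule sum.neutral) (use True m in auto)
    finally show "?Q \<phi>" using minors_sum_split[OF V, of "2*n" \<phi>] True m by simp
  next
    case False
    then obtain j where j: "j < m" "alt V (\<phi> 0) (\<phi> j) \<noteq> 0" by blast
    have "j \<noteq> 0" using j(2) by (metis alt_self)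
    show "?Q \<phi>"
    proof (cases "alt V (\<phi> 0) (\<phi> 1) = 0")
      case True
      with j \<open>j \<noteq> 0\<close> have j1: "1 < j" by (cases "j = 1") auto
      \<comment> \<open>Row \<open>j\<close> is added to row 1 instead of being exchanged with it,
        which keeps the determinant at 1 and makes the pairing of rows 0 and 1 nonzero.\<close>
      define P where "P = (\<lambda>i k. (if k = i then 1 else 0) + (if k = j then (if i = 1 then 1 else 0) else (0::'a)))"
      have P: "rowop P m \<phi> i = (\<lambda>v. \<phi> i v + (if i = 1 then 1 else 0) * \<phi> j v)" if "i < m" for i
      proof
        fix v
        have "(\<Sum>k=0..<m. (if k = i then 1 else 0) * \<phi> k v) = \<phi> i v"
          "(\<Sum>k=0..<m. (if k = j then (if i = 1 then 1 else 0) else 0) * \<phi> k v) = (if i = 1 then 1 else 0) * \<phi> j v"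
          using that j by (simp_all add: if_distrib[of "\<lambda>x. x * _"] sum.delta cong: if_cong)
        then show "rowop P m \<phi> i v = \<phi> i v + (if i = 1 then 1 else 0) * \<phi> j v"
          unfolding rowop_def P_def distrib_right sum.distrib by simp
      qed
      have "det (mat m m (\<lambda>(i,k). P i k)) = prod_list (diag_mat (mat m m (\<lambda>(i,k). P i k)))"
        by (rule det_upper_triangular[of _ m]) (use j1 in \<open>auto simp: P_def upper_triangular_def\<close>)
      also have "diag_mat (mat m m (\<lambda>(i,k). P i k)) = map (\<lambda>i. 1) [0..<m]"
        unfolding diag_mat_def by (rule map_cong) (use j1 in \<open>auto simp: P_def\<close>)
      finally have "det (mat m m (\<lambda>(i,k). P i k)) = 1" by (simp add: map_replicate_const)
      moreover have "rowop P m \<phi> 0 = \<phi> 0" "rowop P m \<phi> 1 = (\<lambda>v. \<phi> 1 v + \<phi> j v)"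
        using P[of 0] P[of 1] m by auto
      then have "alt V (rowop P m \<phi> 0) (rowop P m \<phi> 1) \<noteq> 0"
        using True j by (simp add: alt_add_right)
      ultimately show ?thesis using main transfer by blast
    qed (rule main)
  qed
qed

section \<open>The symmetric part of rank one, by bordering\<close>

lemma det_antisym_odd:
  fixes a :: "nat \<Rightarrow> nat \<Rightarrow> 'a::field_char_0"
  assumes "odd n" "\<And>i j. a i j = - a j i"
  shows "det (mat n n (\<lambda>(i,j). a i j)) = 0"
proof -
  let ?A = "mat n n (\<lambda>(i,j). a i j)"
  have "det ?A = det (transpose_mat ?A)" by (rule det_transpose[symmetric, of _ n]) simp
  also have "transpose_mat ?A = (- 1) \<cdot>\<^sub>m ?A"
  proof (rule eq_matI)
    fix i j assume "i < dim_row ((- 1) \<cdot>\<^sub>m ?A)" "j < dim_col ((- 1) \<cdot>\<^sub>m ?A)"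
    then show "transpose_mat ?A $$ (i,j) = ((- 1) \<cdot>\<^sub>m ?A) $$ (i,j)"
      using assms(2)[of j i] by simp
  qed auto
  also have "det \<dots> = - det ?A" using assms(1) by (subst det_smult) simp
  finally show ?thesis by simp
qed

text \<open>For antisymmetric \<open>a\<close> this matrix is antisymmetric at \<open>s = 0\<close>,
  while at \<open>s = 1\<close> the Schur complement of the corner is
  \<open>a i j + t i * t j\<close>. Its determinant is affine in \<open>s\<close>, which connects
  the two cases.\<close>

definition bordered :: "nat \<Rightarrow> 'a \<Rightarrow> (nat \<Rightarrow> 'a) \<Rightarrow> (nat \<Rightarrow> nat \<Rightarrow> 'a) \<Rightarrow> 'a::field_char_0 mat" where
  "bordered m s t a = mat (Suc m) (Suc m) (\<lambda>(i,j). case (i,j) of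
     (0, 0) \<Rightarrow> s | (0, Suc j) \<Rightarrow> t j | (Suc i, 0) \<Rightarrow> - t i | (Suc i, Suc j) \<Rightarrow> a i j)"

lemma det_bordered_shift:
  "det (bordered m s t a) = det (bordered m 0 t a) + s * det (mat m m (\<lambda>(i,j). a i j))"
proof -
  have del: "mat_delete (bordered m s t a) 0 j = mat_delete (bordered m 0 t a) 0 j" for s j
    by (rule eq_matI) (auto simp: mat_delete_def bordered_def split: nat.splits)
  have d0: "mat_delete (bordered m s t a) 0 0 = mat m m (\<lambda>(i,j). a i j)" for s
    by (rule eq_matI) (auto simp: mat_delete_def bordered_def)
  have L: "det (bordered m s t a) = s * det (mat m m (\<lambda>(i,j). a i j)) +
      (\<Sum>j<m. t j * cofactor (bordered m 0 t a) 0 (Suc j))" for s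
  proof -
    have "det (bordered m s t a) = (\<Sum>j<Suc m. bordered m s t a $$ (0,j) * cofactor (bordered m s t a) 0 j)"
      by (rule laplace_expansion_row) (auto simp: bordered_def)
    also have "\<dots> = bordered m s t a $$ (0,0) * cofactor (bordered m s t a) 0 0 +
       (\<Sum>j<m. bordered m s t a $$ (0,Suc j) * cofactor (bordered m s t a) 0 (Suc j))"
      by (rule sum.lessThan_Suc_shift)
    also have "bordered m s t a $$ (0,0) * cofactor (bordered m s t a) 0 0 = s * det (mat m m (\<lambda>(i,j). a i j))"
      by (simp add: cofactor_def d0) (simp add: bordered_def)
    also have "(\<Sum>j<m. bordered m s t a $$ (0,Suc j) * cofactor (bordered m s t a) 0 (Suc j)) =
       (\<Sum>j<m. t j * cofactor (bordered m 0 t a) 0 (Suc j))"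
      by (rule sum.cong[OF refl], unfold cofactor_def del[of s]) (simp add: bordered_def)
    finally show ?thesis .
  qed
  show ?thesis using L[of s] L[of 0] by simp
qed

lemma det_bordered_one:
  "det (bordered m 1 t a) = det (mat m m (\<lambda>(i,j). a i j + t i * t j))"
proof -
  \<comment> \<open>Adds \<open>t (i - 1)\<close> times row 0 to row \<open>i\<close>; this clears
    column 0 below the corner.\<close>
  let ?P = "mat (Suc m) (Suc m) (\<lambda>(i,k). (if k = i then 1 else 0) + (if k = 0 then (if i = 0 then 0 else t (i - 1)) else 0))"
  let ?M = "bordered m 1 t a"
  let ?B = "mat m m (\<lambda>(i,j). a i j + t i * t j)"
  have M: "?M \<in> carrier_mat (Suc m) (Suc m)" by (simp add: bordered_def)
  have P: "det ?P = 1" by (rule det_lower_unitriangular) auto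
  have PM: "(?P * ?M) $$ (i,j) = ?M $$ (i,j) + (if i = 0 then 0 else t (i - 1)) * ?M $$ (0,j)"
    if "i < Suc m" "j < Suc m" for i j
  proof -
    have "(?P * ?M) $$ (i,j) = (\<Sum>k=0..<Suc m. ((if k = i then 1 else 0) + (if k = 0 then (if i = 0 then 0 else t (i - 1)) else 0)) * ?M $$ (k,j))"
      using that by (simp add: scalar_prod_def bordered_def)
    also have "\<dots> = (\<Sum>k=0..<Suc m. (if k = i then ?M $$ (k,j) else 0)) +
       (\<Sum>k=0..<Suc m. (if k = 0 then (if i = 0 then 0 else t (i - 1)) * ?M $$ (k,j) else 0))"
      unfolding sum.distrib[symmetric] by (rule sum.cong) (auto simp: distrib_right)
    finally show ?thesis using that by (simp add: sum.delta)
  qed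
  have "?P * ?M = four_block_mat (mat 1 1 (\<lambda>_. 1)) (mat 1 m (\<lambda>(i,j). t j)) (0\<^sub>m m 1) ?B"
  proof (rule eq_matI)
    fix i j assume "i < dim_row (four_block_mat (mat 1 1 (\<lambda>_. 1)) (mat 1 m (\<lambda>(i,j). t j)) (0\<^sub>m m 1) ?B)"
      "j < dim_col (four_block_mat (mat 1 1 (\<lambda>_. 1)) (mat 1 m (\<lambda>(i,j). t j)) (0\<^sub>m m 1) ?B)"
    then have ij: "i < Suc m" "j < Suc m" by auto
    show "(?P * ?M) $$ (i,j) = four_block_mat (mat 1 1 (\<lambda>_. 1)) (mat 1 m (\<lambda>(i,j). t j)) (0\<^sub>m m 1) ?B $$ (i,j)"
      unfolding PM[OF ij] using ij by (cases i; cases j) (auto simp: bordered_def)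
  qed (auto simp: bordered_def)
  then have "det (?P * ?M) = det (mat 1 1 (\<lambda>_. 1::'a)) * det ?B"
    by (simp add: det_four_block_mat_lower_left_zero[of _ 1 _ m])
  moreover have "det (?P * ?M) = det ?P * det ?M" by (rule det_mult[OF _ M]) simp
  ultimately show ?thesis using P by (simp add: det_single)
qed

text \<open>Bordering writes the determinant as a sum of two antisymmetric ones, of sizes
  \<open>m\<close> and \<open>Suc m\<close>. The one of odd size vanishes, and the other is a square
  by \<open>pfaffian_square\<close>.\<close>

lemma det_alt_plus:
  fixes \<phi> :: "nat \<Rightarrow> int \<Rightarrow> 'a::field_char_0"
  assumes V: "finite V"
  shows "det (mat m m (\<lambda>(i,j). alt V (\<phi> i) (\<phi> j) + sum (\<phi> i) V * sum (\<phi> j) V)) = (minors_sum V m \<phi>)\<^sup>2"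
proof -
  let ?a = "\<lambda>i j. alt V (\<phi> i) (\<phi> j)" and ?t = "\<lambda>i. sum (\<phi> i) V"
  have D: "det (mat m m (\<lambda>(i,j). ?a i j + ?t i * ?t j)) = det (bordered m 0 ?t ?a) + det (mat m m (\<lambda>(i,j). ?a i j))"
    using det_bordered_one[of m ?t ?a] det_bordered_shift[of m 1 ?t ?a] by simp
  show ?thesis
  proof (cases "even m")
    case True
    then obtain n where n: "m = 2 * n" by blast
    have anti: "(case (i, j) of (0, 0) \<Rightarrow> 0 | (0, Suc j) \<Rightarrow> ?t j | (Suc i, 0) \<Rightarrow> - ?t i | (Suc i, Suc j) \<Rightarrow> ?a i j) =
      - (case (j, i) of (0, 0) \<Rightarrow> 0 | (0, Suc j) \<Rightarrow> ?t j | (Suc i, 0) \<Rightarrow> - ?t i | (Suc i, Suc j) \<Rightarrow> ?a i j)" for i j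
      by (cases i; cases j; (simp; fail)?; simp; rule alt_swap)
    have "det (bordered m 0 ?t ?a) = 0"
      unfolding bordered_def by (rule det_antisym_odd[OF _ anti]) (use True in simp)
    then show ?thesis unfolding D using pfaffian_square[OF V, of n \<phi>] by (simp add: n)
  next
    case False
    \<comment> \<open>A new column below all others, together with its indicator function as a new
      row. Since \<open>cmp\<close> from \<open>v0\<close> to every old column is 1, pairing the new
      row with an old one gives the sum \<open>?t\<close> in the border.\<close>
    define v0 where "v0 = (if V = {} then 0 else Min V - 1)"
    have v0: "v0 < v" if "v \<in> V" for v using that Min_le[OF V that] by (auto simp: v0_def)
    then have v0V: "v0 \<notin> V" by blast
    define \<psi> where "\<psi> = (\<lambda>i v. case i of 0 \<Rightarrow> if v = v0 then 1 else 0 | Suc i \<Rightarrow> if v = v0 then 0 else \<phi> i v)"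
    let ?V = "insert v0 V"
    have fV: "finite ?V" using V by simp
    have a: "alt ?V (\<psi> (Suc i)) (\<psi> (Suc j)) = ?a i j" for i j
    proof -
      have "alt ?V (\<psi> (Suc i)) (\<psi> (Suc j)) = (\<Sum>v\<in>V. \<Sum>u\<in>V. \<psi> (Suc i) v * \<psi> (Suc j) u * cmp v u)"
        using V v0V by (simp add: alt_def) (simp add: \<psi>_def)
      also have "\<dots> = ?a i j" unfolding alt_def using v0V by (intro sum.cong refl) (auto simp: \<psi>_def)
      finally show ?thesis .
    qed
    have t: "alt ?V (\<psi> 0) (\<psi> (Suc j)) = ?t j" for j
    proof -
      have "alt ?V (\<psi> 0) (\<psi> (Suc j)) = (\<Sum>u\<in>V. \<psi> 0 v0 * \<psi> (Suc j) u * cmp v0 u)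
         + (\<Sum>v\<in>V. \<Sum>u\<in>?V. \<psi> 0 v * \<psi> (Suc j) u * cmp v u)"
        using V v0V by (simp add: alt_def) (simp add: \<psi>_def)
      also have "(\<Sum>v\<in>V. \<Sum>u\<in>?V. \<psi> 0 v * \<psi> (Suc j) u * cmp v u) = 0"
        using v0V by (intro sum.neutral ballI) (auto simp: \<psi>_def)
      also have "(\<Sum>u\<in>V. \<psi> 0 v0 * \<psi> (Suc j) u * cmp v0 u) = ?t j"
        using v0 v0V by (intro sum.cong) (auto simp: \<psi>_def cmp_def)
      finally show ?thesis by simp
    qed
    have "bordered m 0 ?t ?a = mat (Suc m) (Suc m) (\<lambda>(i,j). alt ?V (\<psi> i) (\<psi> j))"
      unfolding bordered_def
      by (rule eq_matI) (auto simp: a t alt_self alt_swap[of ?V "\<psi> (Suc _)" "\<psi> 0"] split: nat.splits)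
    moreover obtain n where n: "Suc m = 2 * n" using False by (metis even_Suc evenE)
    ultimately have "det (bordered m 0 ?t ?a) = (minors_sum ?V (Suc m) \<psi>)\<^sup>2"
      using pfaffian_square[OF fV, of n \<psi>] by simp
    moreover have "det (mat m m (\<lambda>(i,j). ?a i j)) = 0"
      using False by (intro det_antisym_odd) (auto intro: alt_swap)
    \<comment> \<open>The indicator row forces \<open>v0\<close> into \<open>T\<close>. There it is
      the first column, so deleting the row and the column costs no sign.\<close>
    moreover have "minors_sum ?V (Suc m) \<psi> = minors_sum V m \<phi>"
    proof -
      have fin: "finite T" if "T \<subseteq> ?V" for T using that fV finite_subset by blast
      have s: "sdet (Suc m) \<psi> T = (if v0 \<in> T then sdet m \<phi> (T - {v0}) else 0)"
        if T: "T \<subseteq> ?V" "card T = Suc m" for T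
      proof -
        have e: "sdet (Suc m) \<psi> T = (\<Sum>v\<in>T. if v = v0 then sdet m (\<lambda>k. \<psi> (Suc k)) (T - {v0}) else 0)"
        proof (subst sdet_expand[OF fin[OF T(1)] T(2)], rule sum.cong[OF refl])
          fix v assume "v \<in> T"
          have "{u\<in>T. u < v0} = {}" using v0 T by force
          then have "lower T v0 = 0" unfolding lower_def by (metis card.empty)
          then show "(- 1) ^ lower T v * \<psi> 0 v * sdet m (\<lambda>k. \<psi> (Suc k)) (T - {v}) =
            (if v = v0 then sdet m (\<lambda>k. \<psi> (Suc k)) (T - {v0}) else 0)"
            by (simp add: \<psi>_def)
        qed
        have c: "sdet m (\<lambda>k. \<psi> (Suc k)) (T - {v0}) = sdet m \<phi> (T - {v0})" if "v0 \<in> T"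
          by (rule sdet_cong) (use that T fin in \<open>auto simp: \<psi>_def card_Diff_singleton\<close>)
        show ?thesis using fin[OF T(1)] c by (simp add: e sum.delta)
      qed
      have "minors_sum ?V (Suc m) \<psi> = (\<Sum>T | T \<subseteq> ?V \<and> card T = Suc m. if v0 \<in> T then sdet m \<phi> (T - {v0}) else 0)"
        unfolding minors_sum_def by (rule sum.cong) (use s in auto)
      also have "\<dots> = (\<Sum>T | T \<subseteq> ?V \<and> card T = Suc m \<and> v0 \<in> T. sdet m \<phi> (T - {v0}))"
        by (rule sum.mono_neutral_cong_right) (use fV in auto)
      also have "\<dots> = minors_sum V m \<phi>" unfolding minors_sum_def
        by (rule sum.reindex_bij_witness[of _ "insert v0" "\<lambda>T. T - {v0}"])
           (use v0V finite_subset[OF _ V] fin in \<open>auto simp: card_insert_if card_Diff_singleton insert_absorb\<close>)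
      finally show ?thesis .
    qed
    ultimately show ?thesis unfolding D by simp
  qed
qed

text \<open>In the pairing of a row with tail sums, columns \<open>q\<close> and \<open>p\<close>
  have coefficient 1, 2 or 0 according as \<open>p = q\<close>, \<open>p > q\<close> or
  \<open>p < q\<close>, that is \<open>cmp q p + 1\<close>. So the Gram matrix produced by
  \<open>cauchy_binet\<close> is the one in \<open>det_alt_plus\<close>; the summand 1 gives its
  rank-one part.\<close>

lemma minors_sum_square:
  fixes \<phi> :: "nat \<Rightarrow> int \<Rightarrow> 'a::field_char_0"
  assumes V: "finite V"
  shows "(\<Sum>T | T \<subseteq> V \<and> card T = m. sdet m \<phi> T * sdet m (\<lambda>i q. \<phi> i q + 2 * (\<Sum>p | p \<in> V \<and> q < p. \<phi> i p)) T)
     = (\<Sum>T | T \<subseteq> V \<and> card T = m. sdet m \<phi> T)\<^sup>2"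
proof -
  have B: "(\<Sum>q\<in>V. x q * (y q + 2 * (\<Sum>p | p \<in> V \<and> q < p. y p))) = alt V x y + sum x V * sum y V"
    for x y :: "int \<Rightarrow> 'a"
  proof -
    have "(\<Sum>q\<in>V. x q * (y q + 2 * (\<Sum>p | p \<in> V \<and> q < p. y p))) =
      (\<Sum>q\<in>V. \<Sum>p\<in>V. x q * y p * (cmp q p + 1))"
    proof (rule sum.cong[OF refl])
      fix q assume q: "q \<in> V"
      have "(\<Sum>p\<in>V. x q * y p * (cmp q p + 1)) = (\<Sum>p\<in>V. (if p = q then x q * y p else 0) + (if q < p then 2 * (x q * y p) else 0))"
        by (rule sum.cong) (auto simp: cmp_def)
      also have "\<dots> = x q * y q + (\<Sum>p\<in>V. if q < p then 2 * (x q * y p) else 0)"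
        using q V by (simp add: sum.distrib)
      also have "(\<Sum>p\<in>V. if q < p then 2 * (x q * y p) else 0) = (\<Sum>p | p \<in> V \<and> q < p. 2 * (x q * y p))"
        by (rule sum.mono_neutral_cong_right) (use V in auto)
      finally show "x q * (y q + 2 * (\<Sum>p | p \<in> V \<and> q < p. y p)) = (\<Sum>p\<in>V. x q * y p * (cmp q p + 1))"
        by (simp add: distrib_left sum_distrib_left mult_ac)
    qed
    also have "\<dots> = alt V x y + sum x V * sum y V"
      unfolding alt_def sum_product by (simp add: distrib_left sum.distrib)
    finally show ?thesis .
  qed
  show ?thesis
    using cauchy_binet[OF V, of m \<phi> "\<lambda>i q. \<phi> i q + 2 * (\<Sum>p | p \<in> V \<and> q < p. \<phi> i p)"] det_alt_plus[OF V, of m \<phi>]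
    unfolding B by (simp add: minors_sum_def)
qed

section \<open>Nonintersecting paths\<close>

lemma step_card: "step S S' \<Longrightarrow> card S = card S'"
  by (auto simp: step_def bij_betw_same_card)

lemma step_finite: "step S S' \<Longrightarrow> finite S \<longleftrightarrow> finite S'"
  by (auto simp: step_def bij_betw_finite)

lemma step_neighbour:
  assumes "step S S'" "v \<in> S"
  shows "v + 1 \<in> S' \<or> v - 1 \<in> S'"
  using assms by (auto simp: step_def bij_betw_def) (metis image_eqI)

lemma sdet_delta:
  fixes e :: "nat \<Rightarrow> int"
  assumes T: "finite T" "card T = m" and mono: "\<And>i j. i < j \<Longrightarrow> j < m \<Longrightarrow> e i < e j"
  shows "sdet m (\<lambda>i v. if v = e i then 1 else 0) T = (if T = e ` {0..<m} then 1 else (0::'a::comm_ring_1))"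
proof (cases "T = e ` {0..<m}")
  case True
  have inj: "e i = e j \<longleftrightarrow> i = j" if "i < m" "j < m" for i j
    using mono[of i j] mono[of j i] that by (cases i j rule: linorder_cases) auto
  have l: "sorted_list_of_set T = map e [0..<m]" unfolding True by (rule sorted_list_of_set_image) (rule mono)
  have "sdet m (\<lambda>i v. if v = e i then 1 else 0) T = det (1\<^sub>m m)"
    unfolding sdet_def ldet_def l by (rule arg_cong[where f = det], rule eq_matI) (auto simp: inj)
  then show ?thesis using True by simp
next
  case False
  have "\<exists>i<m. e i \<notin> T"
  proof (rule ccontr)
    assume "\<not> ?thesis"
    then have "e ` {0..<m} \<subseteq> T" by auto
    moreover have "inj_on e {0..<m}"
      by (rule inj_onI) (metis atLeastLessThan_iff linorder_neqE_nat mono order_less_irrefl)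
    then have "card (e ` {0..<m}) = m" by (simp add: card_image)
    ultimately show False using False T by (metis card_subset_eq)
  qed
  then obtain i where i: "i < m" "e i \<notin> T" by blast
  have "sdet m (\<lambda>i v. if v = e i then 1 else (0::'a)) T = 0"
    by (subst sdet_laplace[OF T i(1)], rule sum.neutral) (use i in auto)
  then show ?thesis using False by simp
qed

section \<open>Path counts and the recursion in time\<close>

fun walks :: "nat \<Rightarrow> int \<Rightarrow> rat" where
  "walks 0 d = (if d = 0 then 1 else 0)"
| "walks (Suc n) d = walks n (d - 1) + walks n (d + 1)"

lemma walks_minus: "walks n (- d) = walks n d"
proof (induction n arbitrary: d)
  case (Suc n)
  have "- d - 1 = - (d + 1)" "- d + 1 = - (d - 1)" by auto
  then show ?case using Suc[of "d - 1"] Suc[of "d + 1"] by (simp only: walks.simps add.commute)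
qed auto

lemma walks_zero: "d > int n \<Longrightarrow> walks n d = 0"
  by (induction n arbitrary: d) auto

text \<open>The starting points (time, height) in the upper half plane, latest first. At time 0 they are the
  odd heights on the left side of the hexagon; a time \<open>q \<in> Q\<close> is the position of the vertical side of a
  removed left-pointing triangle, from which a path starts at height 1.\<close>

fun starts :: "nat \<Rightarrow> nat set \<Rightarrow> nat \<Rightarrow> (nat \<times> int) list" where
  "starts b Q 0 = map (\<lambda>j. (0, 2 * int j + 1)) [0..<b]"
| "starts b Q (Suc n) = (if Suc n \<in> Q then [(Suc n, 1)] else []) @ starts b Q n"

lemma starts_time: "st \<in> set (starts b Q n) \<Longrightarrow> fst st \<le> n"
  by (induction n) (auto split: if_splits)

definition path :: "nat \<Rightarrow> nat \<times> int \<Rightarrow> int \<Rightarrow> rat" where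
  "path n st v = walks (n - fst st) (v - snd st)"

text \<open>The hypothesis keeps the truncated subtraction in \<open>path\<close> honest: one time
  unit later the walk is exactly one step longer.\<close>

lemma path_Suc:
  assumes "fst st \<le> n"
  shows "path (Suc n) st v = path n st (v - 1) + path n st (v + 1)"
  using assms by (simp add: path_def Suc_diff_le algebra_simps)

definition enter :: "nat \<Rightarrow> nat set \<Rightarrow> nat \<Rightarrow> int set" where
  "enter b Q n = (if n = 0 then (\<lambda>j. 2 * int j + 1) ` {0..<b} else if n \<in> Q then {1} else {})"

definition enter2 :: "nat \<Rightarrow> nat set \<Rightarrow> nat \<Rightarrow> int set" where
  "enter2 b Q n = enter b Q n \<union> uminus ` enter b Q n"

lemma enter_simps [simp]:
  "enter b Q 0 = (\<lambda>j. 2 * int j + 1) ` {0..<b}"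
  "enter b Q (Suc n) = (if Suc n \<in> Q then {1} else {})"
  "enter2 b Q (Suc n) = (if Suc n \<in> Q then {1, -1} else {})"
  by (auto simp: enter_def enter2_def)

text \<open>The number of families of nonintersecting paths with steps \<open>\<plusminus>1\<close> that occupy \<open>S\<close> at time \<open>n\<close>, where
  paths enter at \<open>D k\<close> at time \<open>k\<close> and stay in \<open>W\<close>.\<close>

fun cnt :: "(nat \<Rightarrow> int set) \<Rightarrow> int set \<Rightarrow> nat \<Rightarrow> int set \<Rightarrow> nat" where
  "cnt D W 0 S = (if S = D 0 then 1 else 0)"
| "cnt D W (Suc n) S = (if D (Suc n) \<subseteq> S \<and> S \<subseteq> W then \<Sum>R | step R (S - D (Suc n)). cnt D W n R else 0)"

text \<open>The reflection principle: for positive heights this counts the walks that never touch 0.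
  As a function of \<open>v\<close> it is odd.\<close>

definition row_minus :: "nat \<Rightarrow> (nat \<times> int) list \<Rightarrow> nat \<Rightarrow> int \<Rightarrow> rat" where
  "row_minus n st i v = path n (st ! i) v - path n (st ! i) (- v)"

definition row_plus :: "nat \<Rightarrow> (nat \<times> int) list \<Rightarrow> nat \<Rightarrow> int \<Rightarrow> rat" where
  "row_plus n st i v = path n (st ! i) v + path n (st ! i) (- v)"

lemma parity_step:
  assumes st: "step R T" and v: "v \<in> R" and par: "\<And>v. v \<in> T \<Longrightarrow> odd (v + int (Suc n))"
  shows "odd (v + int n)"
proof -
  from step_neighbour[OF st v] obtain w where w: "w \<in> T" "w = v + 1 \<or> w = v - 1" by blast
  have "odd (w + int (Suc n))" using par[OF w(1)] .
  then show ?thesis using w(2) by (elim disjE) simp_all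
qed

text \<open>Both sides satisfy the same recursion in time. Between entrances it is
  \<open>sdet_step\<close>; the rows are odd functions, so minors with a column at 0 vanish, which
  matches the confinement to positive heights. An entrance adds a row in front that is the indicator
  of 1 on positive columns. Since 1 is the smallest possible column, the expansion along that row
  carries no sign.\<close>

lemma cnt_one_sided:
  assumes "finite T" "T \<subseteq> {0<..}" "\<And>v. v \<in> T \<Longrightarrow> odd (v + int n)" "card T = length (starts b Q n)"
  shows "of_nat (cnt (enter b Q) {0<..} n T) = sdet (card T) (row_minus n (starts b Q n)) T"
  using assms
proof (induction n arbitrary: T)
  case 0
  have "sdet b (row_minus 0 (starts b Q 0)) T = sdet b (\<lambda>i v. if v = 2 * int i + 1 then 1 else 0) T"
    by (rule sdet_cong) (use 0 in \<open>auto simp: row_minus_def path_def\<close>)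
  also have "\<dots> = (if T = (\<lambda>j. 2 * int j + 1) ` {0..<b} then 1 else 0)"
    by (rule sdet_delta) (use 0 in auto)
  finally show ?case using 0 by simp
next
  case (Suc n)
  let ?st = "starts b Q n"
  have evolve: "sdet (card T) (row_minus (Suc n) ?st) T = of_nat (\<Sum>R | step R T. cnt (enter b Q) {0<..} n R)"
    if T: "finite T" "T \<subseteq> {0<..}" "\<And>v. v \<in> T \<Longrightarrow> odd (v + int (Suc n))" "card T = length ?st" for T
  proof -
    have "sdet (card T) (row_minus (Suc n) ?st) T =
       sdet (card T) (\<lambda>i w. row_minus n ?st i (w - 1) + row_minus n ?st i (w + 1)) T"
    proof (rule sdet_cong[OF T(1) refl])
      fix i v assume "i < card T"
      then have "fst (?st ! i) \<le> n" using T(4) by (intro starts_time[OF nth_mem]) simp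
      then show "row_minus (Suc n) ?st i v = row_minus n ?st i (v - 1) + row_minus n ?st i (v + 1)"
        by (simp add: row_minus_def path_Suc)
    qed
    also have "\<dots> = (\<Sum>R | step R T. sdet (card T) (row_minus n ?st) R)"
    proof (rule sdet_step[OF T(1) refl])
      fix u v assume "u \<in> T" "v \<in> T"
      then show "even (u - v)" using T(3)[of u] T(3)[of v] by presburger
    qed
    also have "\<dots> = (\<Sum>R | step R T. of_nat (cnt (enter b Q) {0<..} n R))"
    proof (rule sum.cong[OF refl])
      fix R assume "R \<in> {R. step R T}"
      then have R: "step R T" by simp
      note cR = step_card[OF R] and fR = step_finite[OF R]
      show "sdet (card T) (row_minus n ?st) R = of_nat (cnt (enter b Q) {0<..} n R)"
      proof (cases "0 \<in> R")
        case True
        have "cnt (enter b Q) {0<..} n R = 0"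
          using True by (cases n) auto
        moreover have "sdet (card T) (row_minus n ?st) R = 0"
        proof -
          from True obtain j where j: "j < card R" "sorted_list_of_set R ! j = 0"
            using fR T(1) by (metis in_set_conv_nth length_sorted_list_of_set set_sorted_list_of_set)
          have "ldet (card T) (row_minus n ?st) (nth (sorted_list_of_set R)) = 0"
            unfolding ldet_leibniz
          proof (rule sum.neutral, rule ballI)
            fix p
            have "(\<Prod>j=0..<card T. row_minus n ?st (p j) (sorted_list_of_set R ! j)) = 0"
              by (rule prod_zero) (use j cR in \<open>auto intro!: bexI[of _ j] simp: row_minus_def\<close>)
            then show "signof p * (\<Prod>j=0..<card T. row_minus n ?st (p j) (sorted_list_of_set R ! j)) = 0" by simp
          qed
          then show ?thesis by (simp add: sdet_def)
        qed
        ultimately show ?thesis by simp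
      next
        case False
        have "R \<subseteq> {0<..}"
        proof
          fix v assume v: "v \<in> R"
          then have "v + 1 > 0" using step_neighbour[OF R v] T(2) by auto
          moreover have "v \<noteq> 0" using v False by metis
          ultimately show "v \<in> {0<..}" by simp
        qed
        moreover have "odd (v + int n)" if "v \<in> R" for v using parity_step[OF R that T(3)] .
        ultimately show ?thesis using Suc.IH[of R] fR cR T by simp
      qed
    qed
    finally show ?thesis by simp
  qed
  show ?case
  proof (cases "Suc n \<in> Q")
    case False
    then show ?thesis using evolve[of T] Suc.prems by simp
  next
    case True
    let ?r = "row_minus (Suc n) (starts b Q (Suc n))"
    have c: "card T = Suc (length ?st)" using Suc.prems(4) True by simp
    have r0: "?r 0 v = (if v = 1 then 1 else 0)" if "v \<in> T" for v
      using that Suc.prems(2) True by (auto simp: row_minus_def path_def)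
    have r: "?r (Suc k) = row_minus (Suc n) ?st k" for k using True by (simp add: row_minus_def fun_eq_iff)
    have "sdet (card T) ?r T = (\<Sum>v\<in>T. (- 1) ^ lower T v * ?r 0 v * sdet (length ?st) (row_minus (Suc n) ?st) (T - {v}))"
      unfolding c by (subst sdet_expand[OF Suc.prems(1) c]) (simp only: r)
    also have "\<dots> = (\<Sum>v\<in>T. if v = 1 then sdet (length ?st) (row_minus (Suc n) ?st) (T - {1}) else 0)"
    proof (rule sum.cong[OF refl])
      fix v assume v: "v \<in> T"
      have "{u\<in>T. u < 1} = {}" using Suc.prems(2) by force
      then have "lower T 1 = 0" unfolding lower_def by (metis card.empty)
      then show "(- 1) ^ lower T v * ?r 0 v * sdet (length ?st) (row_minus (Suc n) ?st) (T - {v}) =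
        (if v = 1 then sdet (length ?st) (row_minus (Suc n) ?st) (T - {1}) else 0)"
        unfolding r0[OF v] by simp
    qed
    also have "\<dots> = (if 1 \<in> T then sdet (length ?st) (row_minus (Suc n) ?st) (T - {1}) else 0)"
      using Suc.prems(1) by (simp add: sum.delta)
    finally have e: "sdet (card T) ?r T = \<dots>" .
    show ?thesis
    proof (cases "1 \<in> T")
      case T1: True
      then have "card (T - {1}) = length ?st" using c by (simp add: card_Diff_singleton)
      moreover have "T - {1} \<subseteq> {0<..}" using Suc.prems(2) by blast
      ultimately show ?thesis unfolding e using evolve[of "T - {1}"] Suc.prems T1 True by simp
    next
      case False
      then show ?thesis unfolding e using True by simp
    qed
  qed
qed

text \<open>The rows are ordered as the columns \<open>T \<union> -T\<close> are, so that no sign arises when they are paired up.\<close>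

definition mirror_rows :: "nat \<Rightarrow> (nat \<Rightarrow> int \<Rightarrow> 'a) \<Rightarrow> nat \<Rightarrow> int \<Rightarrow> 'a" where
  "mirror_rows m p k v = (if k < m then p (m - 1 - k) (- v) else p (k - m) v)"

text \<open>The recursion of the one-sided count, now without a wall. A pair of entrances inserts
  two rows in the middle, the indicators of -1 and of 1, and the determinant is expanded along
  both.\<close>

lemma cnt_two_sided:
  assumes Q: "\<And>q. q \<in> Q \<Longrightarrow> even q"
    and "finite S" "\<And>v. v \<in> S \<Longrightarrow> odd (v + int n)" "card S = 2 * length (starts b Q n)"
  shows "of_nat (cnt (enter2 b Q) UNIV n S) =
    sdet (card S) (mirror_rows (length (starts b Q n)) (\<lambda>i. path n (starts b Q n ! i))) S"
  using assms(2-)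
proof (induction n arbitrary: S)
  case 0
  let ?e = "\<lambda>k. 2 * int k - 2 * int b + 1"
  have "sdet (card S) (mirror_rows (length (starts b Q 0)) (\<lambda>i. path 0 (starts b Q 0 ! i))) S =
    sdet (card S) (\<lambda>k v. if v = ?e k then 1 else 0) S"
    by (rule sdet_cong) (use 0 in \<open>auto simp: mirror_rows_def path_def of_nat_diff\<close>)
  also have "\<dots> = (if S = ?e ` {0..<2*b} then 1 else 0)"
    by (subst sdet_delta) (use 0 in auto)
  also have "?e ` {0..<2*b} = enter2 b Q 0"
  proof (intro equalityI subsetI)
    fix v assume "v \<in> ?e ` {0..<2*b}"
    then obtain k where k: "k < 2 * b" "v = ?e k" by auto
    show "v \<in> enter2 b Q 0"
    proof (cases "k < b")
      case True
      then have v: "v = - (2 * int (b - 1 - k) + 1)" and "b - 1 - k < b" using k by (auto simp: of_nat_diff)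
      then have "2 * int (b - 1 - k) + 1 \<in> enter b Q 0" by simp
      then show ?thesis unfolding enter2_def v by blast
    next
      case False
      then have "v = 2 * int (k - b) + 1" "k - b < b" using k by (auto simp: of_nat_diff)
      then show ?thesis by (auto simp: enter2_def)
    qed
  next
    fix v assume "v \<in> enter2 b Q 0"
    then obtain j where j: "j < b" "v = 2 * int j + 1 \<or> v = - (2 * int j + 1)"
      by (auto simp: enter2_def)
    from j(2) show "v \<in> ?e ` {0..<2*b}"
    proof
      assume "v = 2 * int j + 1"
      then show ?thesis using j(1) by (intro image_eqI[of _ _ "b + j"]) auto
    next
      assume "v = - (2 * int j + 1)"
      then show ?thesis using j(1) by (intro image_eqI[of _ _ "b - 1 - j"]) (auto simp: of_nat_diff)
    qed
  qed
  finally show ?case by simp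
next
  case (Suc n)
  let ?st = "starts b Q n"
  let ?R = "\<lambda>n. mirror_rows (length ?st) (\<lambda>i. path n (?st ! i))"
  have evolve: "sdet (card S) (?R (Suc n)) S = of_nat (\<Sum>R | step R S. cnt (enter2 b Q) UNIV n R)"
    if S: "finite S" "\<And>v. v \<in> S \<Longrightarrow> odd (v + int (Suc n))" "card S = 2 * length ?st" for S
  proof -
    have "sdet (card S) (?R (Suc n)) S = sdet (card S) (\<lambda>i w. ?R n i (w - 1) + ?R n i (w + 1)) S"
    proof (rule sdet_cong[OF S(1) refl])
      fix i and v :: int assume i: "i < card S"
      have "fst (?st ! j) \<le> n" if "j < length ?st" for j using that by (intro starts_time[OF nth_mem]) simp
      then have *: "path (Suc n) (?st ! j) v = path n (?st ! j) (v - 1) + path n (?st ! j) (v + 1)"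
        if "j < length ?st" for j v using path_Suc that by blast
      show "?R (Suc n) i v = ?R n i (v - 1) + ?R n i (v + 1)"
      proof (cases "i < length ?st")
        case True
        have "- (v + 1) = - v - 1" "- (v - 1) = - v + 1" by auto
        moreover have "length ?st - 1 - i < length ?st" using True by simp
        ultimately show ?thesis using True by (simp only: mirror_rows_def if_True * add.commute)
      next
        case False
        then show ?thesis using i S(3) by (simp add: mirror_rows_def *)
      qed
    qed
    also have "\<dots> = (\<Sum>R | step R S. sdet (card S) (?R n) R)"
    proof (rule sdet_step[OF S(1) refl])
      fix u v assume "u \<in> S" "v \<in> S"
      then show "even (u - v)" using S(2)[of u] S(2)[of v] by presburger
    qed
    also have "\<dots> = (\<Sum>R | step R S. of_nat (cnt (enter2 b Q) UNIV n R))"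
    proof (rule sum.cong[OF refl])
      fix R assume "R \<in> {R. step R S}"
      then have R: "step R S" by simp
      have "odd (v + int n)" if "v \<in> R" for v using parity_step[OF R that S(2)] .
      then show "sdet (card S) (?R n) R = of_nat (cnt (enter2 b Q) UNIV n R)"
        using Suc.IH[of R] step_card[OF R] step_finite[OF R] S by simp
    qed
    finally show ?thesis by simp
  qed
  show ?case
  proof (cases "Suc n \<in> Q")
    case False
    then show ?thesis using evolve[of S] Suc.prems by simp
  next
    case True
    let ?m = "length ?st"
    define r where "r = mirror_rows (length (starts b Q (Suc n))) (\<lambda>i. path (Suc n) (starts b Q (Suc n) ! i))"
    have c: "card S = Suc (Suc (2 * ?m))" using Suc.prems(3) True by simp
    have oddS: "odd v" if "v \<in> S" for v using Suc.prems(2)[OF that] Q[OF True] by simp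
    have rm: "r ?m v = (if v = - 1 then 1 else 0)" for v
      using True by (auto simp: r_def mirror_rows_def path_def)
    have rm1: "r (Suc ?m) v = (if v = 1 then 1 else 0)" for v
      using True by (auto simp: r_def mirror_rows_def path_def)
    have rk: "r (if k < ?m then k else Suc (Suc k)) = ?R (Suc n) k" for k
    proof (cases "k < ?m")
      case lt: True
      then have "?m - k = Suc (?m - Suc k)" by simp
      then show ?thesis using True lt by (simp add: r_def mirror_rows_def fun_eq_iff)
    next
      case False
      then have "Suc k - ?m = Suc (k - ?m)" by simp
      then show ?thesis using True False by (simp add: r_def mirror_rows_def fun_eq_iff)
    qed
    \<comment> \<open>Deleting row \<open>?m\<close> moves the second new row to position
      \<open>?m\<close>, so both expansions use the same row index.\<close>
    let ?r1 = "\<lambda>k. r (if k < ?m then k else Suc k)"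
    have rr: "(\<lambda>k. ?r1 (if k < ?m then k else Suc k)) = ?R (Suc n)"
    proof
      fix k
      have "(if (if k < ?m then k else Suc k) < ?m then (if k < ?m then k else Suc k) else Suc (if k < ?m then k else Suc k)) =
        (if k < ?m then k else Suc (Suc k))" by simp
      then show "?r1 (if k < ?m then k else Suc k) = ?R (Suc n) k" using rk[of k] by (simp only:)
    qed
    have "sdet (card S) r S = (\<Sum>v\<in>S. (- 1) ^ (?m + lower S v) * r ?m v * sdet (Suc (2 * ?m)) ?r1 (S - {v}))"
      using sdet_laplace[OF Suc.prems(1) c, of ?m r] c by (simp add: lower_def)
    also have "\<dots> = (\<Sum>v\<in>S. if v = -1 then (- 1) ^ (?m + lower S (-1)) * sdet (Suc (2 * ?m)) ?r1 (S - {-1}) else 0)"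
      by (rule sum.cong) (auto simp: rm)
    also have "\<dots> = (if -1 \<in> S then (- 1) ^ (?m + lower S (-1)) * sdet (Suc (2 * ?m)) ?r1 (S - {-1}) else 0)"
      using Suc.prems(1) by (simp add: sum.delta)
    finally have e1: "sdet (card S) r S = \<dots>" .
    have "of_nat (cnt (enter2 b Q) UNIV (Suc n) S) = sdet (card S) r S"
    proof (cases "-1 \<in> S \<and> 1 \<in> S")
      case in2: True
      let ?S = "S - {-1}"
      have c1: "finite ?S" "card ?S = Suc (2 * ?m)" using Suc.prems(1) c in2 by (auto simp: card_Diff_singleton)
      have "sdet (Suc (2 * ?m)) ?r1 ?S = (\<Sum>v\<in>?S. (- 1) ^ (?m + lower ?S v) * ?r1 ?m v * sdet (2 * ?m) (?R (Suc n)) (?S - {v}))"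
        using sdet_laplace[OF c1, of ?m ?r1] by (simp only: lower_def rr) simp
      also have "\<dots> = (\<Sum>v\<in>?S. if v = 1 then (- 1) ^ (?m + lower ?S 1) * sdet (2 * ?m) (?R (Suc n)) (?S - {1}) else 0)"
        by (rule sum.cong) (auto simp: rm1)
      also have "\<dots> = (- 1) ^ (?m + lower ?S 1) * sdet (2 * ?m) (?R (Suc n)) (?S - {1})"
        using c1 in2 by (simp add: sum.delta)
      finally have e2: "sdet (Suc (2 * ?m)) ?r1 ?S = \<dots>" .
      \<comment> \<open>The line \<open>Suc n\<close> is even, so all its columns are odd and none
        lies between -1 and 1. Hence the signs of the two expansions are equal and cancel.\<close>
      have "u < 1 \<and> u \<noteq> -1 \<longleftrightarrow> u < -1" if "u \<in> S" for u using oddS[OF that] by presburger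
      then have "{u\<in>?S. u < 1} = {u\<in>S. u < -1}" by blast
      then have lo: "lower ?S 1 = lower S (-1)" by (simp add: lower_def)
      have "sdet (card S) r S = sdet (2 * ?m) (?R (Suc n)) (?S - {1})"
        unfolding e1 e2 lo using in2 by (simp flip: mult.assoc power_add)
      moreover have "card (?S - {1}) = 2 * ?m" using c1 in2 by (simp add: card_Diff_singleton)
      moreover have "?S - {1} = S - enter2 b Q (Suc n)" using True by (auto simp: enter2_def)
      moreover have "enter2 b Q (Suc n) \<subseteq> S" using True in2 by (auto simp: enter2_def)
      ultimately show ?thesis using evolve[of "?S - {1}"] Suc.prems(1,2) by simp
    next
      case False
      then have z: "\<not> enter2 b Q (Suc n) \<subseteq> S" using True by (auto simp: enter2_def)
      have "sdet (card S) r S = 0"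
      proof (cases "-1 \<in> S")
        case m1: True
        let ?S = "S - {-1}"
        have c1: "finite ?S" "card ?S = Suc (2 * ?m)" using Suc.prems(1) c m1 by (auto simp: card_Diff_singleton)
        have "sdet (Suc (2 * ?m)) ?r1 ?S = 0"
          by (subst sdet_laplace[OF c1, of ?m], simp, rule sum.neutral) (use False m1 rm1 in auto)
        then show ?thesis unfolding e1 by simp
      qed (simp add: e1)
      then show ?thesis using z by simp
    qed
    then show ?thesis by (simp only: r_def)
  qed
qed

section \<open>Determinants with mirrored rows and columns\<close>

lemma det_permute_both:
  fixes G :: "nat \<Rightarrow> nat \<Rightarrow> 'a::comm_ring_1"
  assumes r: "r permutes {0..<n}"
  shows "det (mat n n (\<lambda>(i,j). G (r i) (r j))) = det (mat n n (\<lambda>(i,j). G i j))"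
proof -
  let ?A = "mat n n (\<lambda>(i,j). G i (r j))"
  have "mat n n (\<lambda>(i,j). G (r i) (r j)) = mat n n (\<lambda>(i,j). ?A $$ (r i, j))"
    by (rule eq_matI) (use r in \<open>auto dest: permutes_less_bound\<close>)
  then have "det (mat n n (\<lambda>(i,j). G (r i) (r j))) = signof r * det ?A"
    by (simp add: det_permute_rows[OF _ r])
  also have "det ?A = signof r * det (mat n n (\<lambda>(i,j). G i j))"
    using ldet_permute_cols[OF r, of G "\<lambda>j. j"] by (simp add: ldet_def)
  finally show ?thesis by (simp flip: mult.assoc of_int_mult add: sign_idempotent)
qed

text \<open>Subtracting the second block row from the first and then adding the first block column
  to the second makes the matrix block triangular.\<close>

lemma det_block_symmetric:
  fixes A B :: "'a::idom mat"
  assumes A: "A \<in> carrier_mat m m" and B: "B \<in> carrier_mat m m"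
  shows "det (four_block_mat A B B A) = det (A - B) * det (A + B)"
proof -
  let ?U = "four_block_mat (1\<^sub>m m) (- (1\<^sub>m m)) (0\<^sub>m m m) (1\<^sub>m m) :: 'a mat"
  let ?W = "four_block_mat (1\<^sub>m m) (1\<^sub>m m) (0\<^sub>m m m) (1\<^sub>m m) :: 'a mat"
  let ?M = "four_block_mat A B B A"
  have dU: "det ?U = 1" by (subst det_four_block_mat_lower_left_zero[of _ m _ m]) auto
  have dW: "det ?W = 1" by (subst det_four_block_mat_lower_left_zero[of _ m _ m]) auto
  have UM: "?U * ?M = four_block_mat (A - B) (B - A) B A"
    using A B by (subst mult_four_block_mat[of _ m m _ m _ m _ _ m _ m])
      (auto intro!: arg_cong2[where f = "\<lambda>X Y. four_block_mat X Y B A"] eq_matI)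
  have "?U * ?M * ?W = four_block_mat (A - B) (0\<^sub>m m m) B (A + B)"
    unfolding UM using A B by (subst mult_four_block_mat[of _ m m _ m _ m _ _ m _ m])
      (auto intro!: arg_cong2[where f = "\<lambda>X Y. four_block_mat (A - B) X B Y"] eq_matI)
  then have "det (?U * ?M * ?W) = det (four_block_mat (A - B) (0\<^sub>m m m) B (A + B))" by simp
  also have "\<dots> = det (A - B) * det (A + B)"
    by (rule det_four_block_mat_upper_right_zero[of _ m _ m]) (use A B in auto)
  finally have "det (?U * ?M * ?W) = det (A - B) * det (A + B)" .
  moreover have "det (?U * ?M * ?W) = det ?U * det ?M * det ?W"
  proof -
    have c: "?U \<in> carrier_mat (m + m) (m + m)" "?M \<in> carrier_mat (m + m) (m + m)" "?W \<in> carrier_mat (m + m) (m + m)"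
      using A B by auto
    show ?thesis using det_mult[OF mult_carrier_mat[OF c(1,2)] c(3)] det_mult[OF c(1,2)] by simp
  qed
  ultimately show ?thesis using dU dW by simp
qed

text \<open>In sorted order the negative columns appear in reverse, and so do the first
  \<open>m\<close> rows. Undoing the reversal on both sides leaves the determinant unchanged and
  exposes the block form of \<open>det_block_symmetric\<close>.\<close>

lemma sdet_mirror:
  fixes p :: "nat \<Rightarrow> int \<Rightarrow> 'a::idom"
  assumes T: "finite T" "card T = m" "T \<subseteq> {0<..}"
  shows "sdet (2 * m) (mirror_rows m p) (T \<union> uminus ` T) =
    sdet m (\<lambda>i v. p i v - p i (- v)) T * sdet m (\<lambda>i v. p i v + p i (- v)) T"
proof -
  define t where "t = nth (sorted_list_of_set T)"
  have bij: "bij_betw t {0..<m} T"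
    using bij_betw_nth[of "sorted_list_of_set T" "{0..<m}" T] T by (auto simp: t_def atLeast0LessThan)
  have t_less: "t i < t j" if "i < j" "j < m" for i j
    unfolding t_def by (rule sorted_wrt_nth_less[OF strict_sorted_list_of_set]) (use that T in auto)
  have t_pos: "t i > 0" if "i < m" for i
    using subsetD[OF T(3), of "t i"] bij_betwE[OF bij] that by simp
  define w where "w = (\<lambda>k. if k < m then - t (m - 1 - k) else t (k - m))"
  have w_less: "w i < w j" if "i < j" "j < 2 * m" for i j
  proof -
    consider "j < m" | "i < m" "\<not> j < m" | "\<not> i < m" "\<not> j < m" using that by linarith
    then show ?thesis
    proof cases
      case 1
      then have "t (m - 1 - j) < t (m - 1 - i)" using that by (intro t_less) auto
      then show ?thesis using 1 that by (simp add: w_def)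
    next
      case 2
      have "t (m - 1 - i) > 0" "t (j - m) > 0" by (rule t_pos, use 2 that in linarith)+
      then show ?thesis using 2 by (simp add: w_def)
    next
      case 3
      then have "t (i - m) < t (j - m)" using that by (intro t_less) auto
      then show ?thesis using 3 by (simp add: w_def)
    qed
  qed
  have img: "w ` {0..<2*m} = T \<union> uminus ` T"
  proof (intro equalityI subsetI)
    fix v assume "v \<in> w ` {0..<2*m}"
    then obtain k where k: "k < 2 * m" "v = w k" by auto
    show "v \<in> T \<union> uminus ` T"
    proof (cases "k < m")
      case True
      then have "t (m - 1 - k) \<in> T" using bij by (auto simp: bij_betw_def)
      then show ?thesis using k True by (simp add: w_def)
    next
      case False
      then have "t (k - m) \<in> T" using bij k by (auto simp: bij_betw_def)
      then show ?thesis using k False by (simp add: w_def)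
    qed
  next
    fix v assume "v \<in> T \<union> uminus ` T"
    then obtain u where u: "u \<in> T" "v = u \<or> v = - u" by blast
    then obtain j where j: "j < m" "u = t j" using bij by (auto simp: bij_betw_def)
    from u(2) show "v \<in> w ` {0..<2*m}"
    proof
      assume "v = u" then show ?thesis using j by (intro image_eqI[of _ _ "m + j"]) (auto simp: w_def)
    next
      assume "v = - u" then show ?thesis using j by (intro image_eqI[of _ _ "m - 1 - j"]) (auto simp: w_def)
    qed
  qed
  define G where "G = (\<lambda>i j. let i' = (if i < m then i else i - m); j' = (if j < m then j else j - m) in
     if i < m \<longleftrightarrow> j < m then p i' (t j') else p i' (- t j'))"
  define r where "r = (\<lambda>k. if k < m then m - 1 - k else k)"
  have "bij_betw r {0..<2*m} {0..<2*m}"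
    by (rule bij_betw_byWitness[of _ r]) (auto simp: r_def)
  then have r: "r permutes {0..<2*m}" by (intro bij_imp_permutes) (auto simp: r_def)
  have srt: "sorted_list_of_set (T \<union> uminus ` T) = map w [0..<2*m]"
    unfolding img[symmetric] by (rule sorted_list_of_set_image) (rule w_less)
  have "sdet (2 * m) (mirror_rows m p) (T \<union> uminus ` T) = det (mat (2*m) (2*m) (\<lambda>(i,j). G (r i) (r j)))"
    unfolding sdet_def ldet_def srt
    by (rule arg_cong[where f = det], rule eq_matI) (auto simp: G_def r_def mirror_rows_def w_def)
  also have "\<dots> = det (mat (2*m) (2*m) (\<lambda>(i,j). G i j))" by (rule det_permute_both[OF r])
  also have "mat (2*m) (2*m) (\<lambda>(i,j). G i j) =
    four_block_mat (mat m m (\<lambda>(i,j). p i (t j))) (mat m m (\<lambda>(i,j). p i (- t j)))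
      (mat m m (\<lambda>(i,j). p i (- t j))) (mat m m (\<lambda>(i,j). p i (t j)))"
    by (rule eq_matI) (auto simp: G_def)
  also have "det \<dots> = det (mat m m (\<lambda>(i,j). p i (t j)) - mat m m (\<lambda>(i,j). p i (- t j))) *
     det (mat m m (\<lambda>(i,j). p i (t j)) + mat m m (\<lambda>(i,j). p i (- t j)))"
    by (rule det_block_symmetric) auto
  also have "mat m m (\<lambda>(i,j). p i (t j)) - mat m m (\<lambda>(i,j). p i (- t j)) = mat m m (\<lambda>(i,j). p i (t j) - p i (- t j))"
    by (rule eq_matI) auto
  also have "mat m m (\<lambda>(i,j). p i (t j)) + mat m m (\<lambda>(i,j). p i (- t j)) = mat m m (\<lambda>(i,j). p i (t j) + p i (- t j))"
    by (rule eq_matI) auto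
  finally show ?thesis by (simp add: sdet_def ldet_def t_def)
qed

section \<open>Tail sums of reflected path counts\<close>

text \<open>In closed form a sliding window: the sum of \<open>walks n (v - 1 + 2 * l)\<close> over
  all integers \<open>l\<close> between \<open>- j\<close> and \<open>j\<close>. Moving
  \<open>v\<close> by 2 moves the window by one place. The difference of the two windows therefore
  consists of two end terms, which form the reflected count for the start \<open>2 * j + 1\<close>.
  Their sum contains the end terms once and everything between them twice, and the latter are the
  counts with plus sign for the lower starts.\<close>

primrec tail_walks :: "nat \<Rightarrow> nat \<Rightarrow> int \<Rightarrow> rat" where
  "tail_walks n 0 v = walks n (v - 1)"
| "tail_walks n (Suc j) v = tail_walks n j v + walks n (v - 2 * int j - 3) + walks n (v + 2 * int j + 1)"

lemma tail_walks_diff: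
  "tail_walks n j v - tail_walks n j (v + 2) = walks n (v - (2 * int j + 1)) - walks n (v + (2 * int j + 1))"
  by (induction j) (simp_all add: algebra_simps)

lemma tail_walks_sum:
  "tail_walks n j v + tail_walks n j (v + 2) =
    walks n (v - (2 * int j + 1)) + walks n (v + (2 * int j + 1)) +
    2 * (\<Sum>l<j. walks n (v - (2 * int l + 1)) + walks n (v + (2 * int l + 1)))"
  by (induction j) (simp_all add: algebra_simps)

lemma tail_walks_zero: "v > int n + 2 * int j + 1 \<Longrightarrow> tail_walks n j v = 0"
  by (induction j) (auto simp: walks_zero)

definition ends :: "nat \<Rightarrow> nat \<Rightarrow> nat \<Rightarrow> int set" where
  "ends b A h = {v. 0 < v \<and> int h \<le> v \<and> odd (v + int A) \<and> v \<le> int A + 2 * int b}"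

lemma finite_ends: "finite (ends b A h)"
  by (rule finite_subset[of _ "{0..int A + 2 * int b}"]) (auto simp: ends_def)

lemma tail_sum:
  assumes v: "v \<in> ends b A h" and n: "n \<le> A" and j: "j < b \<or> j = 0 \<and> n < A + 2 * b"
  shows "walks n (v - (2 * int j + 1)) - walks n (v + (2 * int j + 1)) +
      2 * (\<Sum>p | p \<in> ends b A h \<and> v < p. walks n (p - (2 * int j + 1)) - walks n (p + (2 * int j + 1))) =
    walks n (v - (2 * int j + 1)) + walks n (v + (2 * int j + 1)) +
      2 * (\<Sum>l<j. walks n (v - (2 * int l + 1)) + walks n (v + (2 * int l + 1)))"
proof -
  \<comment> \<open>The number of end heights above \<open>v\<close>.\<close>
  define L where "L = nat ((int A + 2 * int b - v) div 2)"
  have v': "v \<le> int A + 2 * int b" "odd (v + int A)" "0 < v" "int h \<le> v" using v by (auto simp: ends_def)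
  have L: "v + 2 * int L + 2 > int A + 2 * int b" "v + 2 * int L \<le> int A + 2 * int b"
    using v' by (auto simp: L_def)
  let ?g = "\<lambda>i. v + 2 + 2 * int i"
  \<comment> \<open>Above \<open>v\<close> the bound \<open>h\<close> holds automatically, so these
    are all heights of the right parity up to the top. This is why the rhombus does not disturb the
    telescoping.\<close>
  have img: "{p. p \<in> ends b A h \<and> v < p} = ?g ` {..<L}"
  proof (intro equalityI subsetI)
    fix p assume "p \<in> {p. p \<in> ends b A h \<and> v < p}"
    then have p: "v < p" "odd (p + int A)" "p \<le> int A + 2 * int b" by (auto simp: ends_def)
    have "even (p - v)" using p(2) v'(2) by presburger
    then obtain i where i: "p - v = 2 * i" by blast
    then have "p = ?g (nat (i - 1))" using p by auto
    moreover have "nat (i - 1) < L" using i p L by linarith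
    ultimately show "p \<in> ?g ` {..<L}" by blast
  next
    fix p assume "p \<in> ?g ` {..<L}"
    then obtain i where "i < L" "p = ?g i" by blast
    then show "p \<in> {p. p \<in> ends b A h \<and> v < p}" using v' L by (auto simp: ends_def)
  qed
  have "(\<Sum>p | p \<in> ends b A h \<and> v < p. walks n (p - (2 * int j + 1)) - walks n (p + (2 * int j + 1))) =
    (\<Sum>i<L. walks n (?g i - (2 * int j + 1)) - walks n (?g i + (2 * int j + 1)))"
    unfolding img by (subst sum.reindex) (auto intro!: inj_onI)
  also have "\<dots> = (\<Sum>i<L. tail_walks n j (?g i) - tail_walks n j (?g (Suc i)))"
    by (rule sum.cong[OF refl], subst tail_walks_diff[symmetric]) (simp add: algebra_simps)
  also have "\<dots> = tail_walks n j (?g 0) - tail_walks n j (?g L)"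
    by (rule sum_lessThan_telescope')
  also have "tail_walks n j (?g L) = 0"
    by (rule tail_walks_zero) (use L n j in auto)
  finally have s: "(\<Sum>p | p \<in> ends b A h \<and> v < p. walks n (p - (2 * int j + 1)) - walks n (p + (2 * int j + 1))) =
    tail_walks n j (v + 2)" by simp
  show ?thesis unfolding s using tail_walks_sum[of n j v] tail_walks_diff[of n j v] by simp
qed

lemma starts_split:
  "\<exists>pre. starts b Q A = pre @ map (\<lambda>j. (0, 2 * int j + 1)) [0..<b] \<and> (\<forall>st\<in>set pre. snd st = 1)"
proof (induction A)
  case (Suc A)
  then obtain pre where "starts b Q A = pre @ map (\<lambda>j. (0, 2 * int j + 1)) [0..<b]" "\<forall>st\<in>set pre. snd st = 1" by blast
  then show ?case by (intro exI[of _ "(if Suc A \<in> Q then [(Suc A, 1)] else []) @ pre"]) auto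
qed auto

lemma row_minus_walks: "row_minus n st i v = walks (n - fst (st ! i)) (v - snd (st ! i)) - walks (n - fst (st ! i)) (v + snd (st ! i))"
  using walks_minus[of "n - fst (st ! i)" "v + snd (st ! i)"] by (simp add: row_minus_def path_def)

lemma row_plus_walks: "row_plus n st i v = walks (n - fst (st ! i)) (v - snd (st ! i)) + walks (n - fst (st ! i)) (v + snd (st ! i))"
  using walks_minus[of "n - fst (st ! i)" "v + snd (st ! i)"] by (simp add: row_plus_def path_def)

text \<open>This is the unitriangular change of rows that turns the tail sums of \<open>X\<close> into \<open>Z\<close>.\<close>

lemma sdet_tail:
  assumes b: "b > 0" and T: "T \<subseteq> ends b A h" "card T = length (starts b Q A)"
  shows "sdet (card T) (\<lambda>i q. row_minus A (starts b Q A) i q +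
      2 * (\<Sum>p | p \<in> ends b A h \<and> q < p. row_minus A (starts b Q A) i p)) T =
    sdet (card T) (row_plus A (starts b Q A)) T"
proof -
  let ?st = "starts b Q A"
  let ?m = "length ?st"
  obtain pre where pre: "?st = pre @ map (\<lambda>j. (0, 2 * int j + 1)) [0..<b]" "\<forall>st\<in>set pre. snd st = 1"
    using starts_split by blast
  define q where "q = length pre"
  have m: "?m = q + b" by (simp add: pre q_def)
  \<comment> \<open>The coefficients of \<open>tail_walks_sum\<close>: a start at time 0 receives
    twice the rows of the lower starts at time 0. The rows before \<open>q\<close> belong to starts
    of height 1 at later times, where no lower start occurs and the row is unchanged.\<close>
  define P where "P = (\<lambda>i k. if k = i then 1 else if q \<le> k \<and> k < i then 2 else (0::rat))"
  have fT: "finite T" using T(1) finite_ends finite_subset by blast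
  have row: "row_minus A ?st i v + 2 * (\<Sum>p | p \<in> ends b A h \<and> v < p. row_minus A ?st i p) =
     rowop P ?m (row_plus A ?st) i v" if i: "i < ?m" and v: "v \<in> ends b A h" for i v
  proof -
    have R: "rowop P ?m (row_plus A ?st) i v = row_plus A ?st i v + 2 * (\<Sum>k=q..<i. row_plus A ?st k v)"
    proof -
      have "rowop P ?m (row_plus A ?st) i v = (\<Sum>k=0..<?m. (if k = i then row_plus A ?st k v else 0)
           + (if q \<le> k \<and> k < i then 2 * row_plus A ?st k v else 0))"
        unfolding rowop_def by (rule sum.cong) (auto simp: P_def)
      also have "\<dots> = row_plus A ?st i v + (\<Sum>k=0..<?m. if q \<le> k \<and> k < i then 2 * row_plus A ?st k v else 0)"
        using i by (simp add: sum.distrib)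
      also have "(\<Sum>k=0..<?m. if q \<le> k \<and> k < i then 2 * row_plus A ?st k v else 0) = (\<Sum>k=q..<i. 2 * row_plus A ?st k v)"
        by (rule sum.mono_neutral_cong_right) (use i in auto)
      finally show ?thesis by (simp add: sum_distrib_left)
    qed
    show ?thesis
    proof (cases "i < q")
      case True
      then have "snd (?st ! i) = 1" using pre by (simp add: q_def nth_append)
      then show ?thesis unfolding R row_minus_walks row_plus_walks
        using tail_sum[OF v, of "A - fst (?st ! i)" 0] True b by simp
    next
      case False
      define j where "j = i - q"
      have j: "i = q + j" "j < b" using False i m by (auto simp: j_def)
      have st: "?st ! (q + l) = (0, 2 * int l + 1)" if "l < b" for l
        using that by (simp add: pre q_def nth_append)
      have "(\<Sum>k=q..<q+j. row_plus A ?st k v) = (\<Sum>l<j. row_plus A ?st (q + l) v)"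
        using sum.shift_bounds_nat_ivl[of "\<lambda>k. row_plus A ?st k v" 0 q j]
        by (simp add: atLeast0LessThan add.commute)
      also have "\<dots> = (\<Sum>l<j. walks A (v - (2 * int l + 1)) + walks A (v + (2 * int l + 1)))"
        by (rule sum.cong) (use j st in \<open>auto simp: row_plus_walks\<close>)
      finally show ?thesis unfolding R unfolding j(1) row_minus_walks
        using tail_sum[OF v, of A j] j(2) by (simp add: st row_plus_walks)
    qed
  qed
  have "sdet (card T) (\<lambda>i q. row_minus A ?st i q + 2 * (\<Sum>p | p \<in> ends b A h \<and> q < p. row_minus A ?st i p)) T =
    sdet (card T) (rowop P ?m (row_plus A ?st)) T"
    by (rule sdet_cong[OF fT refl]) (use row T in auto)
  also have "\<dots> = det (mat ?m ?m (\<lambda>(i,k). P i k)) * sdet ?m (row_plus A ?st) T"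
    unfolding T(2) by (rule sdet_rowop)
  also have "det (mat ?m ?m (\<lambda>(i,k). P i k)) = 1"
    by (rule det_lower_unitriangular) (auto simp: P_def)
  finally show ?thesis by (simp add: T)
qed

lemma cnt_square:
  fixes A b h :: nat
  assumes b: "b > 0" and Q: "\<And>q. q \<in> Q \<Longrightarrow> even q"
  defines "m \<equiv> length (starts b Q A)"
  shows "(\<Sum>T | T \<subseteq> ends b A h \<and> card T = m. cnt (enter2 b Q) UNIV A (T \<union> uminus ` T)) =
    (\<Sum>T | T \<subseteq> ends b A h \<and> card T = m. cnt (enter b Q) {0<..} A T)\<^sup>2"
proof -
  let ?st = "starts b Q A"
  let ?V = "ends b A h"
  have one: "of_nat (cnt (enter b Q) {0<..} A T) = sdet m (row_minus A ?st) T" if T: "T \<subseteq> ?V" "card T = m" for T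
  proof -
    have "finite T" using T(1) finite_ends finite_subset by blast
    moreover have "T \<subseteq> {0<..}" "\<And>v. v \<in> T \<Longrightarrow> odd (v + int A)" using T by (auto simp: ends_def)
    ultimately show ?thesis using cnt_one_sided[of T A b Q] T by (simp add: m_def)
  qed
  have two: "of_nat (cnt (enter2 b Q) UNIV A (T \<union> uminus ` T)) =
      sdet m (row_minus A ?st) T * sdet m (row_plus A ?st) T" if T: "T \<subseteq> ?V" "card T = m" for T
  proof -
    let ?S = "T \<union> uminus ` T"
    have fT: "finite T" using T(1) finite_ends finite_subset by blast
    have pos: "T \<subseteq> {0<..}" using T by (auto simp: ends_def)
    have "u \<noteq> - v" if "u \<in> T" "v \<in> T" for u v using subsetD[OF pos that(1)] subsetD[OF pos that(2)] by simp
    then have "T \<inter> uminus ` T = {}" by blast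
    then have c: "card ?S = 2 * m" using fT T by (simp add: card_Un_disjoint card_image)
    have "odd (v + int A)" if "v \<in> ?S" for v using that T by (auto simp: ends_def)
    then have "of_nat (cnt (enter2 b Q) UNIV A ?S) = sdet (card ?S) (mirror_rows m (\<lambda>i. path A (?st ! i))) ?S"
      using cnt_two_sided[OF Q, where S = ?S and n = A and b = b] fT c unfolding m_def by blast
    also have "\<dots> = sdet m (\<lambda>i v. path A (?st ! i) v - path A (?st ! i) (- v)) T *
        sdet m (\<lambda>i v. path A (?st ! i) v + path A (?st ! i) (- v)) T"
      unfolding c by (rule sdet_mirror[OF fT T(2) pos])
    finally show ?thesis by (simp add: row_minus_def[abs_def] row_plus_def[abs_def])
  qed
  have "of_nat (\<Sum>T | T \<subseteq> ?V \<and> card T = m. cnt (enter2 b Q) UNIV A (T \<union> uminus ` T)) =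
    (\<Sum>T | T \<subseteq> ?V \<and> card T = m. sdet m (row_minus A ?st) T * sdet m (row_plus A ?st) T)"
    unfolding of_nat_sum by (rule sum.cong) (use two in auto)
  also have "\<dots> = (\<Sum>T | T \<subseteq> ?V \<and> card T = m. sdet m (row_minus A ?st) T *
      sdet m (\<lambda>i q. row_minus A ?st i q + 2 * (\<Sum>p | p \<in> ?V \<and> q < p. row_minus A ?st i p)) T)"
    by (rule sum.cong) (use sdet_tail[OF b] in \<open>auto simp: m_def\<close>)
  also have "\<dots> = (\<Sum>T | T \<subseteq> ?V \<and> card T = m. sdet m (row_minus A ?st) T)\<^sup>2"
    by (rule minors_sum_square[OF finite_ends])
  also have "(\<Sum>T | T \<subseteq> ?V \<and> card T = m. sdet m (row_minus A ?st) T) =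
      of_nat (\<Sum>T | T \<subseteq> ?V \<and> card T = m. cnt (enter b Q) {0<..} A T)"
    unfolding of_nat_sum by (rule sum.cong) (use one in auto)
  finally have "(of_nat (\<Sum>T | T \<subseteq> ?V \<and> card T = m. cnt (enter2 b Q) UNIV A (T \<union> uminus ` T)) :: rat) =
    of_nat ((\<Sum>T | T \<subseteq> ?V \<and> card T = m. cnt (enter b Q) {0<..} A T)\<^sup>2)" by simp
  then show ?thesis by (simp only: of_nat_eq_iff)
qed

section \<open>Tilings as matchings of cells\<close>

type_synonym cell = "int \<times> int"

text \<open>The cell \<open>(x, y)\<close> is the unit triangle between the vertical lines \<open>x\<close> and \<open>x + 1\<close> that is symmetric
  about the height \<open>y + h\<close>; it points to the left iff \<open>x + y\<close> is even.\<close>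

definition tri :: "int \<Rightarrow> cell \<Rightarrow> pt set" where
  "tri h = (\<lambda>(x, y). if even (x + y) then {(x, y + h), (x + 1, y + h - 1), (x + 1, y + h + 1)}
     else {(x, y + h - 1), (x, y + h + 1), (x + 1, y + h)})"

definition adj :: "cell \<Rightarrow> cell \<Rightarrow> bool" where
  "adj = (\<lambda>(x, y) (x', y'). (x = x' \<and> (y' = y + 1 \<or> y' = y - 1))
     \<or> (y = y' \<and> (x' = x + 1 \<and> even (x + y) \<or> x' = x - 1 \<and> odd (x + y))))"

lemma adj_irrefl: "\<not> adj c c"
  by (auto simp: adj_def split: prod.splits)

text \<open>The sum of the first coordinates modulo 3 shows the orientation, so the two sums
  identify the cell.\<close>

lemma tri_sums:
  "(\<Sum>v\<in>tri h (x, y). fst v) = (if even (x + y) then 3 * x + 2 else 3 * x + 1)"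
  "(\<Sum>v\<in>tri h (x, y). snd v) = 3 * (y + h)"
  by (auto simp: tri_def)

lemma inj_tri: "inj (tri h)"
proof (rule injI)
  fix c d :: cell assume eq: "tri h c = tri h d"
  obtain x y x' y' where cd: "c = (x, y)" "d = (x', y')" by (metis surj_pair)
  have "y = y'" using tri_sums(2)[of h x y] tri_sums(2)[of h x' y'] eq cd by simp
  moreover have "x = x'" using tri_sums(1)[of h x y] tri_sums(1)[of h x' y'] eq cd by (auto split: if_splits; presburger)
  ultimately show "c = d" using cd by simp
qed

lemma range_tri:
  assumes "even h"
  shows "range (tri h) = unit_tris"
proof (intro equalityI subsetI)
  fix t assume "t \<in> range (tri h)"
  then obtain x y where t: "t = tri h (x, y)" by auto
  show "t \<in> unit_tris"
  proof (cases "even (x + y)")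
    case True
    then have "even (x + (y + h))" using assms by simp
    moreover have "t = {(x, y + h), (x + 1, y + h - 1), (x + 1, y + h + 1)}" using True by (simp add: t tri_def)
    ultimately show ?thesis unfolding unit_tris_def by blast
  next
    case False
    then have "odd (x + (y + h))" using assms by simp
    moreover have "t = {(x, y + h - 1), (x, y + h + 1), (x + 1, y + h)}" using False by (simp add: t tri_def)
    ultimately show ?thesis unfolding unit_tris_def by blast
  qed
next
  fix t assume "t \<in> unit_tris"
  then consider x y where "even (x + y)" "t = {(x, y), (x + 1, y - 1), (x + 1, y + 1)}"
    | x y where "odd (x + y)" "t = {(x, y - 1), (x, y + 1), (x + 1, y)}"
    unfolding unit_tris_def by blast
  then show "t \<in> range (tri h)"
  proof cases
    case (1 x y)
    then have "t = tri h (x, y - h)" using assms by (simp add: tri_def)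
    then show ?thesis by blast
  next
    case (2 x y)
    then have "t = tri h (x, y - h)" using assms by (simp add: tri_def)
    then show ?thesis by blast
  qed
qed

lemma card_inter_three:
  assumes "p \<noteq> q" "p \<noteq> r" "q \<noteq> r"
  shows "card ({p, q, r} \<inter> S) = (if p \<in> S then 1 else 0) + (if q \<in> S then 1 else 0) + (if r \<in> S then 1 else 0)"
  using assms by (simp add: Int_insert_left)

lemma card_tri_inter:
  assumes "c \<noteq> d"
  shows "card (tri h c \<inter> tri h d) = 2 \<longleftrightarrow> adj c d"
proof -
  obtain x y x' y' where cd: "c = (x, y)" "d = (x', y')" by (metis surj_pair)
  have ne: "x \<noteq> x' \<or> y \<noteq> y'" using assms cd by auto
  have L: "card (tri h (x, y) \<inter> S) = (if (x, y + h) \<in> S then 1 else 0) +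
     (if (x + 1, y + h - 1) \<in> S then 1 else 0) + (if (x + 1, y + h + 1) \<in> S then 1 else 0)" if "even (x + y)" for S
    unfolding tri_def using that by (simp only: prod.case if_True) (rule card_inter_three; simp)
  have R: "card (tri h (x, y) \<inter> S) = (if (x, y + h - 1) \<in> S then 1 else 0) +
     (if (x, y + h + 1) \<in> S then 1 else 0) + (if (x + 1, y + h) \<in> S then 1 else 0)" if "odd (x + y)" for S
    unfolding tri_def using that by (simp only: prod.case if_False) (rule card_inter_three; simp)
  \<comment> \<open>How two triangles meet depends only on the difference of their cells and on
    their orientations.\<close>
  define u v where "u = x' - x" and "v = y' - y"
  have uv: "x' = x + u" "y' = y + v" by (auto simp: u_def v_def)
  have n0: "u \<noteq> 0 \<or> v \<noteq> 0" using ne by (auto simp: u_def v_def)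
  have par: "even (x' + y') \<longleftrightarrow> (even (x + y) \<longleftrightarrow> even (u + v))" unfolding uv by presburger
  have A: "adj (x, y) (x', y') \<longleftrightarrow> u = 0 \<and> (v = 1 \<or> v = -1) \<or> v = 0 \<and> (u = 1 \<and> even (x + y) \<or> u = -1 \<and> odd (x + y))"
    unfolding adj_def uv by auto
  show ?thesis
  proof (cases "even (x + y)")
    case e: True
    show ?thesis
    proof (cases "even (u + v)")
      case True
      then have e': "even (x' + y')" using e par by simp
      have m: "(x, y + h) \<in> tri h (x', y') \<longleftrightarrow> u = -1 \<and> (v = 1 \<or> v = -1)"
        "(x + 1, y + h - 1) \<in> tri h (x', y') \<longleftrightarrow> u = 1 \<and> v = -1 \<or> u = 0 \<and> v = -2"
        "(x + 1, y + h + 1) \<in> tri h (x', y') \<longleftrightarrow> u = 1 \<and> v = 1 \<or> u = 0 \<and> v = 2"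
        unfolding tri_def using e' n0 by (auto simp: u_def v_def)
      show ?thesis unfolding cd A L[OF e] m using True by auto
    next
      case False
      then have e': "odd (x' + y')" using e par by simp
      have m: "(x, y + h) \<in> tri h (x', y') \<longleftrightarrow> u = 0 \<and> (v = 1 \<or> v = -1) \<or> u = -1 \<and> v = 0"
        "(x + 1, y + h - 1) \<in> tri h (x', y') \<longleftrightarrow> u = 1 \<and> (v = 0 \<or> v = -2) \<or> u = 0 \<and> v = -1"
        "(x + 1, y + h + 1) \<in> tri h (x', y') \<longleftrightarrow> u = 1 \<and> (v = 0 \<or> v = 2) \<or> u = 0 \<and> v = 1"
        unfolding tri_def using e' by (auto simp: u_def v_def)
      show ?thesis unfolding cd A L[OF e] m using e by auto
    qed
  next
    case e: False
    show ?thesis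
    proof (cases "even (u + v)")
      case True
      then have e': "odd (x' + y')" using e par by simp
      have m: "(x, y + h - 1) \<in> tri h (x', y') \<longleftrightarrow> u = 0 \<and> v = -2 \<or> u = -1 \<and> v = -1"
        "(x, y + h + 1) \<in> tri h (x', y') \<longleftrightarrow> u = 0 \<and> v = 2 \<or> u = -1 \<and> v = 1"
        "(x + 1, y + h) \<in> tri h (x', y') \<longleftrightarrow> u = 1 \<and> (v = 1 \<or> v = -1)"
        unfolding tri_def using e' n0 by (auto simp: u_def v_def)
      show ?thesis unfolding cd A R[OF e] m using True by auto
    next
      case False
      then have e': "even (x' + y')" using e par by simp
      have m: "(x, y + h - 1) \<in> tri h (x', y') \<longleftrightarrow> u = 0 \<and> v = -1 \<or> u = -1 \<and> (v = 0 \<or> v = -2)"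
        "(x, y + h + 1) \<in> tri h (x', y') \<longleftrightarrow> u = 0 \<and> v = 1 \<or> u = -1 \<and> (v = 0 \<or> v = 2)"
        "(x + 1, y + h) \<in> tri h (x', y') \<longleftrightarrow> u = 1 \<and> v = 0 \<or> u = 0 \<and> (v = 1 \<or> v = -1)"
        unfolding tri_def using e' by (auto simp: u_def v_def)
      show ?thesis unfolding cd A R[OF e] m using e by auto
    qed
  qed
qed

text \<open>A tiling becomes the involution that exchanges the two cells of each lozenge. Since all
  other cells are fixed, equality of functions is equality of tilings, and invariance under a
  symmetry means commuting with it.\<close>

definition matchings :: "cell set \<Rightarrow> (cell \<Rightarrow> cell) set" where
  "matchings R = {\<mu>. (\<forall>c. \<mu> (\<mu> c) = c) \<and> (\<forall>c\<in>R. adj c (\<mu> c)) \<and> (\<forall>c. c \<notin> R \<longrightarrow> \<mu> c = c)}"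

lemma matchingsD:
  assumes "\<mu> \<in> matchings R"
  shows "\<mu> (\<mu> c) = c" "c \<in> R \<Longrightarrow> adj c (\<mu> c)" "c \<notin> R \<Longrightarrow> \<mu> c = c" "c \<in> R \<Longrightarrow> \<mu> c \<in> R"
proof -
  show 1: "\<mu> (\<mu> c) = c" "c \<in> R \<Longrightarrow> adj c (\<mu> c)" "c \<notin> R \<Longrightarrow> \<mu> c = c" for c
    using assms unfolding matchings_def by blast+
  show "\<mu> c \<in> R" if c: "c \<in> R"
  proof (rule ccontr)
    assume "\<mu> c \<notin> R"
    then have "\<mu> c = c" using 1(3)[of "\<mu> c"] 1(1)[of c] by simp
    then show False using 1(2)[OF c] adj_irrefl by simp
  qed
qed

definition tiling_of :: "int \<Rightarrow> cell set \<Rightarrow> (cell \<Rightarrow> cell) \<Rightarrow> pt set set set" where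
  "tiling_of h R \<mu> = (\<lambda>c. {tri h c, tri h (\<mu> c)}) ` R"

lemma tiling_of_bij: "bij_betw (tiling_of h R) (matchings R) (lozenge_tilings (tri h ` R))"
  unfolding bij_betw_def
proof (intro conjI equalityI subsetI)
  have eqT: "tri h c = tri h d \<longleftrightarrow> c = d" for c d using inj_tri[of h] by (auto dest: injD)
  show "inj_on (tiling_of h R) (matchings R)"
  proof (rule inj_onI, rule ext)
    fix \<mu> \<nu> c assume m: "\<mu> \<in> matchings R" "\<nu> \<in> matchings R" "tiling_of h R \<mu> = tiling_of h R \<nu>"
    show "\<mu> c = \<nu> c"
    proof (cases "c \<in> R")
      case True
      then have "{tri h c, tri h (\<mu> c)} \<in> tiling_of h R \<nu>" using m(3) by (auto simp: tiling_of_def)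
      then obtain d where "{tri h c, tri h (\<mu> c)} = {tri h d, tri h (\<nu> d)}" by (auto simp: tiling_of_def)
      then have "c = d \<and> \<mu> c = \<nu> d \<or> c = \<nu> d \<and> \<mu> c = d" by (auto simp: doubleton_eq_iff eqT)
      then show ?thesis using matchingsD(1)[OF m(2), of d] by auto
    qed (use m matchingsD(3) in metis)
  qed
  fix F assume "F \<in> tiling_of h R ` matchings R"
  then obtain \<mu> where m: "\<mu> \<in> matchings R" and F: "F = tiling_of h R \<mu>" by blast
  note mD = matchingsD[OF m]
  show "F \<in> lozenge_tilings (tri h ` R)"
    unfolding lozenge_tilings_def mem_Collect_eq
  proof (intro conjI ballI impI)
    fix l assume "l \<in> F"
    then obtain c where c: "c \<in> R" "l = {tri h c, tri h (\<mu> c)}" by (auto simp: F tiling_of_def)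
    have "c \<noteq> \<mu> c" using mD(2)[OF c(1)] adj_irrefl by metis
    then have "tri h c \<noteq> tri h (\<mu> c)" "card (tri h c \<inter> tri h (\<mu> c)) = 2"
      using card_tri_inter[of c "\<mu> c" h] mD(2)[OF c(1)] by (auto simp: eqT)
    then show "\<exists>t1 t2. l = {t1, t2} \<and> t1 \<noteq> t2 \<and> card (t1 \<inter> t2) = 2" using c by blast
  next
    fix l1 l2 assume "l1 \<in> F" "l2 \<in> F" and ne: "l1 \<noteq> l2"
    then obtain c d where c: "l1 = {tri h c, tri h (\<mu> c)}" and d: "l2 = {tri h d, tri h (\<mu> d)}"
      by (auto simp: F tiling_of_def)
    have 1: "c \<noteq> d" using ne c d by blast
    have "\<mu> c \<noteq> d"
    proof
      assume "\<mu> c = d"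
      then have "\<mu> d = c" using mD(1)[of c] by simp
      then show False using ne \<open>\<mu> c = d\<close> unfolding c d by (simp add: insert_commute)
    qed
    moreover have "c \<noteq> \<mu> d"
    proof
      assume "c = \<mu> d"
      then have "\<mu> c = d" using mD(1)[of d] by simp
      then show False using ne \<open>c = \<mu> d\<close> unfolding c d by (simp add: insert_commute)
    qed
    moreover have "\<mu> c \<noteq> \<mu> d" using 1 mD(1)[of c] mD(1)[of d] by metis
    ultimately show "l1 \<inter> l2 = {}" using 1 unfolding c d by (auto simp: eqT)
  next
    show "\<Union>F = tri h ` R" unfolding F tiling_of_def using mD(4) by auto
  qed
next
  have eqT: "tri h c = tri h d \<longleftrightarrow> c = d" for c d using inj_tri[of h] by (auto dest: injD)
  fix F assume "F \<in> lozenge_tilings (tri h ` R)"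
  then have F1: "\<And>l. l \<in> F \<Longrightarrow> \<exists>t1 t2. l = {t1, t2} \<and> t1 \<noteq> t2 \<and> card (t1 \<inter> t2) = 2"
    and F2: "\<And>l l'. l \<in> F \<Longrightarrow> l' \<in> F \<Longrightarrow> l \<noteq> l' \<Longrightarrow> l \<inter> l' = {}" and F3: "\<Union>F = tri h ` R"
    by (auto simp: lozenge_tilings_def)
  have ex: "\<exists>d. adj c d \<and> d \<in> R \<and> {tri h c, tri h d} \<in> F" if c: "c \<in> R" for c
  proof -
    have "tri h c \<in> \<Union>F" using F3 c by blast
    then obtain l where l: "l \<in> F" "tri h c \<in> l" by blast
    obtain t1 t2 where t12: "l = {t1, t2}" "t1 \<noteq> t2" "card (t1 \<inter> t2) = 2" using F1[OF l(1)] by blast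
    obtain t where t: "l = {tri h c, t}" "t \<noteq> tri h c" "card (tri h c \<inter> t) = 2"
    proof (cases "tri h c = t1")
      case True
      then show ?thesis using t12 by (intro that[of t2]) simp_all
    next
      case False
      then have "tri h c = t2" using l(2) t12(1) by simp
      then show ?thesis using t12 by (intro that[of t1]) (simp_all add: insert_commute Int_commute)
    qed
    have "t \<in> tri h ` R" using F3 l t by blast
    then obtain d where d: "d \<in> R" "t = tri h d" by blast
    then have "adj c d" using card_tri_inter[of c d h] t by auto
    then show ?thesis using d l t by blast
  qed
  have un: "d = d'" if "{tri h c, tri h d} \<in> F" "{tri h c, tri h d'} \<in> F" for c d d'
  proof -
    have "{tri h c, tri h d} = {tri h c, tri h d'}" using F2[OF that] by blast
    then show ?thesis by (auto simp: doubleton_eq_iff eqT)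
  qed
  define \<mu> where "\<mu> = (\<lambda>c. if c \<in> R then THE d. {tri h c, tri h d} \<in> F else c)"
  have mu: "adj c (\<mu> c) \<and> \<mu> c \<in> R \<and> {tri h c, tri h (\<mu> c)} \<in> F" if c: "c \<in> R" for c
  proof -
    obtain d where d: "adj c d" "d \<in> R" "{tri h c, tri h d} \<in> F" using ex[OF c] by blast
    then have "\<mu> c = d" unfolding \<mu>_def using c un by (simp add: the_equality)
    then show ?thesis using d by simp
  qed
  have "\<mu> (\<mu> c) = c" for c
  proof (cases "c \<in> R")
    case True
    note 1 = mu[OF True] and 2 = mu[of "\<mu> c"]
    have "{tri h (\<mu> c), tri h c} \<in> F" using 1 by (simp add: insert_commute)
    then show ?thesis using un 1 2 by blast
  qed (simp add: \<mu>_def)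
  then have "\<mu> \<in> matchings R" using mu by (auto simp: matchings_def) (simp add: \<mu>_def)
  moreover have "F = tiling_of h R \<mu>"
  proof (intro equalityI subsetI)
    fix l assume l: "l \<in> F"
    from F1[OF l] obtain t1 t2 where t: "l = {t1, t2}" by blast
    then obtain c where c: "c \<in> R" "t1 = tri h c" using F3 l by blast
    have "l = {tri h c, tri h (\<mu> c)}" using F2[OF l, of "{tri h c, tri h (\<mu> c)}"] mu[OF c(1)] t c by blast
    then show "l \<in> tiling_of h R \<mu>" using c by (auto simp: tiling_of_def)
  qed (use mu in \<open>auto simp: tiling_of_def\<close>)
  ultimately show "F \<in> tiling_of h R ` matchings R" by blast
qed

section \<open>Symmetries of tilings and of matchings\<close>

definition commutes :: "('a \<Rightarrow> 'a) \<Rightarrow> ('a \<Rightarrow> 'a) \<Rightarrow> bool" where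
  "commutes f g \<longleftrightarrow> (\<forall>c. f (g c) = g (f c))"

definition cell_symmetry :: "cell set \<Rightarrow> (cell \<Rightarrow> cell) \<Rightarrow> bool" where
  "cell_symmetry R \<gamma> \<longleftrightarrow> (\<forall>c. \<gamma> (\<gamma> c) = c) \<and> (\<forall>c. \<gamma> c \<in> R \<longleftrightarrow> c \<in> R) \<and> (\<forall>c d. adj c d \<longrightarrow> adj (\<gamma> c) (\<gamma> d))"

lemma conj_matching:
  assumes m: "\<mu> \<in> matchings R" and s: "cell_symmetry R \<gamma>"
  shows "(\<lambda>c. \<gamma> (\<mu> (\<gamma> c))) \<in> matchings R"
proof -
  note mD = matchingsD[OF m]
  have g: "\<gamma> (\<gamma> c) = c" "\<gamma> c \<in> R \<longleftrightarrow> c \<in> R" "adj c d \<Longrightarrow> adj (\<gamma> c) (\<gamma> d)" for c d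
    using s unfolding cell_symmetry_def by blast+
  have "adj c (\<gamma> (\<mu> (\<gamma> c)))" if "c \<in> R" for c
    using g(3)[of "\<gamma> c" "\<mu> (\<gamma> c)"] mD(2)[of "\<gamma> c"] that g(1,2) by simp
  then show ?thesis unfolding matchings_def mem_Collect_eq by (metis g(1,2) mD(1,3))
qed

text \<open>The image tiling belongs to the conjugated matching. As \<gamma> is an involution, a
  matching equals its conjugate iff it commutes with \<gamma>.\<close>

lemma map_tiling_iff:
  assumes m: "\<mu> \<in> matchings R" and s: "cell_symmetry R \<gamma>" and f: "\<And>c. f ` tri h c = tri h (\<gamma> c)"
  shows "map_tiling f (tiling_of h R \<mu>) = tiling_of h R \<mu> \<longleftrightarrow> commutes \<mu> \<gamma>"
proof -
  have g: "\<gamma> (\<gamma> c) = c" "\<gamma> c \<in> R \<longleftrightarrow> c \<in> R" for c using s unfolding cell_symmetry_def by blast+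
  have img: "\<gamma> ` R = R"
  proof (intro equalityI subsetI)
    fix c assume "c \<in> R"
    then show "c \<in> \<gamma> ` R" using g by (intro image_eqI[of c \<gamma> "\<gamma> c"]) simp_all
  qed (use g in blast)
  have "map_tiling f (tiling_of h R \<mu>) = (\<lambda>c. {tri h (\<gamma> c), tri h (\<gamma> (\<mu> c))}) ` R"
    unfolding map_tiling_def tiling_of_def image_image by (rule image_cong) (auto simp: f)
  also have "\<dots> = (\<lambda>c. {tri h (\<gamma> c), tri h (\<gamma> (\<mu> c))}) ` (\<gamma> ` R)" by (simp only: img)
  also have "\<dots> = tiling_of h R (\<lambda>c. \<gamma> (\<mu> (\<gamma> c)))"
    unfolding tiling_of_def image_image by (simp add: g)
  finally have "map_tiling f (tiling_of h R \<mu>) = tiling_of h R \<mu> \<longleftrightarrow> (\<lambda>c. \<gamma> (\<mu> (\<gamma> c))) = \<mu>"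
    using tiling_of_bij[of h R] conj_matching[OF m s] m by (auto simp: bij_betw_def dest: inj_onD)
  also have "\<dots> \<longleftrightarrow> commutes \<mu> \<gamma>"
    unfolding commutes_def fun_eq_iff by (metis g(1))
  finally show ?thesis .
qed

lemma M_sym_matchings:
  assumes G: "\<And>f. f \<in> S \<Longrightarrow> cell_symmetry R (\<gamma> f) \<and> (\<forall>c. f ` tri h c = tri h (\<gamma> f c))"
  shows "M_sym S (tri h ` R) = card {\<mu>\<in>matchings R. \<forall>f\<in>S. commutes \<mu> (\<gamma> f)}"
proof -
  have "bij_betw (tiling_of h R) {\<mu>\<in>matchings R. \<forall>f\<in>S. commutes \<mu> (\<gamma> f)}
     {F\<in>lozenge_tilings (tri h ` R). \<forall>f\<in>S. map_tiling f F = F}"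
  proof (rule bij_betw_subset[OF tiling_of_bij])
    have iff: "map_tiling f (tiling_of h R \<mu>) = tiling_of h R \<mu> \<longleftrightarrow> commutes \<mu> (\<gamma> f)"
      if "f \<in> S" "\<mu> \<in> matchings R" for f \<mu>
      by (rule map_tiling_iff[OF that(2)]) (use G[OF that(1)] in blast)+
    show "tiling_of h R ` {\<mu>\<in>matchings R. \<forall>f\<in>S. commutes \<mu> (\<gamma> f)} =
      {F\<in>lozenge_tilings (tri h ` R). \<forall>f\<in>S. map_tiling f F = F}"
    proof (intro equalityI subsetI)
      fix F assume "F \<in> tiling_of h R ` {\<mu>\<in>matchings R. \<forall>f\<in>S. commutes \<mu> (\<gamma> f)}"
      then obtain \<mu> where m: "\<mu> \<in> matchings R" "\<forall>f\<in>S. commutes \<mu> (\<gamma> f)" "F = tiling_of h R \<mu>" by blast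
      have "F \<in> lozenge_tilings (tri h ` R)" using m bij_betwE[OF tiling_of_bij] by blast
      moreover have "\<forall>f\<in>S. map_tiling f F = F" using m iff by simp
      ultimately show "F \<in> {F\<in>lozenge_tilings (tri h ` R). \<forall>f\<in>S. map_tiling f F = F}" by blast
    next
      fix F assume F: "F \<in> {F\<in>lozenge_tilings (tri h ` R). \<forall>f\<in>S. map_tiling f F = F}"
      have "F \<in> tiling_of h R ` matchings R"
        unfolding bij_betw_imp_surj_on[OF tiling_of_bij] using F by simp
      then obtain \<mu> where m: "\<mu> \<in> matchings R" "F = tiling_of h R \<mu>" by blast
      then have "\<forall>f\<in>S. commutes \<mu> (\<gamma> f)" using F m iff by simp
      then show "F \<in> tiling_of h R ` {\<mu>\<in>matchings R. \<forall>f\<in>S. commutes \<mu> (\<gamma> f)}" using m by blast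
    qed
  qed auto
  then show ?thesis unfolding M_sym_def by (simp add: bij_betw_same_card)
qed

section \<open>Matchings as path families\<close>

definition moves :: "(int \<Rightarrow> int) \<Rightarrow> int set \<Rightarrow> int set \<Rightarrow> bool" where
  "moves f S S' \<longleftrightarrow> bij_betw f S S' \<and> (\<forall>v\<in>S. f v = v + 1 \<or> f v = v - 1)"

lemma step_moves: "step S S' \<longleftrightarrow> (\<exists>f. moves f S S')"
  by (simp add: step_def moves_def)

text \<open>At the lowest position where the maps differ, one goes down and the other goes up. The
  other one must then reach the lower target from two places below; there both maps agree, so the
  first one takes the same value twice. Finiteness provides the lowest position.\<close>

lemma moves_unique:
  assumes S: "finite S" and f: "moves f S S'" and g: "moves g S S'" and v: "v \<in> S"
  shows "f v = g v"
proof (rule ccontr)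
  assume "f v \<noteq> g v"
  let ?X = "{v\<in>S. f v \<noteq> g v}"
  define u where "u = Min ?X"
  have fin: "finite ?X" and ne: "?X \<noteq> {}" using S v \<open>f v \<noteq> g v\<close> by auto
  have "u \<in> ?X" unfolding u_def by (rule Min_in[OF fin ne])
  then have u: "u \<in> S" "f u \<noteq> g u" by auto
  have min: "f w = g w" if "w \<in> S" "w < u" for w
    using Min_le[OF fin, of w] that unfolding u_def by fastforce
  have no: False if f: "moves f S S'" and g: "moves g S S'" and lo: "f u = u - 1" "g u = u + 1"
    and eq: "\<And>w. w \<in> S \<Longrightarrow> w < u \<Longrightarrow> f w = g w" for f g
  proof -
    have "f u \<in> S'" using f u by (auto simp: moves_def bij_betw_def)
    then have "u - 1 \<in> S'" using lo by simp
    then obtain w where w: "w \<in> S" "g w = u - 1" using g by (force simp: moves_def bij_betw_def)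
    then have "w = u \<or> w = u - 2" using g by (auto simp: moves_def)
    then have "w = u - 2" using w lo by auto
    then have "f w = f u" using eq[OF w(1)] w lo by simp
    then have "w = u" using f u w by (auto simp: moves_def bij_betw_def dest: inj_onD)
    then show False using \<open>w = u - 2\<close> by simp
  qed
  have "f u = u + 1 \<or> f u = u - 1" "g u = u + 1 \<or> g u = u - 1" using f g u by (auto simp: moves_def)
  then consider "f u = u - 1" "g u = u + 1" | "g u = u - 1" "f u = u + 1" using u(2) by auto
  then show False
  proof cases
    case 1
    then show ?thesis using no[OF f g 1] min by blast
  next
    case 2
    then show ?thesis using no[OF g f 2] min by metis
  qed
qed

text \<open>The value after time \<open>N\<close> is fixed, so that distinct functions are distinct
  path families and cardinalities count families.\<close>

definition seqs :: "(nat \<Rightarrow> int set) \<Rightarrow> int set \<Rightarrow> nat \<Rightarrow> (nat \<Rightarrow> int set) set" where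
  "seqs D W N = {c. c 0 = D 0 \<and> (\<forall>k<N. D (Suc k) \<subseteq> c (Suc k) \<and> c (Suc k) \<subseteq> W \<and>
      step (c k) (c (Suc k) - D (Suc k))) \<and> (\<forall>k>N. c k = {})}"

lemma finite_step_pre:
  assumes "finite S"
  shows "finite {R. step R S}"
proof (rule finite_subset)
  show "{R. step R S} \<subseteq> Pow ((\<lambda>v. v - 1) ` S \<union> (\<lambda>v. v + 1) ` S)"
  proof
    fix R assume "R \<in> {R. step R S}"
    then have R: "step R S" by simp
    have "v \<in> (\<lambda>v. v - 1) ` S \<union> (\<lambda>v. v + 1) ` S" if "v \<in> R" for v
      using step_neighbour[OF R that]
    proof
      assume "v + 1 \<in> S"
      then have "v + 1 - 1 \<in> (\<lambda>v. v - 1) ` S" by (rule imageI)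
      then show ?thesis by simp
    next
      assume "v - 1 \<in> S"
      then have "v - 1 + 1 \<in> (\<lambda>v. v + 1) ` S" by (rule imageI)
      then show ?thesis by simp
    qed
    then show "R \<in> Pow ((\<lambda>v. v - 1) ` S \<union> (\<lambda>v. v + 1) ` S)" by blast
  qed
qed (use assms in simp)

lemma card_seqs:
  assumes "finite S"
  shows "finite {c\<in>seqs D W N. c N = S} \<and> card {c\<in>seqs D W N. c N = S} = cnt D W N S"
  using assms
proof (induction N arbitrary: S)
  case 0
  have "{c\<in>seqs D W 0. c 0 = S} = (if S = D 0 then {\<lambda>k. if k = 0 then D 0 else {}} else {})"
    by (auto simp: seqs_def fun_eq_iff)
  then show ?case by simp
next
  case (Suc N)
  let ?S = "S - D (Suc N)"
  show ?case
  proof (cases "D (Suc N) \<subseteq> S \<and> S \<subseteq> W")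
    case False
    then have e: "{c\<in>seqs D W (Suc N). c (Suc N) = S} = {}" by (auto simp: seqs_def)
    show ?thesis unfolding e using False by auto
  next
    case True
    let ?B = "\<lambda>R. {c\<in>seqs D W N. c N = R}"
    let ?u = "\<lambda>c. c(Suc N := S)"
    have eq: "{c\<in>seqs D W (Suc N). c (Suc N) = S} = (\<Union>R\<in>{R. step R ?S}. ?u ` ?B R)"
    proof (intro equalityI subsetI)
      fix c assume c: "c \<in> {c\<in>seqs D W (Suc N). c (Suc N) = S}"
      let ?c = "c(Suc N := {})"
      have "c = ?u ?c" using c by auto
      moreover have "?c \<in> ?B (c N)" using c by (auto simp: seqs_def)
      moreover have "step (c N) ?S" using c by (auto simp: seqs_def)
      ultimately show "c \<in> (\<Union>R\<in>{R. step R ?S}. ?u ` ?B R)" by blast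
    next
      fix c assume "c \<in> (\<Union>R\<in>{R. step R ?S}. ?u ` ?B R)"
      then obtain d where "d \<in> seqs D W N" "step (d N) ?S" "c = ?u d" by blast
      then show "c \<in> {c\<in>seqs D W (Suc N). c (Suc N) = S}"
        using True by (auto simp: seqs_def less_Suc_eq)
    qed
    have inj: "inj_on ?u (?B R)" for R
    proof (rule inj_onI)
      fix c d assume cd: "c \<in> ?B R" "d \<in> ?B R" "?u c = ?u d"
      show "c = d"
      proof
        fix k show "c k = d k"
        proof (cases "k = Suc N")
          case True
          then show ?thesis using cd(1,2) by (simp add: seqs_def)
        next
          case False
          then show ?thesis using fun_cong[OF cd(3), of k] by simp
        qed
      qed
    qed
    have B: "finite (?B R) \<and> card (?B R) = cnt D W N R" if "step R ?S" for R
      using Suc.IH[of R] step_finite[OF that] Suc.prems by simp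
    have fin: "finite {R. step R ?S}" using Suc.prems by (intro finite_step_pre) simp
    have "card (\<Union>R\<in>{R. step R ?S}. ?u ` ?B R) = (\<Sum>R\<in>{R. step R ?S}. card (?u ` ?B R))"
    proof (rule card_UN_disjoint[OF fin])
      show "\<forall>R\<in>{R. step R ?S}. \<forall>R'\<in>{R. step R ?S}. R \<noteq> R' \<longrightarrow> ?u ` ?B R \<inter> ?u ` ?B R' = {}"
      proof (intro ballI impI, rule ccontr)
        fix R R' assume "R \<noteq> R'" "?u ` ?B R \<inter> ?u ` ?B R' \<noteq> {}"
        then obtain c d where cd: "c \<in> ?B R" "d \<in> ?B R'" "?u c = ?u d" by blast
        have "c N = d N" using fun_cong[OF cd(3), of N] by simp
        then show False using cd(1,2) \<open>R \<noteq> R'\<close> by simp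
      qed
    qed (use B in auto)
    also have "\<dots> = (\<Sum>R\<in>{R. step R ?S}. cnt D W N R)"
      by (rule sum.cong) (use B inj in \<open>auto simp: card_image\<close>)
    finally show ?thesis unfolding eq using True B fin by auto
  qed
qed

lemma mem_enter2_0: "y \<in> enter2 b Q 0 \<longleftrightarrow> odd y \<and> \<bar>y\<bar> \<le> 2 * int b"
proof
  assume "y \<in> enter2 b Q 0"
  then show "odd y \<and> \<bar>y\<bar> \<le> 2 * int b" by (auto simp: enter2_def)
next
  assume y: "odd y \<and> \<bar>y\<bar> \<le> 2 * int b"
  have pos: "z \<in> enter b Q 0" if z: "odd z" "0 < z" "z \<le> 2 * int b" for z
  proof -
    from z obtain j where j: "z = 2 * j + 1" by (auto elim: oddE)
    then show ?thesis using z by (auto intro!: image_eqI[of _ _ "nat j"])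
  qed
  have "y \<noteq> 0" using y by auto
  then consider "0 < y" | "0 < - y" by linarith
  then show "y \<in> enter2 b Q 0"
  proof cases
    case 1
    then show ?thesis using pos[of y] y by (auto simp: enter2_def)
  next
    case 2
    then have "- y \<in> enter b Q 0" using y by (intro pos) auto
    then have "- (- y) \<in> uminus ` enter b Q 0" by blast
    then show ?thesis by (simp add: enter2_def)
  qed
qed

text \<open>The hexagon has sides \<open>A, A, 2b\<close>, the central rhombus has side \<open>n\<close>, and \<open>Q\<close> contains the positions
  of the vertical sides of the removed left-pointing triangles that are not inside the rhombus.\<close>

locale wedge =
  fixes A b n :: nat and Q :: "nat set"
  assumes b: "0 < b" and A: "0 < A"
    and Q_even: "\<And>q. q \<in> Q \<Longrightarrow> even q" and Q_pos: "\<And>q. q \<in> Q \<Longrightarrow> 0 < q"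
    and Q_le: "\<And>q. q \<in> Q \<Longrightarrow> q + n \<le> A" and centre: "n = 0 \<or> odd n \<and> odd A \<and> n \<le> A"
begin

text \<open>Here \<open>x\<close> is the column of a cell in the left half; the last two conditions exclude the removed
  triangles and the left half of the rhombus.\<close>

definition in_left :: "int \<Rightarrow> int \<Rightarrow> bool" where
  "in_left x y \<longleftrightarrow> 0 \<le> x \<and> \<bar>y\<bar> \<le> 2 * int b + x \<and>
     (\<forall>q\<in>Q. int q - 2 \<le> x \<and> x < int q \<longrightarrow> x - int q + 2 < \<bar>y\<bar>) \<and> x - int A + int n < \<bar>y\<bar>"

text \<open>Column \<open>x\<close> lies between the lines \<open>x\<close> and
  \<open>x + 1\<close>, so its mirror image in the central line \<open>A\<close> is column
  \<open>2 * A - 1 - x\<close>.\<close>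

definition region :: "cell set" where
  "region = {(x, y). in_left (min x (2 * int A - 1 - x)) y}"

definition rot :: "cell \<Rightarrow> cell" where "rot = (\<lambda>(x, y). (2 * int A - 1 - x, - y))"
text \<open>The reflection in the horizontal axis. Together with \<open>rot\<close> it generates the
  reflection in the vertical axis, but it preserves the left half and so acts directly on the path
  families there.\<close>

definition flip :: "cell \<Rightarrow> cell" where "flip = (\<lambda>(x, y). (x, - y))"

abbreviation "D \<equiv> enter2 b Q"

lemma in_left_minus [simp]: "in_left x (- y) = in_left x y"
  by (simp add: in_left_def)

lemma region_left: "x < int A \<Longrightarrow> (x, y) \<in> region \<longleftrightarrow> in_left x y"
  by (simp add: region_def min_def)

lemma rot_rot [simp]: "rot (rot c) = c"
  by (simp add: rot_def split: prod.splits)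

lemma rot_region: "rot c \<in> region \<longleftrightarrow> c \<in> region"
  by (simp add: rot_def region_def min_def split: prod.splits)

lemma adj_rot: "adj c d \<Longrightarrow> adj (rot c) (rot d)"
  by (cases c; cases d; auto simp: rot_def adj_def)

text \<open>Towards the left, the removed triangles and the left half of the rhombus have only
  slanted sides. So crossing a vertical edge from left to right never enters a hole; the borderline
  cases of the inequalities have the wrong parity.\<close>

lemma in_left_right_neighbour:
  assumes "even (x + y)" "in_left x y" "x + 1 < int A"
  shows "in_left (x + 1) y"
proof -
  have 1: "x + 1 - int q + 2 < \<bar>y\<bar>" if q: "q \<in> Q" "int q - 2 \<le> x + 1" "x + 1 < int q" for q
  proof -
    have e: "even (int q)" using Q_even[OF q(1)] by simp
    consider "x + 1 = int q - 2" | "x + 1 = int q - 1" using q by linarith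
    then show ?thesis
    proof cases
      case 1
      then have "odd y" using assms(1) e by presburger
      then have "y \<noteq> 0" by auto
      then show ?thesis using 1 by auto
    next
      case 2
      then have "x - int q + 2 < \<bar>y\<bar>" using assms(2) q by (auto simp: in_left_def)
      then have "0 < \<bar>y\<bar>" using 2 by simp
      moreover have "even y" using assms(1) e 2 by presburger
      ultimately have "1 < \<bar>y\<bar>" by presburger
      then show ?thesis using 2 by simp
    qed
  qed
  have 2: "x + 1 - int A + int n < \<bar>y\<bar>"
  proof (cases "n = 0")
    case True
    then show ?thesis using assms(3) by auto
  next
    case False
    then have "odd (int n)" "odd (int A)" using centre by auto
    moreover have "x - int A + int n < \<bar>y\<bar>" using assms(2) by (simp add: in_left_def)
    ultimately show ?thesis using assms(1) by presburger
  qed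
  show ?thesis using assms(2) 1 2 by (auto simp: in_left_def)
qed

text \<open>Apart from the left side of the hexagon, the vertical sides of the removed triangles are
  the only places in the left half where a right-pointing cell has no left neighbour. These are the
  entrances.\<close>

lemma in_left_left_neighbour:
  assumes "odd (x + y)" "in_left x y" "0 < x"
  shows "in_left (x - 1) y \<or> (\<exists>q\<in>Q. x = int q \<and> \<bar>y\<bar> = 1)"
proof (rule disjCI)
  assume no: "\<not> (\<exists>q\<in>Q. x = int q \<and> \<bar>y\<bar> = 1)"
  have 1: "x - 1 - int q + 2 < \<bar>y\<bar>" if q: "q \<in> Q" "int q - 2 \<le> x - 1" "x - 1 < int q" for q
  proof -
    have e: "even (int q)" using Q_even[OF q(1)] by simp
    consider "x = int q - 1" | "x = int q" using q by linarith
    then show ?thesis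
    proof cases
      case 1
      then have "x - int q + 2 < \<bar>y\<bar>" using assms(2) q by (auto simp: in_left_def)
      then show ?thesis by simp
    next
      case 2
      then have "odd y" using assms(1) e by presburger
      moreover have "\<bar>y\<bar> \<noteq> 1" using no 2 q by blast
      ultimately have "1 < \<bar>y\<bar>" by presburger
      then show ?thesis using 2 by simp
    qed
  qed
  have "\<bar>y\<bar> \<le> 2 * int b + x" using assms(2) by (simp add: in_left_def)
  then have "\<bar>y\<bar> \<le> 2 * int b + (x - 1)" using assms(1) by presburger
  then show "in_left (x - 1) y" using assms 1 by (auto simp: in_left_def)
qed

lemma D_Suc_not_in_left:
  assumes "y \<in> D (Suc k)"
  shows "\<not> in_left (int k) y"
proof -
  have q: "Suc k \<in> Q" "\<bar>y\<bar> = 1" using assms by (auto split: if_splits)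
  then show ?thesis by (auto simp: in_left_def intro!: bexI[of _ "Suc k"])
qed

lemma D_in_left:
  assumes "y \<in> D k" "k < A"
  shows "in_left (int k) y \<and> odd (y + int k)"
proof (cases k)
  case 0
  then have y: "odd y" "\<bar>y\<bar> \<le> 2 * int b" using assms by (auto simp: mem_enter2_0)
  then have "1 \<le> \<bar>y\<bar>" by presburger
  moreover have "n \<le> A" using centre by auto
  moreover have "2 \<le> int q" if "q \<in> Q" for q using Q_pos[OF that] Q_even[OF that] by presburger
  ultimately show ?thesis using y 0 by (fastforce simp: in_left_def)
next
  case (Suc j)
  then have q: "k \<in> Q" "\<bar>y\<bar> = 1" using assms by (auto split: if_splits)
  then have "odd y" by presburger
  moreover have "even k" using Q_even q by blast
  moreover have "int k - int p + 2 < 1" if "p \<in> Q" "int p - 2 \<le> int k" "int k < int p" for p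
    using Q_even[OF that(1)] \<open>even k\<close> that by presburger
  moreover have "int k - int A + int n < 1" using Q_le[OF q(1)] by auto
  ultimately show ?thesis using q b by (auto simp: in_left_def)
qed

text \<open>The first condition is what the half turn imposes on the central line. The second keeps
  the end points off the part of that line which the rhombus covers.\<close>

definition final :: "(nat \<Rightarrow> int set) \<Rightarrow> bool" where
  "final c \<longleftrightarrow> (\<forall>y\<in>c A. - y \<in> c A) \<and> (\<forall>y\<in>c A. int n \<le> \<bar>y\<bar>)"

definition confs :: "(nat \<Rightarrow> int set) set" where
  "confs = {c\<in>seqs D UNIV A. final c}"

lemma confsD:
  assumes "c \<in> confs"
  shows "c 0 = D 0" "k < A \<Longrightarrow> D (Suc k) \<subseteq> c (Suc k)" "k < A \<Longrightarrow> step (c k) (c (Suc k) - D (Suc k))"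
    "A < k \<Longrightarrow> c k = {}" "y \<in> c A \<Longrightarrow> - y \<in> c A" "y \<in> c A \<Longrightarrow> int n \<le> \<bar>y\<bar>"
  using assms by (auto simp: confs_def seqs_def final_def)

lemma seqs_bounds:
  assumes c: "c \<in> seqs D UNIV A" and "k \<le> A" "y \<in> c k"
  shows "odd (y + int k) \<and> \<bar>y\<bar> \<le> 2 * int b + int k"
  using assms(2,3)
proof (induction k arbitrary: y)
  case 0
  then have "y \<in> D 0" using c by (auto simp: seqs_def)
  then show ?case by (simp add: mem_enter2_0)
next
  case (Suc k)
  show ?case
  proof (cases "y \<in> D (Suc k)")
    case True
    then have q: "Suc k \<in> Q" "\<bar>y\<bar> = 1" by (auto split: if_splits)
    then have "even (Suc k)" "odd y" using Q_even by (blast, presburger)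
    then show ?thesis using q by simp
  next
    case False
    have "step (c k) (c (Suc k) - D (Suc k))" using c Suc.prems by (auto simp: seqs_def)
    then obtain f where f: "moves f (c k) (c (Suc k) - D (Suc k))" by (auto simp: step_moves)
    then obtain z where z: "z \<in> c k" "f z = y" using False Suc.prems by (force simp: moves_def bij_betw_def)
    then have "y = z + 1 \<or> y = z - 1" using f by (auto simp: moves_def)
    then show ?thesis using Suc.IH[OF _ z(1)] Suc.prems by auto
  qed
qed

lemma confs_bounds:
  assumes "c \<in> confs" "k \<le> A" "y \<in> c k"
  shows "odd (y + int k)" "\<bar>y\<bar> \<le> 2 * int b + int k"
  using seqs_bounds[of c k y] assms by (auto simp: confs_def)

lemma seqs_finite:
  assumes c: "c \<in> seqs D UNIV A" and k: "k \<le> A"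
  shows "finite (c k)"
proof (rule finite_subset)
  show "c k \<subseteq> {- (2 * int b + int k)..2 * int b + int k}" using seqs_bounds[OF c k] by fastforce
qed simp

lemma confs_successor:
  assumes c: "c \<in> confs" "k < A" "y \<in> c k"
  shows "\<exists>z \<in> c (Suc k) - D (Suc k). z = y + 1 \<or> z = y - 1"
  using step_neighbour[OF confsD(3)[OF c(1,2)] c(3)] by blast

text \<open>Heights change by one per step, so the condition on line \<open>A\<close>, read
  backwards, keeps the paths out of the rhombus. It becomes strict because \<open>n\<close> is odd
  while the heights on line \<open>A\<close> are even.\<close>

lemma confs_cone:
  assumes c: "c \<in> confs" and n: "n \<noteq> 0" and "k \<le> A" "y \<in> c k"
  shows "int k - int A + int n < \<bar>y\<bar>"
  using assms(3,4)
proof (induction k arbitrary: y rule: inc_induct)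
  case base
  have "odd (y + int A)" using confs_bounds(1)[OF c _ base] by simp
  moreover have "odd (int n)" "odd (int A)" using centre n by auto
  moreover have "int n \<le> \<bar>y\<bar>" using confsD(6)[OF c base] .
  ultimately show ?case by presburger
next
  case (step k)
  obtain z where z: "z \<in> c (Suc k)" "z = y + 1 \<or> z = y - 1" using confs_successor[OF c step(2) step(4)] by blast
  then show ?case using step.IH[OF z(1)] by auto
qed

text \<open>From height 0 on line \<open>q - 1\<close> a path could go only to 1 or -1 on line
  \<open>q\<close>, and both places are taken by entering paths. Hence paths avoid the removed
  triangles without any further condition.\<close>

lemma confs_avoid:
  assumes c: "c \<in> confs" and q: "q \<in> Q"
  shows "0 \<notin> c (q - 1)"
proof
  assume 0: "0 \<in> c (q - 1)"
  have q': "Suc (q - 1) = q" "q - 1 < A" using Q_pos[OF q] Q_le[OF q] by auto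
  obtain z where z: "z \<in> c q - D q" "z = 1 \<or> z = -1"
    using confs_successor[OF c q'(2) 0] unfolding q' by auto
  moreover have "D q = {1, -1}" using enter_simps(3)[of b Q "q - 1"] q q' by simp
  ultimately show False by auto
qed

lemma confs_in_left:
  assumes c: "c \<in> confs" and k: "k < A" and y: "y \<in> c k"
  shows "in_left (int k) y"
proof -
  have p: "odd (y + int k)" "\<bar>y\<bar> \<le> 2 * int b + int k" using confs_bounds[OF c _ y] k by auto
  have "int k - int q + 2 < \<bar>y\<bar>" if q: "q \<in> Q" "int q - 2 \<le> int k" "int k < int q" for q
  proof -
    have e: "even (int q)" using Q_even[OF q(1)] by simp
    consider "int k = int q - 2" | "int k = int q - 1" using q by linarith
    then show ?thesis
    proof cases
      case 1
      then have "odd y" using p(1) e by presburger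
      then show ?thesis using 1 by presburger
    next
      case 2
      then have "even y" using p(1) e by presburger
      moreover have "k = q - 1" using 2 by simp
      then have "y \<noteq> 0" using confs_avoid[OF c q(1)] y by auto
      ultimately have "1 < \<bar>y\<bar>" by presburger
      then show ?thesis using 2 by simp
    qed
  qed
  moreover have "int k - int A + int n < \<bar>y\<bar>"
    using confs_cone[OF c _ _ y] k by (cases "n = 0") auto
  ultimately show ?thesis using p by (auto simp: in_left_def)
qed

lemma confs_in_left_Suc:
  assumes c: "c \<in> confs" and k: "k < A" and y: "y \<in> c (Suc k)" "y \<notin> D (Suc k)"
  shows "in_left (int k) y"
proof -
  have p: "odd (y + int (Suc k))" using confs_bounds[OF c _ y(1)] k by auto
  obtain f where f: "moves f (c k) (c (Suc k) - D (Suc k))" using confsD(3)[OF c k] by (auto simp: step_moves)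
  obtain z where z: "z \<in> c k" "f z = y" using f y by (force simp: moves_def bij_betw_def)
  \<comment> \<open>The parity of \<open>z\<close> excludes equality in the bound for line
    \<open>k\<close>, which leaves room for the step.\<close>
  have "\<bar>z\<bar> \<le> 2 * int b + int k - 1"
  proof -
    have "odd (z + int k)" "\<bar>z\<bar> \<le> 2 * int b + int k" using confs_bounds[OF c _ z(1)] k by auto
    then show ?thesis by presburger
  qed
  moreover have "y = z + 1 \<or> y = z - 1" using f z by (auto simp: moves_def)
  ultimately have "\<bar>y\<bar> \<le> 2 * int b + int k" by auto
  moreover have "int k - int q + 2 < \<bar>y\<bar>" if q: "q \<in> Q" "int q - 2 \<le> int k" "int k < int q" for q
  proof -
    have e: "even (int q)" using Q_even[OF q(1)] by simp
    consider "int k = int q - 2" | "int k = int q - 1" using q by linarith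
    then show ?thesis
    proof cases
      case 1
      then have "Suc k = q - 1" by simp
      then have "y \<noteq> 0" using confs_avoid[OF c q(1)] y by auto
      then show ?thesis using 1 by simp
    next
      case 2
      then have "odd y" using p e by presburger
      moreover have "Suc k = q" using 2 by simp
      then have "\<bar>y\<bar> \<noteq> 1" using y(2) q(1) by auto
      ultimately have "1 < \<bar>y\<bar>" by presburger
      then show ?thesis using 2 by simp
    qed
  qed
  moreover have "int k - int A + int n < \<bar>y\<bar>"
    using confs_cone[OF c _ _ y(1)] k by (cases "n = 0") auto
  ultimately show ?thesis by (auto simp: in_left_def)
qed

end

context wedge
begin

text \<open>The heights of the vertical edges on line \<open>k\<close> that are not inside a horizontal lozenge, together with
  the vertical sides of the removed triangles on that line.\<close>

definition seq_of :: "(cell \<Rightarrow> cell) \<Rightarrow> nat \<Rightarrow> int set" where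
  "seq_of \<mu> k = (if k = 0 then D 0 else if k \<le> A then
     D k \<union> {y. odd (y + int k) \<and> in_left (int k - 1) y \<and> \<mu> (int k - 1, y) \<noteq> (int k, y)} else {})"

definition rmatchings :: "(cell \<Rightarrow> cell) set" where
  "rmatchings = {\<mu>\<in>matchings region. commutes \<mu> rot}"

lemma rmatchingsD:
  assumes "\<mu> \<in> rmatchings"
  shows "\<mu> (\<mu> c) = c" "c \<in> region \<Longrightarrow> adj c (\<mu> c)" "c \<notin> region \<Longrightarrow> \<mu> c = c"
    "c \<in> region \<Longrightarrow> \<mu> c \<in> region" "\<mu> (rot c) = rot (\<mu> c)"
  using assms matchingsD[of \<mu> region] by (auto simp: rmatchings_def commutes_def simp del: split_paired_All)

text \<open>\<open>seq_of\<close> tests a vertical edge by the cell to its left, this description by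
  the cell to its right. Entrances are the edges whose left cell is missing.\<close>

lemma seq_of_right:
  assumes m: "\<mu> \<in> rmatchings" and k: "k < A"
  shows "seq_of \<mu> k = {y. odd (y + int k) \<and> in_left (int k) y \<and> \<mu> (int k, y) \<noteq> (int k - 1, y)}"
proof (intro equalityI subsetI)
  note mD = rmatchingsD[OF m]
  fix y assume y: "y \<in> seq_of \<mu> k"
  show "y \<in> {y. odd (y + int k) \<and> in_left (int k) y \<and> \<mu> (int k, y) \<noteq> (int k - 1, y)}"
  proof (cases "y \<in> D k")
    case True
    note l = D_in_left[OF True k]
    have "\<not> in_left (int k - 1) y"
    proof (cases k)
      case 0
      then show ?thesis by (simp add: in_left_def)
    next
      case (Suc j)
      then show ?thesis using D_Suc_not_in_left[of y j] True by simp
    qed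
    then have "(int k - 1, y) \<notin> region" using k by (simp add: region_left)
    then have "\<mu> (int k, y) \<noteq> (int k - 1, y)" using mD(4)[of "(int k, y)"] l k by (auto simp: region_left)
    then show ?thesis using l by simp
  next
    case False
    then have y': "0 < k" "odd (y + int k)" "in_left (int k - 1) y" "\<mu> (int k - 1, y) \<noteq> (int k, y)"
      using y k by (auto simp: seq_of_def split: if_splits)
    have "in_left (int k - 1 + 1) y" by (rule in_left_right_neighbour) (use y' k in auto)
    moreover have "\<mu> (int k, y) \<noteq> (int k - 1, y)" using y'(4) mD(1)[of "(int k, y)"] by metis
    ultimately show ?thesis using y' by simp
  qed
next
  note mD = rmatchingsD[OF m]
  fix y assume "y \<in> {y. odd (y + int k) \<and> in_left (int k) y \<and> \<mu> (int k, y) \<noteq> (int k - 1, y)}"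
  then have y: "odd (y + int k)" "in_left (int k) y" "\<mu> (int k, y) \<noteq> (int k - 1, y)" by auto
  show "y \<in> seq_of \<mu> k"
  proof (cases "k = 0")
    case True
    then have "y \<in> D 0" using y by (simp add: mem_enter2_0 in_left_def)
    then show ?thesis using True by (simp add: seq_of_def)
  next
    case False
    have "in_left (int k - 1) y \<or> (\<exists>q\<in>Q. int k = int q \<and> \<bar>y\<bar> = 1)"
      by (rule in_left_left_neighbour) (use y False in \<open>auto simp: add.commute\<close>)
    then show ?thesis
    proof
      assume "in_left (int k - 1) y"
      moreover have "\<mu> (int k - 1, y) \<noteq> (int k, y)" using y(3) mD(1)[of "(int k - 1, y)"] by metis
      ultimately show ?thesis using y(1) k False by (simp add: seq_of_def)
    next
      assume "\<exists>q\<in>Q. int k = int q \<and> \<bar>y\<bar> = 1"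
      then have "k \<in> Q" "y = 1 \<or> y = -1" by auto
      then have "y \<in> D k" using enter_simps(3)[of b Q "k - 1"] False by auto
      then show ?thesis using k False by (simp add: seq_of_def)
    qed
  qed
qed

lemma seq_of_left:
  assumes k: "k < A"
  shows "seq_of \<mu> (Suc k) - D (Suc k) = {y. even (y + int k) \<and> in_left (int k) y \<and> \<mu> (int k, y) \<noteq> (int k + 1, y)}"
  using k D_Suc_not_in_left[of _ k] by (auto simp: seq_of_def simp del: enter_simps)

text \<open>A cell that is not matched across its vertical edge is matched within its column, one
  height up or down. Such a pair consists of a right-pointing cell with its edge on line
  \<open>k\<close> and a left-pointing one with its edge on line \<open>Suc k\<close>: a single step
  of a path.\<close>

lemma seq_of_moves:
  assumes m: "\<mu> \<in> rmatchings" and k: "k < A"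
  shows "moves (\<lambda>y. snd (\<mu> (int k, y))) (seq_of \<mu> k) (seq_of \<mu> (Suc k) - D (Suc k))"
    and "y \<in> seq_of \<mu> k \<Longrightarrow> \<mu> (int k, y) = (int k, snd (\<mu> (int k, y)))"
    and "z \<in> seq_of \<mu> (Suc k) - D (Suc k) \<Longrightarrow> \<exists>y\<in>seq_of \<mu> k. \<mu> (int k, z) = (int k, y) \<and> \<mu> (int k, y) = (int k, z)"
proof -
  note mD = rmatchingsD[OF m]
  note R = seq_of_right[OF m k] and L = seq_of_left[OF k, of \<mu>]
  have fwd: "\<exists>z\<in>seq_of \<mu> (Suc k) - D (Suc k). \<mu> (int k, y) = (int k, z) \<and> (z = y + 1 \<or> z = y - 1)"
    if "y \<in> seq_of \<mu> k" for y
  proof -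
    have y: "odd (y + int k)" "in_left (int k) y" "\<mu> (int k, y) \<noteq> (int k - 1, y)" using that R by auto
    then have r: "(int k, y) \<in> region" using k by (simp add: region_left)
    have o: "odd (int k + y)" using y(1) by (simp add: add.commute)
    obtain z where z: "\<mu> (int k, y) = (int k, z)" "z = y + 1 \<or> z = y - 1"
      using mD(2)[OF r] y(3) o by (cases "\<mu> (int k, y)") (auto simp: adj_def)
    have "in_left (int k) z" using mD(4)[OF r] z(1) k by (simp add: region_left)
    moreover have "even (z + int k)" using z(2) y(1) by auto
    moreover have "\<mu> (int k, z) = (int k, y)" using mD(1)[of "(int k, y)"] z(1) by simp
    ultimately have "z \<in> seq_of \<mu> (Suc k) - D (Suc k)" unfolding L by simp
    then show ?thesis using z by blast
  qed
  have bwd: "\<exists>y\<in>seq_of \<mu> k. \<mu> (int k, z) = (int k, y) \<and> \<mu> (int k, y) = (int k, z)"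
    if "z \<in> seq_of \<mu> (Suc k) - D (Suc k)" for z
  proof -
    have z: "even (z + int k)" "in_left (int k) z" "\<mu> (int k, z) \<noteq> (int k + 1, z)" using that unfolding L by auto
    then have r: "(int k, z) \<in> region" using k by (simp add: region_left)
    have e: "even (int k + z)" using z(1) by (simp add: add.commute)
    obtain y where y: "\<mu> (int k, z) = (int k, y)" "y = z + 1 \<or> y = z - 1"
      using mD(2)[OF r] z(3) e by (cases "\<mu> (int k, z)") (auto simp: adj_def)
    have "in_left (int k) y" using mD(4)[OF r] y(1) k by (simp add: region_left)
    moreover have "odd (y + int k)" using y(2) z(1) by auto
    moreover have \<mu>: "\<mu> (int k, y) = (int k, z)" using mD(1)[of "(int k, z)"] y(1) by simp
    ultimately have "y \<in> seq_of \<mu> k" unfolding R by simp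
    then show ?thesis using y \<mu> by blast
  qed
  show "\<mu> (int k, y) = (int k, snd (\<mu> (int k, y)))" if "y \<in> seq_of \<mu> k" for y using fwd[OF that] by auto
  show "\<exists>y\<in>seq_of \<mu> k. \<mu> (int k, z) = (int k, y) \<and> \<mu> (int k, y) = (int k, z)"
    if "z \<in> seq_of \<mu> (Suc k) - D (Suc k)" for z using bwd[OF that] .
  show "moves (\<lambda>y. snd (\<mu> (int k, y))) (seq_of \<mu> k) (seq_of \<mu> (Suc k) - D (Suc k))"
    unfolding moves_def bij_betw_def
  proof (intro conjI inj_onI ballI)
    fix y y' assume yy: "y \<in> seq_of \<mu> k" "y' \<in> seq_of \<mu> k" "snd (\<mu> (int k, y)) = snd (\<mu> (int k, y'))"
    then have "\<mu> (int k, y) = \<mu> (int k, y')" using fwd[OF yy(1)] fwd[OF yy(2)] by auto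
    then have "(int k, y) = (int k, y')" using mD(1) by metis
    then show "y = y'" by simp
  next
    show "(\<lambda>y. snd (\<mu> (int k, y))) ` seq_of \<mu> k = seq_of \<mu> (Suc k) - D (Suc k)"
    proof (intro equalityI subsetI)
      fix z assume "z \<in> (\<lambda>y. snd (\<mu> (int k, y))) ` seq_of \<mu> k"
      then show "z \<in> seq_of \<mu> (Suc k) - D (Suc k)" using fwd by fastforce
    next
      fix z assume "z \<in> seq_of \<mu> (Suc k) - D (Suc k)"
      from bwd[OF this] obtain y where "y \<in> seq_of \<mu> k" "\<mu> (int k, y) = (int k, z)" by blast
      then show "z \<in> (\<lambda>y. snd (\<mu> (int k, y))) ` seq_of \<mu> k" by (intro image_eqI[of _ _ y]) simp_all
    qed
  next
    fix y assume "y \<in> seq_of \<mu> k"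
    then show "snd (\<mu> (int k, y)) = y + 1 \<or> snd (\<mu> (int k, y)) = y - 1" using fwd by fastforce
  qed
qed

lemma D_minus: "y \<in> D k \<Longrightarrow> - y \<in> D k"
  by (auto simp: enter2_def)

lemma seq_of_confs:
  assumes m: "\<mu> \<in> rmatchings"
  shows "seq_of \<mu> \<in> confs"
proof -
  note mD = rmatchingsD[OF m]
  have "seq_of \<mu> 0 = D 0" "\<And>k. A < k \<Longrightarrow> seq_of \<mu> k = {}" by (auto simp: seq_of_def)
  moreover have "D (Suc k) \<subseteq> seq_of \<mu> (Suc k)" if "k < A" for k
    using that by (auto simp: seq_of_def simp del: enter_simps)
  moreover have "step (seq_of \<mu> k) (seq_of \<mu> (Suc k) - D (Suc k))" if "k < A" for k
    using seq_of_moves(1)[OF m that] step_moves by blast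
  moreover have "- y \<in> seq_of \<mu> A \<and> int n \<le> \<bar>y\<bar>" if y: "y \<in> seq_of \<mu> A" for y
  proof (cases "y \<in> D A")
    case True
    then have "A \<in> Q" using A by (cases A) (auto split: if_splits)
    then have "int n \<le> \<bar>y\<bar>" using Q_le by fastforce
    moreover have "- y \<in> seq_of \<mu> A" using D_minus[OF True] A by (simp add: seq_of_def)
    ultimately show ?thesis by blast
  next
    case False
    then have y': "odd (y + int A)" "in_left (int A - 1) y" "\<mu> (int A - 1, y) \<noteq> (int A, y)"
      using y A by (auto simp: seq_of_def)
    \<comment> \<open>The half turn maps a lozenge across line \<open>A\<close> at height
      \<open>- y\<close> to the one at height \<open>y\<close>.\<close>
    have "\<mu> (int A - 1, - y) \<noteq> (int A, - y)"
    proof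
      assume "\<mu> (int A - 1, - y) = (int A, - y)"
      then have "\<mu> (int A, y) = (int A - 1, y)" using mD(5)[of "(int A - 1, - y)"] by (simp add: rot_def)
      then show False using y'(3) mD(1)[of "(int A, y)"] by simp
    qed
    moreover have "odd (- y + int A)" using y'(1) by presburger
    ultimately have "- y \<in> seq_of \<mu> A" using y' A by (simp add: seq_of_def)
    moreover have "int n \<le> \<bar>y\<bar>" using y'(2) by (simp add: in_left_def)
    ultimately show ?thesis by simp
  qed
  ultimately show ?thesis unfolding confs_def seqs_def final_def by blast
qed

section \<open>From path families back to matchings\<close>

text \<open>The choice is immaterial on \<open>c k\<close>, since by \<open>moves_unique\<close>
  there is only one such map there.\<close>

definition pick :: "(nat \<Rightarrow> int set) \<Rightarrow> nat \<Rightarrow> int \<Rightarrow> int" where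
  "pick c k = (SOME f. moves f (c k) (c (Suc k) - D (Suc k)))"

definition left_of :: "(nat \<Rightarrow> int set) \<Rightarrow> cell \<Rightarrow> cell" where
  "left_of c = (\<lambda>(x, y). if \<not> in_left x y then (x, y)
     else if odd (x + y) then (if y \<in> c (nat x) then (x, pick c (nat x) y) else (x - 1, y))
     else (if y \<in> c (Suc (nat x)) then (x, inv_into (c (nat x)) (pick c (nat x)) y) else (x + 1, y)))"

definition match_of :: "(nat \<Rightarrow> int set) \<Rightarrow> cell \<Rightarrow> cell" where
  "match_of c p = (if fst p < int A then left_of c p else rot (left_of c (rot p)))"

lemma pick_moves:
  assumes "c \<in> confs" "k < A"
  shows "moves (pick c k) (c k) (c (Suc k) - D (Suc k))"
  unfolding pick_def using confsD(3)[OF assms] unfolding step_moves by (rule someI_ex)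

lemma fst_rot: "fst (rot p) = 2 * int A - 1 - fst p"
  by (simp add: rot_def split: prod.splits)

lemma match_of_rot: "match_of c (rot p) = rot (match_of c p)"
  by (auto simp: match_of_def fst_rot)

lemma left_of_int:
  "left_of c (int k, y) = (if \<not> in_left (int k) y then (int k, y)
     else if odd (int k + y) then (if y \<in> c k then (int k, pick c k y) else (int k - 1, y))
     else (if y \<in> c (Suc k) then (int k, inv_into (c k) (pick c k) y) else (int k + 1, y)))"
  by (simp add: left_of_def)

lemma match_of_left:
  assumes c: "c \<in> confs" and k: "k < A" and y: "in_left (int k) y"
  shows "match_of c (match_of c (int k, y)) = (int k, y) \<and> adj (int k, y) (match_of c (int k, y))"
proof -
  note f = pick_moves[OF c k]
  have fb: "bij_betw (pick c k) (c k) (c (Suc k) - D (Suc k))" using f by (simp add: moves_def)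
  have M: "match_of c (int k, z) = left_of c (int k, z)" for z using k by (simp add: match_of_def)
  have M0: "match_of c (int k, y) = left_of c (int k, y)" using M .
  show ?thesis
  proof (cases "odd (int k + y)")
    case o: True
    show ?thesis
    proof (cases "y \<in> c k")
      case True
      let ?z = "pick c k y"
      have z: "?z = y + 1 \<or> ?z = y - 1" using f True by (simp add: moves_def)
      have zc: "?z \<in> c (Suc k) - D (Suc k)" using fb True by (rule bij_betwE[THEN bspec])
      have "in_left (int k) ?z" using confs_in_left_Suc[OF c k] zc by simp
      moreover have "\<not> odd (int k + ?z)" using z o by auto
      moreover have "inv_into (c k) (pick c k) ?z = y" by (rule bij_betw_inv_into_left[OF fb True])
      ultimately have "left_of c (int k, ?z) = (int k, y)" using zc unfolding left_of_int by simp
      moreover have "left_of c (int k, y) = (int k, ?z)" unfolding left_of_int using y o True by simp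
      ultimately show ?thesis unfolding M0 using z by (auto simp: M adj_def)
    next
      case False
      have "k \<noteq> 0"
      proof
        assume "k = 0"
        then have "y \<in> D 0" using y o by (simp add: mem_enter2_0 in_left_def)
        then show False using False confsD(1)[OF c] \<open>k = 0\<close> by simp
      qed
      then obtain j where j: "k = Suc j" by (cases k) auto
      have "in_left (int k - 1) y \<or> (\<exists>q\<in>Q. int k = int q \<and> \<bar>y\<bar> = 1)"
        by (rule in_left_left_neighbour) (use y o j in auto)
      moreover have "\<not> (\<exists>q\<in>Q. int k = int q \<and> \<bar>y\<bar> = 1)"
      proof
        assume "\<exists>q\<in>Q. int k = int q \<and> \<bar>y\<bar> = 1"
        then have "k \<in> Q" "y = 1 \<or> y = -1" by auto
        then have "y \<in> D (Suc j)" using j by auto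
        then show False using confsD(2)[OF c, of j] False j k by auto
      qed
      ultimately have "in_left (int k - 1) y" by blast
      then have l: "in_left (int j) y" using j by simp
      have "left_of c (int k, y) = (int j, y)" unfolding left_of_int using y o False j by simp
      moreover have "left_of c (int j, y) = (int k, y)" unfolding left_of_int using l o False j by simp
      moreover have "match_of c (int j, y) = left_of c (int j, y)" using j k by (simp add: match_of_def)
      ultimately show ?thesis unfolding M0 using o j by (simp add: adj_def)
    qed
  next
    case e: False
    show ?thesis
    proof (cases "y \<in> c (Suc k)")
      case True
      have yD: "y \<notin> D (Suc k)" using D_Suc_not_in_left[of y k] y by blast
      then have yc: "y \<in> c (Suc k) - D (Suc k)" using True by blast
      let ?z = "inv_into (c k) (pick c k) y"
      have z: "?z \<in> c k" "pick c k ?z = y"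
        using bij_betw_inv_into_right[OF fb yc] bij_betwE[OF bij_betw_inv_into[OF fb]] yc by auto
      then have zy: "y = ?z + 1 \<or> y = ?z - 1" using f by (auto simp: moves_def)
      have "in_left (int k) ?z" using confs_in_left[OF c k z(1)] .
      moreover have "odd (int k + ?z)" using zy e by presburger
      ultimately have "left_of c (int k, ?z) = (int k, y)" using z unfolding left_of_int by simp
      moreover have "left_of c (int k, y) = (int k, ?z)" unfolding left_of_int using y e True by simp
      ultimately show ?thesis unfolding M0 using zy by (auto simp: M adj_def)
    next
      case False
      have l: "left_of c (int k, y) = (int k + 1, y)" unfolding left_of_int using y e False by simp
      show ?thesis
      proof (cases "Suc k < A")
        case True
        have "in_left (int k + 1) y" by (rule in_left_right_neighbour) (use e y True in auto)
        then have i: "in_left (int (Suc k)) y" by (simp add: add.commute)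
        have "left_of c (int (Suc k), y) = (int k, y)" unfolding left_of_int using i e False by simp
        moreover have "match_of c (int (Suc k), y) = left_of c (int (Suc k), y)" using True by (simp add: match_of_def)
        ultimately show ?thesis unfolding M0 l using e by (simp add: adj_def add.commute)
      next
        case False': False
        then have kA: "A = Suc k" using k by simp
        \<comment> \<open>Across the central line the partner is computed in the rotated half, at
          height \<open>- y\<close>. The symmetry of \<open>c A\<close> makes the two halves
          agree.\<close>
        have "- y \<notin> c (Suc k)" using confsD(5)[OF c, of "- y"] False kA by auto
        then have "left_of c (int k, - y) = (int k + 1, - y)" unfolding left_of_int using y e by simp
        moreover have "int A = int k + 1" using kA by simp
        ultimately have "match_of c (int k + 1, y) = (int k, y)" by (simp add: match_of_def rot_def)
        then show ?thesis unfolding M0 l using e by (simp add: adj_def)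
      qed
    qed
  qed
qed

lemma match_of_rmatchings:
  assumes c: "c \<in> confs"
  shows "match_of c \<in> rmatchings"
proof -
  have L: "match_of c (match_of c p) = p \<and> (p \<in> region \<longrightarrow> adj p (match_of c p)) \<and> (p \<notin> region \<longrightarrow> match_of c p = p)"
    if x: "fst p < int A" for p
  proof -
    obtain x y where p: "p = (x, y)" by fastforce
    show ?thesis
    proof (cases "in_left x y")
      case True
      then obtain k where k: "x = int k" "k < A" using x p by (metis in_left_def fst_conv nonneg_int_cases of_nat_less_iff)
      then show ?thesis using match_of_left[OF c, of k y] True p x by (simp add: region_left)
    next
      case False
      then have "match_of c p = p" using x p by (simp add: match_of_def left_of_def)
      then show ?thesis using False p x by (simp add: region_left)
    qed
  qed
  have all: "match_of c (match_of c p) = p \<and> (p \<in> region \<longrightarrow> adj p (match_of c p)) \<and> (p \<notin> region \<longrightarrow> match_of c p = p)" for p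
  proof (cases "fst p < int A")
    case True
    then show ?thesis by (rule L)
  next
    case False
    then have "fst (rot p) < int A" by (simp add: fst_rot)
    note l = L[OF this]
    have r: "match_of c p = rot (match_of c (rot p))" using match_of_rot[of c "rot p"] by simp
    have "match_of c (match_of c p) = match_of c (rot (match_of c (rot p)))"
      using arg_cong[OF r, of "match_of c"] .
    also have "\<dots> = rot (match_of c (match_of c (rot p)))" by (rule match_of_rot)
    also have "\<dots> = p" using l by simp
    finally have "match_of c (match_of c p) = p" .
    moreover have "adj p (match_of c p)" if "p \<in> region"
      unfolding r using adj_rot[of "rot p"] l that rot_region[of p] by simp
    moreover have "match_of c p = p" if "p \<notin> region"
      unfolding r using l that rot_region[of p] by simp
    ultimately show ?thesis by blast
  qed
  show ?thesis unfolding rmatchings_def matchings_def commutes_def mem_Collect_eq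
    by (intro conjI allI ballI impI) (simp_all add: all match_of_rot del: split_paired_All)
qed

lemma seq_of_match_of:
  assumes c: "c \<in> confs"
  shows "seq_of (match_of c) = c"
proof
  fix k
  consider "k = 0" | "A < k" | j where "k = Suc j" "j < A" by (cases k) fastforce+
  then show "seq_of (match_of c) k = c k"
  proof cases
    case 1
    then show ?thesis using confsD(1)[OF c] by (simp add: seq_of_def)
  next
    case 2
    then show ?thesis using confsD(4)[OF c] by (simp add: seq_of_def)
  next
    case (3 j)
    have "y \<in> c k \<longleftrightarrow> y \<in> D k \<or> odd (y + int k) \<and> in_left (int j) y \<and> match_of c (int j, y) \<noteq> (int k, y)" for y
    proof -
      have l: "match_of c (int j, y) \<noteq> (int k, y) \<longleftrightarrow> y \<in> c k" if "in_left (int j) y" "odd (y + int k)"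
      proof -
        have "even (int j + y)" using that 3 by (simp add: add.commute)
        then show ?thesis using that 3 by (auto simp: match_of_def left_of_int)
      qed
      show ?thesis using confs_in_left_Suc[OF c 3(2), of y] confs_bounds(1)[OF c, of k y] l confsD(2)[OF c 3(2)] 3
        by (auto simp del: enter_simps)
    qed
    then show ?thesis using 3 by (auto simp: seq_of_def simp del: enter_simps)
  qed
qed

lemma match_of_seq_of:
  assumes m: "\<mu> \<in> rmatchings"
  shows "match_of (seq_of \<mu>) = \<mu>"
proof
  note mD = rmatchingsD[OF m]
  let ?c = "seq_of \<mu>"
  note c = seq_of_confs[OF m]
  have L: "match_of ?c p = \<mu> p" if x: "fst p < int A" for p
  proof -
    obtain x y where p: "p = (x, y)" by fastforce
    show ?thesis
    proof (cases "in_left x y")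
      case False
      then have "match_of ?c p = p" using x p by (simp add: match_of_def left_of_def)
      then show ?thesis using False p x mD(3)[of p] by (simp add: region_left)
    next
      case True
      then obtain k where k: "x = int k" "k < A" using x p by (metis in_left_def fst_conv nonneg_int_cases of_nat_less_iff)
      have i: "in_left (int k) y" using True k by simp
      have r: "(int k, y) \<in> region" using i k by (simp add: region_left)
      have fin: "finite (?c k)" using seqs_finite[of ?c k] c k by (simp add: confs_def)
      have pk: "pick ?c k z = snd (\<mu> (int k, z))" if "z \<in> ?c k" for z
        by (rule moves_unique[OF fin pick_moves[OF c k(2)] seq_of_moves(1)[OF m k(2)] that])
      have M: "match_of ?c p = left_of ?c (int k, y)" using k p by (simp add: match_of_def)
      have "left_of ?c (int k, y) = \<mu> (int k, y)"
      proof (cases "odd (int k + y)")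
        case o: True
        show ?thesis
        proof (cases "y \<in> ?c k")
          case True
          then show ?thesis unfolding left_of_int using i o pk[OF True] seq_of_moves(2)[OF m k(2) True] by simp
        next
          case False
          then have "\<mu> (int k, y) = (int k - 1, y)" using seq_of_right[OF m k(2)] i o by (auto simp: add.commute)
          then show ?thesis unfolding left_of_int using i o False by simp
        qed
      next
        case e: False
        have yD: "y \<notin> D (Suc k)" using D_Suc_not_in_left[of y k] i by blast
        show ?thesis
        proof (cases "y \<in> ?c (Suc k)")
          case True
          obtain z where z: "z \<in> ?c k" "\<mu> (int k, y) = (int k, z)" "\<mu> (int k, z) = (int k, y)"
            using seq_of_moves(3)[OF m k(2)] True yD by blast
          have "pick ?c k z = y" using pk[OF z(1)] z(3) by simp
          moreover have "bij_betw (pick ?c k) (?c k) (?c (Suc k) - D (Suc k))"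
            using pick_moves[OF c k(2)] by (simp add: moves_def)
          ultimately have "inv_into (?c k) (pick ?c k) y = z" using z(1) bij_betw_inv_into_left by metis
          then show ?thesis unfolding left_of_int using i e True z by simp
        next
          case False
          then have "\<mu> (int k, y) = (int k + 1, y)" using seq_of_left[OF k(2), of \<mu>] i e yD
            by (auto simp: add.commute simp del: enter_simps)
          then show ?thesis unfolding left_of_int using i e False by simp
        qed
      qed
      then show ?thesis using M k p by simp
    qed
  qed
  fix p show "match_of ?c p = \<mu> p"
  proof (cases "fst p < int A")
    case True
    then show ?thesis by (rule L)
  next
    case False
    then have "fst (rot p) < int A" by (simp add: fst_rot)
    then have "match_of ?c (rot p) = \<mu> (rot p)" by (rule L)
    then show ?thesis using match_of_rot[of ?c "rot p"] mD(5)[of "rot p"] by simp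
  qed
qed

lemma bij_seq_of: "bij_betw seq_of rmatchings confs"
  by (rule bij_betw_byWitness[of _ match_of])
     (use match_of_seq_of seq_of_match_of seq_of_confs match_of_rmatchings in auto)

section \<open>The horizontal reflection on path families\<close>

definition symmetric_seq :: "(nat \<Rightarrow> int set) \<Rightarrow> bool" where
  "symmetric_seq c \<longleftrightarrow> (\<forall>k. \<forall>y\<in>c k. - y \<in> c k)"

lemma flip_symmetry: "cell_symmetry region flip"
proof -
  have "flip (flip c) = c" "flip c \<in> region \<longleftrightarrow> c \<in> region" for c
    by (auto simp: flip_def region_def split: prod.splits)
  moreover have "adj (flip c) (flip d)" if "adj c d" for c d
    using that by (cases c; cases d) (auto simp: flip_def adj_def)
  ultimately show ?thesis unfolding cell_symmetry_def by blast
qed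

lemma rot_symmetry: "cell_symmetry region rot"
  unfolding cell_symmetry_def using rot_rot rot_region adj_rot by blast

lemma seq_of_flip:
  "seq_of (\<lambda>c. flip (\<mu> (flip c))) k = uminus ` seq_of \<mu> k"
proof -
  have D: "uminus ` D k = D k" for k by (auto simp: enter2_def image_Un image_image)
  have "flip (\<mu> (flip (x, y))) \<noteq> (x', y) \<longleftrightarrow> \<mu> (x, - y) \<noteq> (x', - y)" for x x' y
    by (cases "\<mu> (x, - y)") (auto simp: flip_def)
  then have "{y. odd (y + int k) \<and> in_left (int k - 1) y \<and> flip (\<mu> (flip (int k - 1, y))) \<noteq> (int k, y)} =
    {y. odd (- y + int k) \<and> in_left (int k - 1) (- y) \<and> \<mu> (int k - 1, - y) \<noteq> (int k, - y)}" by auto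
  also have "\<dots> = uminus ` {y. odd (y + int k) \<and> in_left (int k - 1) y \<and> \<mu> (int k - 1, y) \<noteq> (int k, y)}"
    by (auto intro!: image_eqI[of _ uminus "- _"])
  finally show ?thesis using D unfolding seq_of_def by (simp add: image_Un)
qed

text \<open>Conjugation by \<open>flip\<close> negates every set of the sequence
  (\<open>seq_of_flip\<close>), and \<open>seq_of\<close> is injective.\<close>

lemma commutes_flip_iff:
  assumes m: "\<mu> \<in> rmatchings"
  shows "commutes \<mu> flip \<longleftrightarrow> symmetric_seq (seq_of \<mu>)"
proof -
  let ?\<nu> = "\<lambda>c. flip (\<mu> (flip c))"
  have ff: "flip (flip c) = c" for c using flip_symmetry unfolding cell_symmetry_def by blast
  have "?\<nu> \<in> matchings region"
    by (rule conj_matching[OF _ flip_symmetry]) (use m in \<open>simp add: rmatchings_def\<close>)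
  moreover have rf: "rot (flip c) = flip (rot c)" for c by (simp add: rot_def flip_def split: prod.splits)
  have "commutes ?\<nu> rot" unfolding commutes_def by (simp only: rf[symmetric] rmatchingsD(5)[OF m] simp_thms)
  ultimately have nu: "?\<nu> \<in> rmatchings" by (simp add: rmatchings_def)
  have "commutes \<mu> flip \<longleftrightarrow> ?\<nu> = \<mu>" unfolding commutes_def fun_eq_iff by (metis ff)
  also have "\<dots> \<longleftrightarrow> seq_of ?\<nu> = seq_of \<mu>"
    by (rule inj_on_eq_iff[OF bij_betw_imp_inj_on[OF bij_seq_of] nu m, symmetric])
  also have "\<dots> \<longleftrightarrow> (\<forall>k. uminus ` seq_of \<mu> k = seq_of \<mu> k)" unfolding fun_eq_iff seq_of_flip ..
  also have "\<dots> \<longleftrightarrow> symmetric_seq (seq_of \<mu>)"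
  proof
    assume a: "\<forall>k. uminus ` seq_of \<mu> k = seq_of \<mu> k"
    show "symmetric_seq (seq_of \<mu>)" unfolding symmetric_seq_def using a by (metis imageI)
  next
    assume a: "symmetric_seq (seq_of \<mu>)"
    show "\<forall>k. uminus ` seq_of \<mu> k = seq_of \<mu> k"
    proof (intro allI equalityI subsetI)
      fix k y assume "y \<in> seq_of \<mu> k"
      then have "- y \<in> seq_of \<mu> k" using a by (auto simp: symmetric_seq_def)
      then show "y \<in> uminus ` seq_of \<mu> k" by (intro image_eqI[of _ _ "- y"]) simp_all
    qed (use a in \<open>auto simp: symmetric_seq_def\<close>)
  qed
  finally show ?thesis .
qed

end

section \<open>Numbers of paths, and families with their mirror images\<close>

lemma seqs_card:
  assumes c: "c \<in> seqs D W N" and D: "\<And>k. finite (D k)" and "k \<le> N"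
  shows "finite (c k) \<and> card (c k) = (\<Sum>j\<le>k. card (D j))"
  using assms(3)
proof (induction k)
  case 0
  then show ?case using c D by (simp add: seqs_def)
next
  case (Suc k)
  then have k: "D (Suc k) \<subseteq> c (Suc k)" "step (c k) (c (Suc k) - D (Suc k))" using c by (auto simp: seqs_def)
  then have "finite (c (Suc k) - D (Suc k))" using Suc step_finite[OF k(2)] by simp
  then have fin: "finite (c (Suc k))" using D[of "Suc k"] by simp
  have "card (c k) = card (c (Suc k)) - card (D (Suc k))"
    using step_card[OF k(2)] D k(1) by (simp add: card_Diff_subset)
  moreover have "card (D (Suc k)) \<le> card (c (Suc k))" using fin k(1) by (rule card_mono)
  ultimately show ?case using Suc fin by simp
qed

lemma finite_enter [simp]: "finite (enter b Q k)"
  by (simp add: enter_def)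

lemma enter_pos: "enter b Q k \<subseteq> {0<..}"
  by (auto simp: enter_def split: if_splits)

lemma pos_disjoint_minus:
  fixes X :: "int set"
  assumes "X \<subseteq> {0<..}" "Y \<subseteq> {0<..}"
  shows "X \<inter> uminus ` Y = {}"
proof -
  have "u \<noteq> - v" if "u \<in> X" "v \<in> Y" for u v
    using subsetD[OF assms(1) that(1)] subsetD[OF assms(2) that(2)] by simp
  then show ?thesis by blast
qed

lemma card_symmetric_union:
  fixes X :: "int set"
  assumes "finite X" "X \<subseteq> {0<..}"
  shows "card (X \<union> uminus ` X) = 2 * card X"
  using assms pos_disjoint_minus[OF assms(2,2)] by (simp add: card_Un_disjoint card_image)

lemma sum_card_enter: "(\<Sum>j\<le>k. card (enter b Q j)) = length (starts b Q k)"
proof (induction k)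
  case 0
  show ?case by (simp add: card_image inj_on_def)
qed simp

lemma sum_card_enter2: "(\<Sum>j\<le>k. card (enter2 b Q j)) = 2 * length (starts b Q k)"
proof -
  have "card (enter2 b Q j) = 2 * card (enter b Q j)" for j
    unfolding enter2_def by (rule card_symmetric_union) (use enter_pos in auto)
  then show ?thesis using sum_card_enter[of b Q k] by (simp flip: sum_distrib_left)
qed

lemma pos_part_union:
  fixes X :: "int set"
  assumes "X \<subseteq> {0<..}"
  shows "(X \<union> uminus ` X) \<inter> {0<..} = X"
  using assms by auto

lemma symmetric_set_split:
  fixes X :: "int set"
  assumes "\<And>y. y \<in> X \<Longrightarrow> - y \<in> X"
  shows "X - {0} = (X \<inter> {0<..}) \<union> uminus ` (X \<inter> {0<..})"
proof (intro equalityI subsetI)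
  fix y assume y: "y \<in> X - {0}"
  then consider "0 < y" | "0 < - y" by fastforce
  then show "y \<in> (X \<inter> {0<..}) \<union> uminus ` (X \<inter> {0<..})"
  proof cases
    case 2
    then have "- (- y) \<in> uminus ` (X \<inter> {0<..})" using assms y by (intro imageI) simp
    then show ?thesis by simp
  qed (use y in auto)
qed (use assms in auto)

text \<open>A step of length one can change the sign of the height only by way of 0.\<close>

lemma moves_pos_part:
  assumes f: "moves f S S'" and 0: "0 \<notin> S" "0 \<notin> S'"
  shows "moves f (S \<inter> {0<..}) (S' \<inter> {0<..})"
proof -
  have fs: "f v \<in> S'" "f v = v + 1 \<or> f v = v - 1" if "v \<in> S" for v
    using f that by (auto simp: moves_def bij_betw_def)
  have sgn: "f v > 0 \<longleftrightarrow> v > 0" if v: "v \<in> S" for v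
  proof -
    have "f v \<noteq> 0" "v \<noteq> 0" using fs(1)[OF v] v 0 by metis+
    then show ?thesis using fs(2)[OF v] by linarith
  qed
  have "f ` (S \<inter> {0<..}) = S' \<inter> {0<..}"
  proof (intro equalityI subsetI)
    fix w assume w: "w \<in> S' \<inter> {0<..}"
    then obtain v where "v \<in> S" "w = f v" using f by (auto simp: moves_def bij_betw_def)
    then show "w \<in> f ` (S \<inter> {0<..})" using sgn w by auto
  qed (use fs sgn in auto)
  moreover have "inj_on f (S \<inter> {0<..})" using f by (auto simp: moves_def bij_betw_def intro: inj_on_subset)
  ultimately show ?thesis using fs(2) by (simp add: moves_def bij_betw_def)
qed

lemma moves_minus:
  assumes f: "moves f S S'"
  shows "moves (\<lambda>v. - f (- v)) (uminus ` S) (uminus ` S')"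
proof -
  have "bij_betw (uminus \<circ> (f \<circ> uminus)) (uminus ` S) (uminus ` S')"
  proof (rule bij_betw_trans, rule bij_betw_trans)
    show "bij_betw uminus (uminus ` S) S" by (rule bij_betw_byWitness[of _ uminus]) auto
    show "bij_betw f S S'" using f by (simp add: moves_def)
    show "bij_betw uminus S' (uminus ` S')" by (simp add: bij_betw_def)
  qed
  then have "bij_betw (\<lambda>v. - f (- v)) (uminus ` S) (uminus ` S')" by (simp add: comp_def)
  moreover have "- f (- v) = v + 1 \<or> - f (- v) = v - 1" if "v \<in> uminus ` S" for v
  proof -
    have "- v \<in> S" using that by auto
    then have "f (- v) = - v + 1 \<or> f (- v) = - v - 1" using f unfolding moves_def by blast
    then show ?thesis by auto
  qed
  ultimately show ?thesis by (simp add: moves_def)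
qed

lemma step_double:
  assumes st: "step S S'" and pos: "S \<subseteq> {0<..}" "S' \<subseteq> {0<..}"
  shows "step (S \<union> uminus ` S) (S' \<union> uminus ` S')"
proof -
  obtain f where f: "moves f S S'" using st by (auto simp: step_moves)
  let ?g = "\<lambda>v. if 0 < v then f v else - f (- v)"
  have 1: "bij_betw ?g S S'"
    using f pos by (subst bij_betw_cong[of S ?g f]) (auto simp: moves_def)
  have 2: "bij_betw ?g (uminus ` S) (uminus ` S')"
    using moves_minus[OF f] pos by (subst bij_betw_cong[of "uminus ` S" ?g "\<lambda>v. - f (- v)"]) (auto simp: moves_def)
  have "bij_betw ?g (S \<union> uminus ` S) (S' \<union> uminus ` S')"
    by (rule bij_betw_combine[OF 1 2 pos_disjoint_minus[OF pos(2,2)]])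
  moreover have "?g v = v + 1 \<or> ?g v = v - 1" if "v \<in> S \<union> uminus ` S" for v
    using that
  proof
    assume "v \<in> S"
    then show ?thesis using f pos by (auto simp: moves_def)
  next
    assume v: "v \<in> uminus ` S"
    then have "\<not> 0 < v" using pos by auto
    moreover have "- f (- v) = v + 1 \<or> - f (- v) = v - 1"
      using moves_minus[OF f] v unfolding moves_def by blast
    ultimately show ?thesis by simp
  qed
  ultimately show ?thesis unfolding step_def by blast
qed

context wedge
begin

lemma finite_D [simp]: "finite (D k)"
  by (simp add: enter2_def)

text \<open>The number of paths is even, as they enter in mirror pairs, whereas a finite symmetric
  set that contains 0 has odd size.\<close>

lemma confs_zero:
  assumes c: "c \<in> confs"
  shows "0 \<notin> c A"
proof
  assume 0: "0 \<in> c A"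
  have s: "c \<in> seqs D UNIV A" using c by (simp add: confs_def)
  let ?T = "c A \<inter> {0<..}"
  have fin: "finite (c A)" and card: "card (c A) = 2 * length (starts b Q A)"
    using seqs_card[OF s, of A] by (auto simp: sum_card_enter2)
  have "c A - {0} = ?T \<union> uminus ` ?T" by (rule symmetric_set_split) (rule confsD(5)[OF c])
  moreover have "card (?T \<union> uminus ` ?T) = 2 * card ?T" using fin by (intro card_symmetric_union) auto
  ultimately have "card (c A - {0}) = 2 * card ?T" by simp
  moreover have "card (c A) = Suc (card (c A - {0}))" by (rule card.remove[OF fin 0])
  ultimately have "2 * length (starts b Q A) = Suc (2 * card ?T)" using card by simp
  then show False by presburger
qed

lemma confs_split:
  assumes c: "c \<in> confs"
  shows "c A = (c A \<inter> {0<..}) \<union> uminus ` (c A \<inter> {0<..})"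
proof -
  have "c A = c A - {0}" using confs_zero[OF c] by simp
  also have "\<dots> = (c A \<inter> {0<..}) \<union> uminus ` (c A \<inter> {0<..})"
    by (rule symmetric_set_split) (rule confsD(5)[OF c])
  finally show ?thesis .
qed

abbreviation "ends_sets \<equiv> {T. T \<subseteq> ends b A n \<and> card T = length (starts b Q A)}"

lemma finite_ends_sets: "finite ends_sets"
  by (rule finite_subset[of _ "Pow (ends b A n)"]) (auto simp: finite_ends)

lemma ends_pos: "T \<in> ends_sets \<Longrightarrow> T \<subseteq> {0<..} \<and> finite T"
  using finite_subset[OF _ finite_ends] by (auto simp: ends_def)

lemma card_confs: "card confs = (\<Sum>T\<in>ends_sets. cnt D UNIV A (T \<union> uminus ` T))"
proof -
  let ?B = "\<lambda>T. {c\<in>seqs D UNIV A. c A = T \<union> uminus ` T}"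
  have "confs = (\<Union>T\<in>ends_sets. ?B T)"
  proof (intro equalityI subsetI)
    fix c assume c: "c \<in> confs"
    let ?T = "c A \<inter> {0<..}"
    have s: "c \<in> seqs D UNIV A" using c by (simp add: confs_def)
    have "?T \<subseteq> ends b A n"
    proof
      fix y assume y: "y \<in> ?T"
      then have "odd (y + int A)" "\<bar>y\<bar> \<le> 2 * int b + int A" "int n \<le> \<bar>y\<bar>"
        using confs_bounds[OF c, of A y] confsD(6)[OF c, of y] by auto
      then show "y \<in> ends b A n" using y by (simp add: ends_def)
    qed
    moreover have "card ?T = length (starts b Q A)"
    proof -
      have "finite ?T" and "card (c A) = 2 * length (starts b Q A)"
        using seqs_card[OF s, of A] by (auto simp: sum_card_enter2)
      then show ?thesis using card_symmetric_union[of ?T] confs_split[OF c] by simp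
    qed
    ultimately show "c \<in> (\<Union>T\<in>ends_sets. ?B T)" using confs_split[OF c] s by blast
  next
    fix c assume "c \<in> (\<Union>T\<in>ends_sets. ?B T)"
    then obtain T where T: "T \<subseteq> ends b A n" "c \<in> seqs D UNIV A" "c A = T \<union> uminus ` T" by blast
    have "int n \<le> \<bar>y\<bar>" if "y \<in> c A" for y using that T(1) unfolding T(3) by (auto simp: ends_def)
    moreover have "- y \<in> c A" if "y \<in> c A" for y using that unfolding T(3) by auto
    ultimately show "c \<in> confs" using T(2) by (simp add: confs_def final_def)
  qed
  moreover have "card (\<Union>T\<in>ends_sets. ?B T) = (\<Sum>T\<in>ends_sets. card (?B T))"
  proof (rule card_UN_disjoint[OF finite_ends_sets])
    show "\<forall>T\<in>ends_sets. finite (?B T)"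
    proof
      fix T assume "T \<in> ends_sets"
      then show "finite (?B T)" using card_seqs[of "T \<union> uminus ` T" D UNIV A] ends_pos[of T] by simp
    qed
    show "\<forall>T\<in>ends_sets. \<forall>T'\<in>ends_sets. T \<noteq> T' \<longrightarrow> ?B T \<inter> ?B T' = {}"
    proof (intro ballI impI, rule ccontr)
      fix T T' assume T: "T \<in> ends_sets" "T' \<in> ends_sets" "T \<noteq> T'" "?B T \<inter> ?B T' \<noteq> {}"
      then have "T \<union> uminus ` T = T' \<union> uminus ` T'" by blast
      then show False using pos_part_union[of T] pos_part_union[of T'] ends_pos[OF T(1)] ends_pos[OF T(2)] T(3) by metis
    qed
  qed
  moreover have "card (?B T) = cnt D UNIV A (T \<union> uminus ` T)" if "T \<in> ends_sets" for T
    using card_seqs[of "T \<union> uminus ` T" D UNIV A] ends_pos[OF that] by simp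
  ultimately show ?thesis by simp
qed

section \<open>Symmetric families as doubles of families in the upper half plane\<close>

definition half_confs :: "(nat \<Rightarrow> int set) set" where
  "half_confs = {c\<in>seqs (enter b Q) {0<..} A. \<forall>y\<in>c A. int n \<le> y}"

lemma D_pos_part: "D k \<inter> {0<..} = enter b Q k"
  unfolding enter2_def by (rule pos_part_union[OF enter_pos])

lemma half_confs_pos:
  assumes "c \<in> half_confs"
  shows "c k \<subseteq> {0<..}"
proof (cases k)
  case 0
  then show ?thesis using assms enter_pos by (auto simp: half_confs_def seqs_def simp del: enter_simps)
next
  case (Suc j)
  then show ?thesis using assms by (cases "j < A") (auto simp: half_confs_def seqs_def)
qed

lemma double_confs:
  assumes c: "c \<in> half_confs"
  shows "(\<lambda>k. c k \<union> uminus ` c k) \<in> confs" "symmetric_seq (\<lambda>k. c k \<union> uminus ` c k)"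
proof -
  have s: "c 0 = enter b Q 0" "\<And>k. k < A \<Longrightarrow> enter b Q (Suc k) \<subseteq> c (Suc k)"
    "\<And>k. k < A \<Longrightarrow> step (c k) (c (Suc k) - enter b Q (Suc k))" "\<And>k. A < k \<Longrightarrow> c k = {}"
    "\<And>y. y \<in> c A \<Longrightarrow> int n \<le> y"
    using c by (auto simp: half_confs_def seqs_def)
  have "step (c k \<union> uminus ` c k) (c (Suc k) \<union> uminus ` c (Suc k) - D (Suc k))" if k: "k < A" for k
  proof -
    let ?X = "c (Suc k) - enter b Q (Suc k)"
    have p: "c (Suc k) \<subseteq> {0<..}" "c k \<subseteq> {0<..}" using half_confs_pos[OF c] by auto
    have "c (Suc k) \<union> uminus ` c (Suc k) - D (Suc k) = ?X \<union> uminus ` ?X"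
      unfolding enter2_def
      using pos_disjoint_minus[OF p(1) enter_pos[of b Q "Suc k"]] pos_disjoint_minus[OF enter_pos[of b Q "Suc k"] p(1)]
      by (auto simp del: enter_simps)
    moreover have "step (c k \<union> uminus ` c k) (?X \<union> uminus ` ?X)"
      by (rule step_double[OF s(3)[OF k] p(2)]) (use p in auto)
    ultimately show ?thesis by simp
  qed
  moreover have "D (Suc k) \<subseteq> c (Suc k) \<union> uminus ` c (Suc k)" if "k < A" for k
    using s(2)[OF that] unfolding enter2_def by blast
  moreover have "c 0 \<union> uminus ` c 0 = D 0" by (simp only: s(1) enter2_def)
  moreover have "c k \<union> uminus ` c k = {}" if "A < k" for k using s(4)[OF that] by simp
  moreover have "- y \<in> c A \<union> uminus ` c A \<and> int n \<le> \<bar>y\<bar>" if "y \<in> c A \<union> uminus ` c A" for y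
    using that s(5) by fastforce
  ultimately show "(\<lambda>k. c k \<union> uminus ` c k) \<in> confs" by (simp add: confs_def seqs_def final_def)
  show "symmetric_seq (\<lambda>k. c k \<union> uminus ` c k)" by (auto simp: symmetric_seq_def)
qed

text \<open>The mirror image of a step between symmetric sets is again a step between them, hence
  the same one by \<open>moves_unique\<close>. If it led from \<open>z\<close> to 0, it would also
  lead from \<open>- z\<close> to 0, against injectivity.\<close>

lemma symmetric_confs_zero:
  assumes c: "c \<in> confs" and sym: "symmetric_seq c"
  shows "0 \<notin> c k"
proof
  assume 0: "0 \<in> c k"
  then have kA: "k \<le> A" using confsD(4)[OF c, of k] by (cases "k \<le> A") auto
  have "k \<noteq> 0"
  proof
    assume "k = 0"
    then show False using 0 confs_bounds(1)[OF c kA 0] by simp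
  qed
  then obtain j where j: "k = Suc j" "j < A" using kA by (cases k) auto
  obtain f where f: "moves f (c j) (c (Suc j) - D (Suc j))" using confsD(3)[OF c j(2)] by (auto simp: step_moves)
  have flip_set: "uminus ` X = X" if "\<And>y. y \<in> X \<Longrightarrow> - y \<in> X" for X :: "int set"
  proof (intro equalityI subsetI)
    fix y assume "y \<in> X"
    then have "- (- y) \<in> uminus ` X" using that by blast
    then show "y \<in> uminus ` X" by simp
  qed (use that in auto)
  have "0 \<notin> D (Suc j)" by auto
  then have "0 \<in> c (Suc j) - D (Suc j)" using 0 j by blast
  then obtain z where z: "z \<in> c j" "f z = 0" using f by (force simp: moves_def bij_betw_def)
  have z1: "z \<noteq> 0" using f z by (auto simp: moves_def)
  have 1: "uminus ` c j = c j" by (rule flip_set) (use sym in \<open>auto simp: symmetric_seq_def\<close>)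
  have 2: "uminus ` (c (Suc j) - D (Suc j)) = c (Suc j) - D (Suc j)"
  proof (rule flip_set)
    fix y assume y: "y \<in> c (Suc j) - D (Suc j)"
    then have "- y \<in> c (Suc j)" using sym unfolding symmetric_seq_def by blast
    moreover have "- y \<notin> D (Suc j)" using D_minus[of "- y" "Suc j"] y by (auto simp del: enter_simps)
    ultimately show "- y \<in> c (Suc j) - D (Suc j)" by blast
  qed
  have g: "moves (\<lambda>v. - f (- v)) (c j) (c (Suc j) - D (Suc j))" using moves_minus[OF f] unfolding 1 2 .
  have mz: "- z \<in> c j" using z sym by (auto simp: symmetric_seq_def)
  have "finite (c j)" using seqs_finite[of c j] c j by (simp add: confs_def)
  then have "f (- z) = - f (- (- z))" using moves_unique[OF _ f g mz] by simp
  then have "f (- z) = f z" using z by simp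
  then have "- z = z" using f mz z(1) unfolding moves_def bij_betw_def inj_on_def by blast
  then show False using z1 by simp
qed

lemma half_symmetric:
  assumes c: "c \<in> confs" and sym: "symmetric_seq c"
  shows "(\<lambda>k. c k \<inter> {0<..}) \<in> half_confs"
proof -
  have "step (c k \<inter> {0<..}) (c (Suc k) \<inter> {0<..} - enter b Q (Suc k))" if k: "k < A" for k
  proof -
    obtain f where f: "moves f (c k) (c (Suc k) - D (Suc k))" using confsD(3)[OF c k] by (auto simp: step_moves)
    have "moves f (c k \<inter> {0<..}) ((c (Suc k) - D (Suc k)) \<inter> {0<..})"
      by (rule moves_pos_part[OF f]) (use symmetric_confs_zero[OF c sym] in auto)
    moreover have "(c (Suc k) - D (Suc k)) \<inter> {0<..} = c (Suc k) \<inter> {0<..} - enter b Q (Suc k)"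
      using D_pos_part[of "Suc k"] by blast
    ultimately show ?thesis by (auto simp: step_moves)
  qed
  moreover have "enter b Q (Suc k) \<subseteq> c (Suc k) \<inter> {0<..}" if "k < A" for k
    using confsD(2)[OF c that] D_pos_part[of "Suc k"] by blast
  moreover have "c 0 \<inter> {0<..} = enter b Q 0" using confsD(1)[OF c] D_pos_part[of 0] by simp
  ultimately show ?thesis using confsD(4)[OF c] confsD(6)[OF c]
    by (fastforce simp: half_confs_def seqs_def simp del: enter_simps)
qed

lemma card_symmetric_confs: "card {c\<in>confs. symmetric_seq c} = card half_confs"
proof (rule bij_betw_same_card, rule bij_betw_byWitness[of _ "\<lambda>c k. c k \<union> uminus ` c k"])
  show "\<forall>c\<in>{c\<in>confs. symmetric_seq c}. (\<lambda>k. (c k \<inter> {0<..}) \<union> uminus ` (c k \<inter> {0<..})) = c"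
  proof
    fix c assume "c \<in> {c\<in>confs. symmetric_seq c}"
    then have c: "c \<in> confs" and sym: "symmetric_seq c" by auto
    show "(\<lambda>k. (c k \<inter> {0<..}) \<union> uminus ` (c k \<inter> {0<..})) = c"
    proof
      fix k
      have "- y \<in> c k" if "y \<in> c k" for y using sym that by (simp add: symmetric_seq_def)
      then have "(c k \<inter> {0<..}) \<union> uminus ` (c k \<inter> {0<..}) = c k - {0}" by (rule symmetric_set_split[symmetric])
      also have "\<dots> = c k" using symmetric_confs_zero[OF c sym, of k] by simp
      finally show "(c k \<inter> {0<..}) \<union> uminus ` (c k \<inter> {0<..}) = c k" .
    qed
  qed
  show "\<forall>c\<in>half_confs. (\<lambda>k. (c k \<union> uminus ` c k) \<inter> {0<..}) = c"
    using half_confs_pos pos_part_union by (auto simp: fun_eq_iff)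
  show "(\<lambda>c k. c k \<inter> {0<..}) ` {c\<in>confs. symmetric_seq c} \<subseteq> half_confs" using half_symmetric by auto
  show "(\<lambda>c k. c k \<union> uminus ` c k) ` half_confs \<subseteq> {c\<in>confs. symmetric_seq c}" using double_confs by auto
qed

lemma card_half_confs: "card half_confs = (\<Sum>T\<in>ends_sets. cnt (enter b Q) {0<..} A T)"
proof -
  let ?B = "\<lambda>T. {c\<in>seqs (enter b Q) {0<..} A. c A = T}"
  have "half_confs = (\<Union>T\<in>ends_sets. ?B T)"
  proof (intro equalityI subsetI)
    fix c assume c: "c \<in> half_confs"
    have s: "c \<in> seqs (enter b Q) {0<..} A" using c by (simp add: half_confs_def)
    have "c A \<subseteq> ends b A n"
    proof
      fix y assume y: "y \<in> c A"
      have "odd (y + int A)" "\<bar>y\<bar> \<le> 2 * int b + int A"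
        using confs_bounds[OF double_confs(1)[OF c], of A y] y by auto
      moreover have "0 < y" "int n \<le> y" using y half_confs_pos[OF c] c by (auto simp: half_confs_def)
      ultimately show "y \<in> ends b A n" by (simp add: ends_def)
    qed
    moreover have "card (c A) = length (starts b Q A)"
      using seqs_card[OF s, of A] by (simp add: sum_card_enter)
    ultimately show "c \<in> (\<Union>T\<in>ends_sets. ?B T)" using s by blast
  next
    fix c assume "c \<in> (\<Union>T\<in>ends_sets. ?B T)"
    then show "c \<in> half_confs" by (auto simp: half_confs_def ends_def)
  qed
  moreover have "card (\<Union>T\<in>ends_sets. ?B T) = (\<Sum>T\<in>ends_sets. card (?B T))"
  proof (rule card_UN_disjoint[OF finite_ends_sets])
    show "\<forall>T\<in>ends_sets. finite (?B T)"
    proof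
      fix T assume "T \<in> ends_sets"
      then show "finite (?B T)" using card_seqs[of T "enter b Q" "{0<..}" A] ends_pos[of T] by simp
    qed
    show "\<forall>T\<in>ends_sets. \<forall>T'\<in>ends_sets. T \<noteq> T' \<longrightarrow> ?B T \<inter> ?B T' = {}" by blast
  qed
  moreover have "card (?B T) = cnt (enter b Q) {0<..} A T" if "T \<in> ends_sets" for T
    using card_seqs[of T "enter b Q" "{0<..}" A] ends_pos[OF that] by simp
  ultimately show ?thesis by simp
qed

lemma card_confs_square: "card confs = (card {c\<in>confs. symmetric_seq c})\<^sup>2"
  unfolding card_symmetric_confs card_half_confs card_confs
  by (rule cnt_square[OF b Q_even])

lemma card_rmatchings: "card rmatchings = (card {\<mu>\<in>rmatchings. commutes \<mu> flip})\<^sup>2"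
proof -
  have "bij_betw seq_of {\<mu>\<in>rmatchings. commutes \<mu> flip} {c\<in>confs. symmetric_seq c}"
  proof (rule bij_betw_subset[OF bij_seq_of])
    have surj: "seq_of ` rmatchings = confs" using bij_seq_of by (simp add: bij_betw_def)
    show "seq_of ` {\<mu>\<in>rmatchings. commutes \<mu> flip} = {c\<in>confs. symmetric_seq c}"
    proof (intro equalityI subsetI)
      fix c assume "c \<in> {c\<in>confs. symmetric_seq c}"
      then have c: "c \<in> seq_of ` rmatchings" "symmetric_seq c" unfolding surj by auto
      then obtain \<mu> where "\<mu> \<in> rmatchings" "c = seq_of \<mu>" by blast
      then show "c \<in> seq_of ` {\<mu>\<in>rmatchings. commutes \<mu> flip}" using c(2) commutes_flip_iff by blast
    next
      fix c assume "c \<in> seq_of ` {\<mu>\<in>rmatchings. commutes \<mu> flip}"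
      then obtain \<mu> where "\<mu> \<in> rmatchings" "commutes \<mu> flip" "c = seq_of \<mu>" by blast
      then show "c \<in> {c\<in>confs. symmetric_seq c}" using commutes_flip_iff seq_of_confs by blast
    qed
  qed blast
  then have "card {\<mu>\<in>rmatchings. commutes \<mu> flip} = card {c\<in>confs. symmetric_seq c}"
    by (rule bij_betw_same_card)
  moreover have "card rmatchings = card confs" using bij_betw_same_card[OF bij_seq_of] .
  ultimately show ?thesis using card_confs_square by simp
qed

section \<open>Cell symmetries as symmetries of the plane\<close>

lemma rot180_tri: "rot180 A (2 * b) ` tri (2 * int b) c = tri (2 * int b) (rot c)"
proof -
  obtain x y where c: "c = (x, y)" by fastforce
  have "even (2 * int A - 1 - x + - y) \<longleftrightarrow> odd (x + y)" by presburger
  then show ?thesis unfolding c rot_def tri_def prod.case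
    by (cases "even (x + y)") (auto simp: rot180_def)
qed

lemma refl_v_tri: "refl_v A ` tri (2 * int b) c = tri (2 * int b) (rot (flip c))"
proof -
  obtain x y where c: "c = (x, y)" by fastforce
  have "even (2 * int A - 1 - x + - (- y)) \<longleftrightarrow> odd (x + y)" by presburger
  then show ?thesis unfolding c rot_def flip_def tri_def prod.case
    by (cases "even (x + y)") (auto simp: refl_v_def)
qed

lemma rot_flip_symmetry: "cell_symmetry region (\<lambda>c. rot (flip c))"
proof -
  have "rot (flip c) = flip (rot c)" for c by (simp add: rot_def flip_def split: prod.splits)
  moreover have "flip (flip c) = c" "flip c \<in> region \<longleftrightarrow> c \<in> region" "adj c d \<Longrightarrow> adj (flip c) (flip d)" for c d
    using flip_symmetry unfolding cell_symmetry_def by blast+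
  ultimately show ?thesis unfolding cell_symmetry_def
    by (intro conjI allI impI) (simp_all only: rot_rot rot_region adj_rot)
qed

lemma M_sym_square:
  "M_sym {rot180 A (2 * b)} (tri (2 * int b) ` region) =
   (M_sym {rot180 A (2 * b), refl_v A} (tri (2 * int b) ` region))\<^sup>2"
proof -
  have "M_sym {rot180 A (2 * b)} (tri (2 * int b) ` region) =
    card {\<mu>\<in>matchings region. \<forall>f\<in>{rot180 A (2 * b)}. commutes \<mu> rot}"
    by (rule M_sym_matchings[of _ _ "\<lambda>_. rot"]) (use rot_symmetry rot180_tri in blast)
  then have 1: "M_sym {rot180 A (2 * b)} (tri (2 * int b) ` region) = card rmatchings"
    by (simp add: rmatchings_def)
  \<comment> \<open>The map \<open>?\<gamma>\<close> below distinguishes the two symmetries by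
    equality of functions, so they have to differ; since \<open>b\<close> is positive they do so at
    the origin.\<close>
  have "rot180 A (2 * b) (0, 0) \<noteq> refl_v A (0, 0)" using b by (simp add: rot180_def refl_v_def)
  then have ne: "refl_v A \<noteq> rot180 A (2 * b)" by metis
  let ?\<gamma> = "\<lambda>f. if f = rot180 A (2 * b) then rot else (\<lambda>c. rot (flip c))"
  have "M_sym {rot180 A (2 * b), refl_v A} (tri (2 * int b) ` region) =
    card {\<mu>\<in>matchings region. \<forall>f\<in>{rot180 A (2 * b), refl_v A}. commutes \<mu> (?\<gamma> f)}"
  proof (rule M_sym_matchings[of _ _ ?\<gamma>])
    fix f assume "f \<in> {rot180 A (2 * b), refl_v A}"
    then consider "f = rot180 A (2 * b)" | "f = refl_v A" by blast
    then show "cell_symmetry region (?\<gamma> f) \<and> (\<forall>c. f ` tri (2 * int b) c = tri (2 * int b) (?\<gamma> f c))"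
    proof cases
      case 1
      then show ?thesis using rot_symmetry rot180_tri by (simp del: split_paired_All)
    next
      case 2
      then show ?thesis using rot_flip_symmetry refl_v_tri ne by (simp del: split_paired_All)
    qed
  qed
  also have "{\<mu>\<in>matchings region. \<forall>f\<in>{rot180 A (2 * b), refl_v A}. commutes \<mu> (?\<gamma> f)} = {\<mu>\<in>rmatchings. commutes \<mu> flip}"
  proof -
    \<comment> \<open>For tilings invariant under the half turn, invariance under the vertical and
      under the horizontal reflection is the same.\<close>
    have "commutes \<mu> (\<lambda>c. rot (flip c)) \<longleftrightarrow> commutes \<mu> flip" if r: "commutes \<mu> rot" for \<mu>
    proof -
      have "\<mu> (rot (flip c)) = rot (\<mu> (flip c))" for c using r unfolding commutes_def by blast
      moreover have "rot u = rot v \<longleftrightarrow> u = v" for u v by (metis rot_rot)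
      ultimately show ?thesis unfolding commutes_def by simp
    qed
    then show ?thesis using ne by (auto simp: rmatchings_def)
  qed
  finally show ?thesis unfolding 1 by (simp add: card_rmatchings[symmetric])
qed

end

section \<open>The theorem\<close>

lemma tri_in_tris_in:
  assumes "even h"
  shows "tri h (x, y) \<in> tris_in P \<longleftrightarrow> (if even (x + y)
    then P (x, y + h) \<and> P (x + 1, y + h - 1) \<and> P (x + 1, y + h + 1)
    else P (x, y + h - 1) \<and> P (x, y + h + 1) \<and> P (x + 1, y + h))"
proof -
  have "tri h (x, y) \<in> unit_tris" using range_tri[OF assms] by blast
  then show ?thesis by (simp add: tris_in_def) (simp add: tri_def)
qed

text \<open>A cell is tested by its column and its central height instead of its three vertices. The
  condition at the vertices can be sharper by one, and parity closes this gap. The same applies to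
  the other regions below.\<close>

lemma tri_in_hexagon:
  "tri (2 * int b) (x, y) \<in> hexagon A (2 * b) \<longleftrightarrow>
    0 \<le> min x (2 * int A - 1 - x) \<and> \<bar>y\<bar> \<le> 2 * int b + min x (2 * int A - 1 - x)"
proof (cases "even (x + y)")
  case True
  then have "\<bar>y\<bar> \<noteq> 2 * int b + (2 * int A - 1 - x)" by presburger
  then show ?thesis unfolding hexagon_def using True by (subst tri_in_tris_in) auto
next
  case False
  then have "\<bar>y\<bar> \<noteq> 2 * int b + x" by presburger
  then show ?thesis unfolding hexagon_def using False by (subst tri_in_tris_in) auto
qed

lemma tri_in_left_tri2:
  "tri (2 * int b) (x, y) \<in> left_tri2 (2 * b) k \<longleftrightarrow> 2 * int k - 2 \<le> x \<and> x < 2 * int k \<and> \<bar>y\<bar> \<le> x - 2 * int k + 2"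
proof (cases "even (x + y)")
  case True
  then show ?thesis unfolding left_tri2_def by (subst tri_in_tris_in) auto
next
  case False
  then have "\<bar>y\<bar> \<noteq> x - 2 * int k + 2" by presburger
  then show ?thesis unfolding left_tri2_def using False by (subst tri_in_tris_in) auto
qed

lemma tri_in_right_tri2:
  "tri (2 * int b) (x, y) \<in> right_tri2 A (2 * b) k \<longleftrightarrow>
    2 * int k - 2 \<le> 2 * int A - 1 - x \<and> 2 * int A - 1 - x < 2 * int k \<and> \<bar>y\<bar> \<le> 2 * int A - 1 - x - 2 * int k + 2"
proof (cases "even (x + y)")
  case True
  then have "\<bar>y\<bar> \<noteq> 2 * int A - 1 - x - 2 * int k + 2" by presburger
  then show ?thesis unfolding right_tri2_def using True by (subst tri_in_tris_in) auto
next
  case False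
  then show ?thesis unfolding right_tri2_def by (subst tri_in_tris_in) auto
qed

lemma tri_in_center_rhombus:
  assumes "n = 0 \<or> odd n \<and> odd A"
  shows "tri (2 * int b) (x, y) \<in> center_rhombus A (2 * b) n \<longleftrightarrow>
    \<bar>y\<bar> \<le> min x (2 * int A - 1 - x) - int A + int n"
proof (cases "even (x + y)")
  case True
  have "x < int A \<or> \<bar>y\<bar> \<noteq> 2 * int A - 1 - x - int A + int n"
    using assms True by presburger
  then show ?thesis unfolding center_rhombus_def using True by (subst tri_in_tris_in) auto
next
  case False
  have "int A \<le> x \<or> \<bar>y\<bar> \<noteq> x - int A + int n"
    using assms False by presburger
  then show ?thesis unfolding center_rhombus_def using False by (subst tri_in_tris_in) auto
qed

lemma H_rh_region:
  assumes centre: "n = 0 \<or> odd n \<and> odd A \<and> n \<le> A" and b: "0 < b" and A: "0 < A"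
    and K: "\<And>k. k \<in> K \<Longrightarrow> 0 < k \<and> 2 * k \<le> A"
  defines "Q \<equiv> {2 * k |k. k \<in> K \<and> 2 * k + n \<le> A}"
  shows "wedge A b n Q" "H_rh A (2 * b) K n = tri (2 * int b) ` wedge.region A b n Q"
proof -
  show w: "wedge A b n Q" by unfold_locales (use assms in auto)
  interpret wedge A b n Q by (rule w)
  have mem: "tri (2 * int b) (x, y) \<in> H_rh A (2 * b) K n \<longleftrightarrow> (x, y) \<in> region" for x y
  proof -
    define z where "z = min x (2 * int A - 1 - x)"
    have z: "z < int A" by (auto simp: z_def)
    let ?hole = "\<lambda>k z. 2 * int k - 2 \<le> z \<and> z < 2 * int k \<and> \<bar>y\<bar> \<le> z - 2 * int k + 2"
    have lr: "(tri (2 * int b) (x, y) \<in> left_tri2 (2 * b) k \<or> tri (2 * int b) (x, y) \<in> right_tri2 A (2 * b) k) \<longleftrightarrow> ?hole k z"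
      if "k \<in> K" for k
      unfolding tri_in_left_tri2 tri_in_right_tri2 using K[OF that] by (auto simp: z_def min_def)
    \<comment> \<open>When \<open>n\<close> is nonzero, both \<open>2 * k\<close> and
      \<open>A - n\<close> are even, so a triangle whose vertical side lies to the right of the left
      corner \<open>A - n\<close> of the rhombus has its apex at or beyond that corner and lies
      inside the rhombus. This justifies leaving it out of \<open>Q\<close>.\<close>
    have absorbed: "\<bar>y\<bar> \<le> z - int A + int n" if "k \<in> K" "\<not> 2 * k + n \<le> A" "?hole k z" for k
    proof -
      have "int A - int n \<le> 2 * int k - 2" using centre K[OF that(1)] that(2) by presburger
      then show ?thesis using that(3) by linarith
    qed
    have "tri (2 * int b) (x, y) \<in> H_rh A (2 * b) K n \<longleftrightarrow>
      0 \<le> z \<and> \<bar>y\<bar> \<le> 2 * int b + z \<and> (\<forall>k\<in>K. \<not> ?hole k z) \<and> \<not> \<bar>y\<bar> \<le> z - int A + int n"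
      unfolding H_rh_def H_def Diff_iff UN_iff Un_iff tri_in_hexagon z_def[symmetric]
      using lr tri_in_center_rhombus[of n A b x y] centre by (auto simp: z_def[symmetric])
    also have "\<dots> \<longleftrightarrow> 0 \<le> z \<and> \<bar>y\<bar> \<le> 2 * int b + z \<and> (\<forall>k\<in>K. 2 * k + n \<le> A \<longrightarrow> \<not> ?hole k z) \<and> \<not> \<bar>y\<bar> \<le> z - int A + int n"
      using absorbed by blast
    also have "\<dots> \<longleftrightarrow> in_left z y"
      unfolding in_left_def unfolding Q_def by (auto simp: not_le)
    finally show ?thesis by (simp add: region_def z_def)
  qed
  show "H_rh A (2 * b) K n = tri (2 * int b) ` region"
  proof (intro equalityI subsetI)
    fix t assume t: "t \<in> H_rh A (2 * b) K n"
    then have "t \<in> unit_tris" by (simp add: H_rh_def H_def hexagon_def tris_in_def)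
    then have "t \<in> range (tri (2 * int b))" using range_tri[of "2 * int b"] by simp
    then obtain x y where "t = tri (2 * int b) (x, y)" by auto
    then show "t \<in> tri (2 * int b) ` region" using t mem by blast
  next
    fix t assume "t \<in> tri (2 * int b) ` region"
    then show "t \<in> H_rh A (2 * b) K n" using mem by auto
  qed
qed

lemma H_rh_square:
  assumes "n = 0 \<or> odd n \<and> odd A \<and> n \<le> A" "0 < b" "0 < A" "\<And>k. k \<in> K \<Longrightarrow> 0 < k \<and> 2 * k \<le> A"
  shows "M_sym {rot180 A (2 * b)} (H_rh A (2 * b) K n) =
    (M_sym {rot180 A (2 * b), refl_v A} (H_rh A (2 * b) K n))\<^sup>2"
  using wedge.M_sym_square[OF H_rh_region(1)[OF assms]] H_rh_region(2)[OF assms] by simp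

text \<open>A rhombus of side 0 contains no triangle, so the region without a rhombus is covered by
  \<open>H_rh_square\<close> with \<open>n = 0\<close>, for both parities of
  \<open>A\<close>.\<close>

lemma H_rh_0: "H_rh A (2 * b) K 0 = H A (2 * b) K"
proof -
  have "t \<notin> center_rhombus A (2 * b) 0" for t
  proof
    assume t: "t \<in> center_rhombus A (2 * b) 0"
    then have "t \<in> unit_tris" by (simp add: center_rhombus_def tris_in_def)
    then have "t \<in> range (tri (2 * int b))" using range_tri[of "2 * int b"] by simp
    then obtain x y where "t = tri (2 * int b) (x, y)" by auto
    then show False using t tri_in_center_rhombus[of 0 A b x y] by auto
  qed
  then show ?thesis by (auto simp: H_rh_def)
qed

theorem theorem2p1:
  fixes a b s x :: nat and k :: "nat \<Rightarrow> nat"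
  assumes "0 < a" and "0 < b" and "0 < s" and "0 < x" and "x \<le> a"
    and "0 < k 1" and "strict_mono_on {1..s} k" and "2 * k s \<le> a"
  shows "M_sym {rot180 a (2 * b)} (H a (2 * b) (k ` {1..s}))
           = (M_sym {rot180 a (2 * b), refl_v a} (H a (2 * b) (k ` {1..s}))) ^ 2
       \<and> M_sym {rot180 (2 * a - 1) (2 * b)} (H_rh (2 * a - 1) (2 * b) (k ` {1..s}) (2 * x - 1))
           = (M_sym {rot180 (2 * a - 1) (2 * b), refl_v (2 * a - 1)}
                (H_rh (2 * a - 1) (2 * b) (k ` {1..s}) (2 * x - 1))) ^ 2"
proof -
  have K: "0 < j \<and> 2 * j \<le> a" if j: "j \<in> k ` {1..s}" for j
  proof -
    obtain i where i: "i \<in> {1..s}" "j = k i" using j by blast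
    have "k 1 \<le> k i" "k i \<le> k s"
      using strict_mono_on_leD[OF assms(7)] i(1) assms(3) by auto
    then show ?thesis using assms(6,8) i(2) by linarith
  qed
  have "M_sym {rot180 a (2 * b)} (H_rh a (2 * b) (k ` {1..s}) 0)
      = (M_sym {rot180 a (2 * b), refl_v a} (H_rh a (2 * b) (k ` {1..s}) 0)) ^ 2"
    by (rule H_rh_square) (use assms K in auto)
  moreover have "M_sym {rot180 (2 * a - 1) (2 * b)} (H_rh (2 * a - 1) (2 * b) (k ` {1..s}) (2 * x - 1))
      = (M_sym {rot180 (2 * a - 1) (2 * b), refl_v (2 * a - 1)}
          (H_rh (2 * a - 1) (2 * b) (k ` {1..s}) (2 * x - 1))) ^ 2"
  proof (rule H_rh_square)
    show "0 < j \<and> 2 * j \<le> 2 * a - 1" if "j \<in> k ` {1..s}" for j using K[OF that] assms(1) by auto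
  qed (use assms in auto)
  ultimately show ?thesis unfolding H_rh_0 by blast
qed

end
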